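(* Let $T>0$, let $k\ge 1$ be an integer, let $c_2>0$, let $\mathbf y_0,\dot{\mathbf y}_0\in\mathbb R^2$ be fixed (independent of $\varepsilon$), and let $\mathbf E:\mathbb R^2\to\mathbb R^2$ have Lipschitz-continuous derivatives up to order $k$ (i.e. $\mathbf E$ is $C^k$ and all its partial derivatives of orders $0,1,\dots,k$ are globally Lipschitz on $\mathbb R^2$). Then there exist constants $\varepsilon_0>0$ and $C>0$, independent of $\varepsilon$ and of the time step, such that for every $0<\varepsilon\le\varepsilon_0$ and every integer $N\ge1$ for which $\Delta t=T/N$ satisfies $\Delta t>c_2\varepsilon$, the following holds with $t_n=n\Delta t$. Let $\mathbf y:[0,T/\varepsilon]\to\mathbb R^2$ be the solution of $$\ddot{\mathbf y}=\tfrac1\varepsilon J\dot{\mathbf y}+\mathbf E(\mathbf y),\qquad \mathbf y(0)=\mathbf y_0,\quad \dot{\mathbf y}(0)=\dot{\mathbf y}_0,\qquad J=\begin{bmatrix}0&1\\-1&0\end{bmatrix},$$ and let $(\mathbf Y_n,\dot{\mathbf Y}_n)_{n=0}^N$ be the numerical solutions produced by the order-$k$ local linear extension exponential integrator (defined in the context) with $\nu=1$, i.e. with actual step size $h=\Delta t/\varepsilon$. Then $$\|\mathbf y(t_n/\varepsilon)-\mathbf Y_n\|+\varepsilon\|\dot{\mathbf y}(t_n/\varepsilon)-\dot{\mathbf Y}_n\|\le C\,\Delta t^{k+1},\qquad n=0,1,\dots,N.$$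
   Context: $\|\cdot\|$ is the Euclidean norm. Multi-indices. Let $\mathbb I^{[k]}$ be the set of $\alpha=(\alpha_1,\alpha_2,\alpha_3,\alpha_4)$ with nonnegative integer entries and length $|\alpha|=\alpha_1+\alpha_2+\alpha_3+\alpha_4\le k$, and let $D^{[k]}$ be its cardinality. Let $e_1,\dots,e_4$ be the standard unit vectors of $\mathbb R^4$, regarded also as multi-indices. Vectors $v\in\mathbb R^{D^{[k]}}$ are indexed by multi-indices, $v=(v_\alpha)_{\alpha\in\mathbb I^{[k]}}$ (in any fixed ordering in which the zero multi-index comes first, then $e_1,e_2,e_3,e_4$, then the rest by increasing length). Let $e_1^{D^{[k]}}$ be the vector with entry $1$ at $\alpha=0$ and $0$ elsewhere, and let $\Pi_{\mathbf x}:\mathbb R^{D^{[k]}}\to\mathbb R^4$, $\Pi_{\mathbf x}v=(v_{e_1},v_{e_2},v_{e_3},v_{e_4})^\top$. Matrices. For $\hat{\mathbf x}=(\hat x_1,\hat x_2,\hat x_3,\hat x_4)^\top\in\mathbb R^4$ with $\hat{\mathbf y}=(\hat x_1,\hat x_2)^\top$, the $D^{[k]}\times D^{[k]}$ matrices $A_1^{[k]}(\hat{\mathbf x})$ and $A_0^{[k]}(\hat{\mathbf x})$ are defined by (terms whose coefficient $\alpha_j$ is zero are omitted) $$\begin{aligned}(A_1^{[k]}(\hat{\mathbf x})v)_\alpha={}&\alpha_1v_{\alpha-e_1+e_3}+\alpha_2v_{\alpha-e_2+e_4}+\alpha_1\hat x_3v_{\alpha-e_1}+\alpha_2\hat x_4v_{\alpha-e_2}\\&+\alpha_3v_{\alpha-e_3+e_4}-\alpha_4v_{\alpha-e_4+e_3}+\alpha_3\hat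 x_4v_{\alpha-e_3}-\alpha_4\hat x_3v_{\alpha-e_4},\end{aligned}$$ $$(A_0^{[k]}(\hat{\mathbf x})v)_\alpha=\sum_{\substack{\beta=(\beta_1,\beta_2,0,0)\\|\beta|\le k-|\alpha|+1}}\frac{1}{\beta_1!\beta_2!}\left(\alpha_3\,\partial^\beta E_1(\hat{\mathbf y})\,v_{\alpha+\beta-e_3}+\alpha_4\,\partial^\beta E_2(\hat{\mathbf y})\,v_{\alpha+\beta-e_4}\right),$$ where $\partial^\beta=\partial_{y_1}^{\beta_1}\partial_{y_2}^{\beta_2}$ and $\mathbf E=(E_1,E_2)^\top$. Scheme. For the problem on $[0,T/\varepsilon^\nu]$, $\nu\in\{0,1\}$, with $\Delta t=T/N$ and actual time step $h=\Delta t/\varepsilon^\nu$: set $\mathbf X_0=[\mathbf y_0^\top,\varepsilon\dot{\mathbf y}_0^\top]^\top\in\mathbb R^4$ and for $n=0,\dots,N-1$ $$\mathbf X_{n+1}=\mathbf X_n+\Pi_{\mathbf x}\exp\!\left(\left(\varepsilon^{-1-\nu}A_1^{[k]}(\mathbf X_n)+\varepsilon^{1-\nu}A_0^{[k]}(\mathbf X_n)\right)\Delta t\right)e_1^{D^{[k]}}.$$ The numerical position $\mathbf Y_n\in\mathbb R^2$ consists of the first two components of $\mathbf X_n$, and the numerical velocity $\dot{\mathbf Y}_n\in\mathbb R^2$ is $\varepsilon^{-1}$ times the last two components of $\mathbf X_n$. This is the order-$k$ local linear extension exponential integrator. The constants $\varepsilon_0,C$ may depend on $T$, $k$, $c_2$,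 $\mathbf E$, $\mathbf y_0$, $\dot{\mathbf y}_0$. *)

theory Defs
  imports "HOL-Analysis.Analysis"
begin

section \<open>Matrices indexed by a finite set\<close>

text \<open>
  A square matrix with rows and columns indexed by \<open>I\<close> is a function \<open>'i \<Rightarrow> 'i \<Rightarrow> real\<close> of which
  only the values on \<open>I \<times> I\<close> matter. A type-indexed dimension is not an option here, because the
  index set below depends on the order \<open>k\<close> of the method.
\<close>

definition mat_vec :: "'i set \<Rightarrow> ('i \<Rightarrow> 'i \<Rightarrow> real) \<Rightarrow> ('i \<Rightarrow> real) \<Rightarrow> 'i \<Rightarrow> real" where
  "mat_vec I M v i = (\<Sum>j\<in>I. M i j * v j)"

primrec mat_pow :: "'i set \<Rightarrow> ('i \<Rightarrow> 'i \<Rightarrow> real) \<Rightarrow> nat \<Rightarrow> 'i \<Rightarrow> 'i \<Rightarrow> real" where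
  "mat_pow I M 0 = (\<lambda>i j. if i = j then 1 else 0)"
| "mat_pow I M (Suc n) = (\<lambda>i j. \<Sum>l\<in>I. M i l * mat_pow I M n l j)"

definition mat_exp :: "'i set \<Rightarrow> ('i \<Rightarrow> 'i \<Rightarrow> real) \<Rightarrow> 'i \<Rightarrow> 'i \<Rightarrow> real" where
  "mat_exp I M i j = (\<Sum>n. mat_pow I M n i j / fact n)"

text \<open>The series is entrywise absolutely convergent, so its value is never a default one.\<close>

lemma mat_exp_summable:
  assumes "finite I" "i \<in> I" "j \<in> I"
  shows "summable (\<lambda>n. norm (mat_pow I M n i j / fact n))"
proof -
  define K where "K = (\<Sum>a\<in>I. \<Sum>b\<in>I. \<bar>M a b\<bar>)"
  have K: "(\<Sum>b\<in>I. \<bar>M a b\<bar>) \<le> K" if "a \<in> I" for a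
    unfolding K_def using assms(1) that
    by (intro member_le_sum[where f = "\<lambda>a. \<Sum>b\<in>I. \<bar>M a b\<bar>"]) (auto intro: sum_nonneg)
  have K0: "0 \<le> K" unfolding K_def by (intro sum_nonneg) auto
  have bd: "\<bar>mat_pow I M n a j\<bar> \<le> K ^ n" if "a \<in> I" for n a
    using that
  proof (induction n arbitrary: a)
    case 0 then show ?case by simp
  next
    case (Suc n)
    have "\<bar>mat_pow I M (Suc n) a j\<bar> \<le> (\<Sum>l\<in>I. \<bar>M a l\<bar> * \<bar>mat_pow I M n l j\<bar>)"
      using sum_abs[of "\<lambda>l. M a l * mat_pow I M n l j" I] by (simp add: abs_mult)
    also have "\<dots> \<le> (\<Sum>l\<in>I. \<bar>M a l\<bar> * K ^ n)"
      by (intro sum_mono mult_left_mono Suc.IH) auto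
    also have "\<dots> = (\<Sum>l\<in>I. \<bar>M a l\<bar>) * K ^ n" by (simp add: sum_distrib_right)
    also have "\<dots> \<le> K * K ^ n" using K[OF Suc.prems] K0 by (intro mult_right_mono) auto
    finally show ?case by simp
  qed
  have "summable (\<lambda>n. K ^ n / fact n)"
    using summable_exp[of K] by (simp add: field_simps)
  then show ?thesis
    by (rule summable_comparison_test'[where N = 0])
       (use bd[OF assms(2)] in \<open>auto intro!: divide_right_mono\<close>)
qed

section \<open>Multi-indices\<close>

type_synonym mindex = "nat ^ 4"

definition mlen :: "mindex \<Rightarrow> nat" where
  "mlen \<alpha> = (\<Sum>i\<in>UNIV. \<alpha> $ i)"

definition mindices :: "nat \<Rightarrow> mindex set" where
  "mindices k = {\<alpha>. mlen \<alpha> \<le> k}"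

abbreviation munit :: "4 \<Rightarrow> mindex" where
  "munit i \<equiv> axis i 1"

lemma finite_mindices [simp]: "finite (mindices k)"
proof -
  have "mindices k \<subseteq> (\<lambda>f. \<chi> i. f i) ` (UNIV \<rightarrow>\<^sub>E {..k})"
  proof
    fix \<alpha> :: mindex assume "\<alpha> \<in> mindices k"
    then have "\<alpha> $ i \<le> k" for i
      using member_le_sum[of i UNIV "\<lambda>i. \<alpha> $ i"] by (auto simp: mindices_def mlen_def)
    then show "\<alpha> \<in> (\<lambda>f. \<chi> i. f i) ` (UNIV \<rightarrow>\<^sub>E {..k})"
      by (intro image_eqI[where x = "\<lambda>i. \<alpha> $ i"]) (auto simp: vec_eq_iff)
  qed
  moreover have "finite ((UNIV :: 4 set) \<rightarrow>\<^sub>E {..k})"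
    by (intro finite_PiE) auto
  ultimately show ?thesis by (meson finite_imageI finite_subset)
qed

definition e1D :: "mindex \<Rightarrow> real" where
  "e1D \<alpha> = (if \<alpha> = 0 then 1 else 0)"

definition Pi_x :: "(mindex \<Rightarrow> real) \<Rightarrow> real ^ 4" where
  "Pi_x v = (\<chi> i. v (munit i))"

section \<open>Partial derivatives and the regularity class\<close>

definition pd :: "2 \<Rightarrow> (real ^ 2 \<Rightarrow> real) \<Rightarrow> real ^ 2 \<Rightarrow> real" where
  "pd i f y = deriv (\<lambda>t. f (y + t *\<^sub>R axis i 1)) 0"

definition pderiv_mi :: "nat \<Rightarrow> nat \<Rightarrow> (real ^ 2 \<Rightarrow> real) \<Rightarrow> real ^ 2 \<Rightarrow> real" where
  "pderiv_mi b1 b2 f = (pd 1 ^^ b1) ((pd 2 ^^ b2) f)"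

primrec Ck :: "nat \<Rightarrow> (real ^ 2 \<Rightarrow> real) \<Rightarrow> bool" where
  "Ck 0 f \<longleftrightarrow> continuous_on UNIV f"
| "Ck (Suc k) f \<longleftrightarrow> continuous_on UNIV f \<and>
     (\<forall>i. (\<forall>y. (\<lambda>t. f (y + t *\<^sub>R axis i 1)) differentiable (at 0)) \<and> Ck k (pd i f))"

definition Ck_Lipschitz :: "nat \<Rightarrow> (real ^ 2 \<Rightarrow> real ^ 2) \<Rightarrow> bool" where
  "Ck_Lipschitz k E \<longleftrightarrow>
     (\<forall>j. Ck k (\<lambda>y. E y $ j) \<and>
       (\<forall>b1 b2. b1 + b2 \<le> k \<longrightarrow> (\<exists>L. L-lipschitz_on UNIV (pderiv_mi b1 b2 (\<lambda>y. E y $ j)))))"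

section \<open>The matrices of the linear extension\<close>

text \<open>
  The matrices are given through their action on a vector. Subtraction of multi-indices is
  truncated, but whenever \<open>\<alpha> - munit j\<close> is not the true difference the coefficient \<open>\<alpha> $ j\<close> of the
  term is zero. For the same reason the derivatives of order \<open>k + 1\<close> that formally occur for
  \<open>\<alpha> = 0\<close> do not contribute.
\<close>

definition A1_act :: "real ^ 4 \<Rightarrow> (mindex \<Rightarrow> real) \<Rightarrow> mindex \<Rightarrow> real" where
  "A1_act x v \<alpha> =
     real (\<alpha> $ 1) * v (\<alpha> - munit 1 + munit 3)
   + real (\<alpha> $ 2) * v (\<alpha> - munit 2 + munit 4)
   + real (\<alpha> $ 1) * x $ 3 * v (\<alpha> - munit 1)
   + real (\<alpha> $ 2) * x $ 4 * v (\<alpha> - munit 2)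
   + real (\<alpha> $ 3) * v (\<alpha> - munit 3 + munit 4)
   - real (\<alpha> $ 4) * v (\<alpha> - munit 4 + munit 3)
   + real (\<alpha> $ 3) * x $ 4 * v (\<alpha> - munit 3)
   - real (\<alpha> $ 4) * x $ 3 * v (\<alpha> - munit 4)"

text \<open>The summation condition is \<open>|\<beta>| \<le> k - |\<alpha>| + 1\<close>, written without natural-number subtraction.\<close>

definition A0_act ::
  "(real ^ 2 \<Rightarrow> real ^ 2) \<Rightarrow> nat \<Rightarrow> real ^ 4 \<Rightarrow> (mindex \<Rightarrow> real) \<Rightarrow> mindex \<Rightarrow> real" where
  "A0_act E k x v \<alpha> =
     (\<Sum>\<beta> | \<beta> $ 3 = 0 \<and> \<beta> $ 4 = 0 \<and> mlen \<beta> + mlen \<alpha> \<le> k + 1.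
        1 / (fact (\<beta> $ 1) * fact (\<beta> $ 2)) *
        (real (\<alpha> $ 3) * pderiv_mi (\<beta> $ 1) (\<beta> $ 2) (\<lambda>y. E y $ 1) (vector [x $ 1, x $ 2])
           * v (\<alpha> + \<beta> - munit 3)
       + real (\<alpha> $ 4) * pderiv_mi (\<beta> $ 1) (\<beta> $ 2) (\<lambda>y. E y $ 2) (vector [x $ 1, x $ 2])
           * v (\<alpha> + \<beta> - munit 4)))"

definition unit_vec :: "mindex \<Rightarrow> mindex \<Rightarrow> real" where
  "unit_vec \<beta> \<alpha> = (if \<alpha> = \<beta> then 1 else 0)"

definition A1 :: "real ^ 4 \<Rightarrow> mindex \<Rightarrow> mindex \<Rightarrow> real" where
  "A1 x \<alpha> \<beta> = A1_act x (unit_vec \<beta>) \<alpha>"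

definition A0 :: "(real ^ 2 \<Rightarrow> real ^ 2) \<Rightarrow> nat \<Rightarrow> real ^ 4 \<Rightarrow> mindex \<Rightarrow> mindex \<Rightarrow> real" where
  "A0 E k x \<alpha> \<beta> = A0_act E k x (unit_vec \<beta>) \<alpha>"

lemma mlen_add: "mlen (\<alpha> + \<beta>) = mlen \<alpha> + mlen \<beta>"
  by (simp add: mlen_def sum.distrib)

lemma mlen_munit [simp]: "mlen (axis i (Suc 0)) = 1"
  by (simp add: mlen_def axis_def)

lemma mlen_diff_munit:
  assumes "0 < \<alpha> $ i"
  shows "mlen (\<alpha> - munit i) + 1 = mlen \<alpha>"
proof -
  have "\<alpha> - munit i + munit i = \<alpha>"
    using assms by (auto simp: vec_eq_iff axis_def)
  then show ?thesis using mlen_add[of "\<alpha> - munit i" "munit i"] by simp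
qed

lemma sum_unit_vec:
  assumes "c \<noteq> 0 \<Longrightarrow> \<gamma> \<in> mindices k"
  shows "(\<Sum>\<beta>\<in>mindices k. c * unit_vec \<beta> \<gamma> * v \<beta>) = c * v \<gamma>"
proof (cases "c = 0")
  case False
  have "(\<Sum>\<beta>\<in>mindices k. c * unit_vec \<beta> \<gamma> * v \<beta>)
      = (\<Sum>\<beta>\<in>mindices k. if \<beta> = \<gamma> then c * v \<gamma> else 0)"
    by (intro sum.cong) (auto simp: unit_vec_def)
  then show ?thesis using assms[OF False] by simp
qed simp

text \<open>
  On vectors indexed by \<open>mindices k\<close>, the matrices act by the given formulas; in particular every
  index with nonzero coefficient stays inside \<open>mindices k\<close>.
\<close>

lemma mat_vec_A1:
  assumes "\<alpha> \<in> mindices k"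
  shows "mat_vec (mindices k) (A1 x) v \<alpha> = A1_act x v \<alpha>"
proof -
  have i1: "\<alpha> - munit i \<in> mindices k" if "0 < \<alpha> $ i" for i
    using assms mlen_diff_munit[OF that] by (simp add: mindices_def)
  have i2: "\<alpha> - munit i + munit j \<in> mindices k" if "0 < \<alpha> $ i" for i j
    using assms mlen_diff_munit[OF that] by (simp add: mindices_def mlen_add)
  have "mat_vec (mindices k) (A1 x) v \<alpha> =
     (\<Sum>\<beta>\<in>mindices k. real (\<alpha> $ 1) * unit_vec \<beta> (\<alpha> - munit 1 + munit 3) * v \<beta>)
   + (\<Sum>\<beta>\<in>mindices k. real (\<alpha> $ 2) * unit_vec \<beta> (\<alpha> - munit 2 + munit 4) * v \<beta>)
   + (\<Sum>\<beta>\<in>mindices k. (real (\<alpha> $ 1) * x $ 3) * unit_vec \<beta> (\<alpha> - munit 1) * v \<beta>)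
   + (\<Sum>\<beta>\<in>mindices k. (real (\<alpha> $ 2) * x $ 4) * unit_vec \<beta> (\<alpha> - munit 2) * v \<beta>)
   + (\<Sum>\<beta>\<in>mindices k. real (\<alpha> $ 3) * unit_vec \<beta> (\<alpha> - munit 3 + munit 4) * v \<beta>)
   - (\<Sum>\<beta>\<in>mindices k. real (\<alpha> $ 4) * unit_vec \<beta> (\<alpha> - munit 4 + munit 3) * v \<beta>)
   + (\<Sum>\<beta>\<in>mindices k. (real (\<alpha> $ 3) * x $ 4) * unit_vec \<beta> (\<alpha> - munit 3) * v \<beta>)
   - (\<Sum>\<beta>\<in>mindices k. (real (\<alpha> $ 4) * x $ 3) * unit_vec \<beta> (\<alpha> - munit 4) * v \<beta>)"
    unfolding mat_vec_def A1_def A1_act_def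
    by (simp only: sum.distrib [symmetric] sum_subtractf [symmetric] distrib_right left_diff_distrib)
  also have "\<dots> = A1_act x v \<alpha>"
    unfolding A1_act_def
    by (subst sum_unit_vec, (use i1 i2 in force))+ simp
  finally show ?thesis .
qed

lemma mat_vec_A0:
  assumes "\<alpha> \<in> mindices k"
  shows "mat_vec (mindices k) (A0 E k x) v \<alpha> = A0_act E k x v \<alpha>"
proof -
  define B :: "mindex set" where "B = {\<beta>. \<beta> $ 3 = 0 \<and> \<beta> $ 4 = 0 \<and> mlen \<beta> + mlen \<alpha> \<le> k + 1}"
  define c where "c = (\<lambda>(j::4) \<beta>::mindex. 1 / (fact (\<beta> $ 1) * fact (\<beta> $ 2)) * (real (\<alpha> $ j) *
     pderiv_mi (\<beta> $ 1) (\<beta> $ 2) (\<lambda>y. E y $ (if j = 3 then 1 else 2)) (vector [x $ 1, x $ 2])))"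
  have ix: "\<alpha> + \<beta> - munit j \<in> mindices k" if "\<beta> \<in> B" "c j \<beta> \<noteq> 0" for \<beta> j
  proof -
    have "0 < \<alpha> $ j" using that(2) by (auto simp: c_def)
    then have "mlen (\<alpha> + \<beta> - munit j) + 1 = mlen \<alpha> + mlen \<beta>"
      using mlen_diff_munit[of "\<alpha> + \<beta>" j] by (simp add: mlen_add)
    then show ?thesis using that(1) by (simp add: B_def mindices_def)
  qed
  have act: "A0_act E k x w \<alpha> = (\<Sum>\<beta>\<in>B. c 3 \<beta> * w (\<alpha> + \<beta> - munit 3) + c 4 \<beta> * w (\<alpha> + \<beta> - munit 4))"
    for w
    unfolding A0_act_def B_def c_def by (intro sum.cong) (auto simp: algebra_simps)
  have "mat_vec (mindices k) (A0 E k x) v \<alpha> =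
    (\<Sum>\<gamma>\<in>mindices k. \<Sum>\<beta>\<in>B. c 3 \<beta> * unit_vec \<gamma> (\<alpha> + \<beta> - munit 3) * v \<gamma>
        + c 4 \<beta> * unit_vec \<gamma> (\<alpha> + \<beta> - munit 4) * v \<gamma>)"
    unfolding mat_vec_def A0_def act by (simp add: sum_distrib_right distrib_right)
  also have "\<dots> = (\<Sum>\<beta>\<in>B. \<Sum>\<gamma>\<in>mindices k. c 3 \<beta> * unit_vec \<gamma> (\<alpha> + \<beta> - munit 3) * v \<gamma>
        + c 4 \<beta> * unit_vec \<gamma> (\<alpha> + \<beta> - munit 4) * v \<gamma>)"
    by (rule sum.swap)
  also have "\<dots> = A0_act E k x v \<alpha>"
    unfolding act sum.distrib using ix by (intro arg_cong2[where f = "(+)"] sum.cong sum_unit_vec refl) auto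
  finally show ?thesis .
qed

section \<open>The integrator\<close>

text \<open>
  In \<open>lle_X E k \<nu> \<epsilon> \<Delta>t y0 v0\<close> the argument \<open>\<Delta>t\<close> is the step in the rescaled time, i.e. the actual
  step is \<open>\<Delta>t / \<epsilon> powi \<nu>\<close>.
\<close>

primrec lle_X ::
  "(real ^ 2 \<Rightarrow> real ^ 2) \<Rightarrow> nat \<Rightarrow> int \<Rightarrow> real \<Rightarrow> real \<Rightarrow> real ^ 2 \<Rightarrow> real ^ 2 \<Rightarrow> nat \<Rightarrow> real ^ 4" where
  "lle_X E k \<nu> \<epsilon> \<Delta>t y0 v0 0 = vector [y0 $ 1, y0 $ 2, \<epsilon> * v0 $ 1, \<epsilon> * v0 $ 2]"
| "lle_X E k \<nu> \<epsilon> \<Delta>t y0 v0 (Suc n) =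
     (let X = lle_X E k \<nu> \<epsilon> \<Delta>t y0 v0 n;
          M = (\<lambda>\<alpha> \<beta>. (\<epsilon> powi (- 1 - \<nu>) * A1 X \<alpha> \<beta> + \<epsilon> powi (1 - \<nu>) * A0 E k X \<alpha> \<beta>) * \<Delta>t)
      in X + Pi_x (mat_vec (mindices k) (mat_exp (mindices k) M) e1D))"

definition lle_pos ::
  "(real ^ 2 \<Rightarrow> real ^ 2) \<Rightarrow> nat \<Rightarrow> int \<Rightarrow> real \<Rightarrow> real \<Rightarrow> real ^ 2 \<Rightarrow> real ^ 2 \<Rightarrow> nat \<Rightarrow> real ^ 2" where
  "lle_pos E k \<nu> \<epsilon> \<Delta>t y0 v0 n =
     (let X = lle_X E k \<nu> \<epsilon> \<Delta>t y0 v0 n in vector [X $ 1, X $ 2])"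

definition lle_vel ::
  "(real ^ 2 \<Rightarrow> real ^ 2) \<Rightarrow> nat \<Rightarrow> int \<Rightarrow> real \<Rightarrow> real \<Rightarrow> real ^ 2 \<Rightarrow> real ^ 2 \<Rightarrow> nat \<Rightarrow> real ^ 2" where
  "lle_vel E k \<nu> \<epsilon> \<Delta>t y0 v0 n =
     (let X = lle_X E k \<nu> \<epsilon> \<Delta>t y0 v0 n in (1 / \<epsilon>) *\<^sub>R vector [X $ 3, X $ 4])"

section \<open>The differential equation\<close>

definition J :: "real ^ 2 ^ 2" where
  "J = vector [vector [0, 1], vector [- 1, 0]]"

text \<open>\<open>v\<close> is the velocity of the trajectory \<open>y\<close>; derivatives at the end points are one-sided.\<close>

definition solves_cpd ::
  "(real ^ 2 \<Rightarrow> real ^ 2) \<Rightarrow> real \<Rightarrow> real \<Rightarrow> real ^ 2 \<Rightarrow> real ^ 2 \<Rightarrow>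
   (real \<Rightarrow> real ^ 2) \<Rightarrow> (real \<Rightarrow> real ^ 2) \<Rightarrow> bool" where
  "solves_cpd E \<epsilon> S y0 v0 y v \<longleftrightarrow>
     y 0 = y0 \<and> v 0 = v0 \<and>
     (\<forall>t\<in>{0..S}. (y has_vector_derivative v t) (at t within {0..S}) \<and>
       (v has_vector_derivative (1 / \<epsilon>) *\<^sub>R (J *v v t) + E (y t)) (at t within {0..S}))"

end

theory Submission
  imports Defs
begin

text \<open>
  In the rescaled time \<open>t = \<epsilon> s\<close> and with \<open>p = \<epsilon> \<cdot> velocity\<close> the equation reads
  \<open>y' = \<omega> p\<close>, \<open>p' = \<omega> J p + E y\<close> with \<open>\<omega> = 1 / \<epsilon>\<^sup>2\<close>. The fast flow conserves \<open>y + J p\<close> and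
  rotates \<open>p\<close>, so \<open>\<bar>y + J p\<bar>\<^sup>2 + \<bar>p\<bar>\<^sup>2\<close> grows only through the force, uniformly in \<open>\<omega>\<close>.
  Over one step the numerical solution is extended to a curve that solves the same equation with a
  perturbed force; the global error then follows by Gronwall from a bound
  \<open>O(\<Delta>t ^ (k + 1))\<close> for the perturbation. That bound compares the vector \<open>v\<close> of the linear extension
  with the monomials of the curve. It needs increments of size \<open>O(\<Delta>t)\<close>, hence \<open>p = O(\<Delta>t)\<close>, which is
  where \<open>\<epsilon> < \<Delta>t / c2\<close> enters, and stability of \<open>v' = \<omega> A1 v + g\<close> uniformly in \<open>\<omega>\<close>, which comes
  from rewriting \<open>v\<close>, viewed as a linear functional on polynomials, in coordinates that are constant
  along the fast flow.
\<close>

section \<open>Forced gyration\<close>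

text \<open>A direct Gronwall argument for \<open>v' = \<omega> A1 v\<close> or for the position
  equation costs a factor \<open>exp (\<omega> * \<tau>)\<close>, useless for
  \<open>\<omega> = 1 / \<epsilon>\<^sup>2\<close>. What helps is that \<open>A1\<close> is dual to
  a derivation of polynomials, the one generating the fast flow around the base point, so conserved
  quantities of that flow can be used as factors.

  No order is lost between local and global error because the perturbation is measured in the force:
  a force error \<open>O(\<Delta>t ^ (k + 1))\<close> acts during the bounded time \<open>T\<close>.

  One circularity remains. The consistency constant requires bounded numerical positions, since the
  field is only Lipschitz and may be unbounded, and numerical momenta \<open>O(\<Delta>t)\<close>;
  both are known a priori only for the exact solution. The error bound carries them over to the
  numerical one, up to a margin \<open>C * \<Delta>t ^ k\<close> that is small for large
  \<open>N\<close> because \<open>k \<ge> 1\<close>. The finitely many other \<open>N\<close> may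
  each have their own constant, provided that it is uniform in \<open>\<epsilon>\<close>.\<close>

text \<open>With the integrating factor, \<open>H s * exp (- c * (s - a)) - d * (s - a)\<close> is
  nonincreasing. Bounding \<open>d * exp (- c * (s - a))\<close> by \<open>d\<close> avoids the
  quotient \<open>(exp (c * (t - a)) - 1) / c\<close>, so \<open>c = 0\<close> is no special
  case.\<close>

lemma gronwall_linear:
  fixes H H' :: "real \<Rightarrow> real"
  assumes der: "\<And>s. s \<in> {a..b} \<Longrightarrow> (H has_real_derivative H' s) (at s within {a..b})"
    and le: "\<And>s. s \<in> {a..b} \<Longrightarrow> H' s \<le> c * H s + d"
    and "0 \<le> c" "0 \<le> d" and t: "t \<in> {a..b}"
  shows "H t \<le> (H a + d * (t - a)) * exp (c * (t - a))"
proof -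
  define f where "f s = H s * exp (- c * (s - a)) - d * (s - a)" for s
  define f' where "f' s = (H' s - c * H s) * exp (- c * (s - a)) - d" for s
  have f: "(f has_real_derivative f' s) (at s within {a..b})" if "s \<in> {a..b}" for s
    unfolding f_def f'_def
    by (rule derivative_eq_intros der[OF that] refl)+ (simp add: algebra_simps)
  have f'_le: "f' s \<le> 0" if "s \<in> {a..b}" for s
  proof -
    have "exp (- c * (s - a)) \<le> 1" using that \<open>0 \<le> c\<close> by simp
    then have "d * exp (- c * (s - a)) \<le> d" using \<open>0 \<le> d\<close> by (simp add: mult_left_le)
    moreover have "(H' s - c * H s) * exp (- c * (s - a)) \<le> d * exp (- c * (s - a))"
      using le[OF that] by (intro mult_right_mono) auto
    ultimately show ?thesis unfolding f'_def by linarith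
  qed
  have "f t \<le> f a"
  proof (rule DERIV_nonpos_imp_decreasing_open[where f = f and a = a and b = t])
    show "a \<le> t" using t by simp
  next
    fix x assume x: "a < x" "x < t"
    then have "x \<in> {a..b}" "at x within {a..b} = at x" using t by (auto simp: at_within_Icc_at)
    then show "\<exists>y. (f has_real_derivative y) (at x) \<and> y \<le> 0" using f f'_le by metis
  next
    have "continuous_on {a..b} f" using f by (rule DERIV_continuous_on)
    then show "continuous_on {a..t} f" using t by (auto elim: continuous_on_subset)
  qed
  then have "H t * exp (- c * (t - a)) \<le> H a + d * (t - a)" by (simp add: f_def)
  then have "H t * exp (- c * (t - a)) * exp (c * (t - a)) \<le> (H a + d * (t - a)) * exp (c * (t - a))"
    by (intro mult_right_mono) auto
  then show ?thesis by (simp add: mult.assoc flip: exp_add)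
qed

text \<open>The forces are functions of time, not of the state. Thus the exact trajectory, the
  numerical curve and, by linearity, their difference are all instances.\<close>

definition gyro :: "real \<Rightarrow> real \<Rightarrow> real \<Rightarrow> (real \<Rightarrow> real ^ 4) \<Rightarrow> (real \<Rightarrow> real) \<Rightarrow> (real \<Rightarrow> real) \<Rightarrow> bool"
  where "gyro \<omega> a b z F1 F2 \<longleftrightarrow> (\<forall>t\<in>{a..b}.
    ((\<lambda>s. z s $ 1) has_real_derivative \<omega> * z t $ 3) (at t within {a..b}) \<and>
    ((\<lambda>s. z s $ 2) has_real_derivative \<omega> * z t $ 4) (at t within {a..b}) \<and>
    ((\<lambda>s. z s $ 3) has_real_derivative \<omega> * z t $ 4 + F1 t) (at t within {a..b}) \<and>
    ((\<lambda>s. z s $ 4) has_real_derivative - \<omega> * z t $ 3 + F2 t) (at t within {a..b}))"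

lemma gyro_diff:
  assumes "gyro \<omega> a b z F1 F2" "gyro \<omega> a b w G1 G2"
  shows "gyro \<omega> a b (\<lambda>t. z t - w t) (\<lambda>t. F1 t - G1 t) (\<lambda>t. F2 t - G2 t)"
  unfolding gyro_def
proof (intro ballI)
  fix t assume "t \<in> {a..b}"
  note * = assms[unfolded gyro_def, rule_format, OF this]
  show "((\<lambda>s. (z s - w s) $ 1) has_real_derivative \<omega> * (z t - w t) $ 3) (at t within {a..b}) \<and>
    ((\<lambda>s. (z s - w s) $ 2) has_real_derivative \<omega> * (z t - w t) $ 4) (at t within {a..b}) \<and>
    ((\<lambda>s. (z s - w s) $ 3) has_real_derivative \<omega> * (z t - w t) $ 4 + (F1 t - G1 t)) (at t within {a..b}) \<and>
    ((\<lambda>s. (z s - w s) $ 4) has_real_derivative - \<omega> * (z t - w t) $ 3 + (F2 t - G2 t)) (at t within {a..b})"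
    by (intro conjI; simp only: vector_minus_component;
        rule DERIV_cong, (rule derivative_intros; use * in blast)) (simp_all add: algebra_simps)
qed

lemma gyro_shift:
  assumes "gyro \<omega> a b z F1 F2" "a \<le> c + a'" "c + b' \<le> b"
  shows "gyro \<omega> a' b' (\<lambda>t. z (c + t)) (\<lambda>t. F1 (c + t)) (\<lambda>t. F2 (c + t))"
  unfolding gyro_def
proof (intro ballI)
  fix t assume t: "t \<in> {a'..b'}"
  then have ct: "c + t \<in> {a..b}" using assms(2,3) by auto
  have sh: "((\<lambda>s. f (c + s)) has_real_derivative D) (at t within {a'..b'})"
    if "(f has_real_derivative D) (at (c + t) within {a..b})" for f D
  proof -
    have "(f has_real_derivative D) (at (c + t) within (+) c ` {a'..b'})"
      using that assms(2,3) by (elim has_field_derivative_subset) auto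
    then have "(f \<circ> (+) c has_real_derivative D * (0 + 1)) (at t within {a'..b'})"
      by (intro DERIV_image_chain derivative_eq_intros) auto
    then show ?thesis by (simp add: o_def)
  qed
  show "((\<lambda>s. z (c + s) $ 1) has_real_derivative \<omega> * z (c + t) $ 3) (at t within {a'..b'}) \<and>
    ((\<lambda>s. z (c + s) $ 2) has_real_derivative \<omega> * z (c + t) $ 4) (at t within {a'..b'}) \<and>
    ((\<lambda>s. z (c + s) $ 3) has_real_derivative \<omega> * z (c + t) $ 4 + F1 (c + t)) (at t within {a'..b'}) \<and>
    ((\<lambda>s. z (c + s) $ 4) has_real_derivative - \<omega> * z (c + t) $ 3 + F2 (c + t)) (at t within {a'..b'})"
    using assms(1)[unfolded gyro_def, rule_format, OF ct]
    by (intro conjI sh[of "\<lambda>r. z r $ i" for i]; blast)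
qed

text \<open>The first two squares are those of the components of \<open>y + J p\<close>, which the fast flow conserves.\<close>

definition gyro_norm2 :: "real ^ 4 \<Rightarrow> real" where
  "gyro_norm2 z = (z $ 1 + z $ 4)\<^sup>2 + (z $ 2 - z $ 3)\<^sup>2 + (z $ 3)\<^sup>2 + (z $ 4)\<^sup>2"

lemma gyro_norm2_nonneg [simp]: "0 \<le> gyro_norm2 z"
  by (simp add: gyro_norm2_def)

lemma young_inequality: "0 < s \<Longrightarrow> 2 * a * b \<le> a\<^sup>2 / s + s * b\<^sup>2" for a b s :: real
proof -
  assume "0 < s"
  then have "a\<^sup>2 / s + s * b\<^sup>2 - 2 * a * b = (a - s * b)\<^sup>2 / s"
    by (simp add: field_simps power2_eq_square)
  then show ?thesis using \<open>0 < s\<close> by (smt (verit) divide_nonneg_pos zero_le_power2)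
qed

text \<open>
  The free parameter \<open>s\<close> is taken of order one over long times, and equal to the length of the
  interval where a bound linear in that length is wanted.
\<close>

lemma gyro_energy:
  assumes g: "gyro \<omega> a b z F1 F2" and "0 < s" "0 \<le> c" "0 \<le> d"
    and F: "\<And>t. t \<in> {a..b} \<Longrightarrow> (F1 t)\<^sup>2 + (F2 t)\<^sup>2 \<le> c * gyro_norm2 (z t) + d" and t: "t \<in> {a..b}"
  shows "gyro_norm2 (z t) \<le> (gyro_norm2 (z a) + 2 * s * d * (t - a)) * exp ((1 / s + 2 * s * c) * (t - a))"
proof (rule gronwall_linear[where b = b])
  fix r assume r: "r \<in> {a..b}"
  note * = g[unfolded gyro_def, rule_format, OF r]
  define G where "G = 2 * (z r $ 1 + z r $ 4) * F2 r + 2 * (- (z r $ 2 - z r $ 3)) * F1 r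
    + 2 * z r $ 3 * F1 r + 2 * z r $ 4 * F2 r"
  \<comment> \<open>All terms with \<open>\<omega>\<close> cancel: \<open>z $ 1 + z $ 4\<close> has
    derivative \<open>F2\<close>, \<open>z $ 2 - z $ 3\<close> has derivative \<open>- F1\<close>,
    and the rotation moves the momentum at right angles to itself.\<close>
  show "((\<lambda>r. gyro_norm2 (z r)) has_real_derivative
      2 * (z r $ 1 + z r $ 4) * F2 r + 2 * (- (z r $ 2 - z r $ 3)) * F1 r
    + 2 * z r $ 3 * F1 r + 2 * z r $ 4 * F2 r) (at r within {a..b})"
    unfolding gyro_norm2_def
    by (rule derivative_eq_intros *[THEN conjunct1] *[THEN conjunct2, THEN conjunct1]
        *[THEN conjunct2, THEN conjunct2, THEN conjunct1]
        *[THEN conjunct2, THEN conjunct2, THEN conjunct2] refl)+ (simp add: algebra_simps)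
  have "2 * (z r $ 1 + z r $ 4) * F2 r + 2 * (- (z r $ 2 - z r $ 3)) * F1 r
    + 2 * z r $ 3 * F1 r + 2 * z r $ 4 * F2 r
    \<le> ((z r $ 1 + z r $ 4)\<^sup>2 / s + s * (F2 r)\<^sup>2) + ((- (z r $ 2 - z r $ 3))\<^sup>2 / s + s * (F1 r)\<^sup>2)
     + ((z r $ 3)\<^sup>2 / s + s * (F1 r)\<^sup>2) + ((z r $ 4)\<^sup>2 / s + s * (F2 r)\<^sup>2)"
    using \<open>0 < s\<close> by (intro add_mono young_inequality)
  also have "\<dots> = gyro_norm2 (z r) / s + 2 * s * ((F1 r)\<^sup>2 + (F2 r)\<^sup>2)"
    by (simp add: gyro_norm2_def algebra_simps power2_commute add_divide_distrib)
  also have "\<dots> \<le> gyro_norm2 (z r) / s + 2 * s * (c * gyro_norm2 (z r) + d)"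
    using F[OF r] \<open>0 < s\<close> by (intro add_left_mono mult_left_mono) auto
  finally show "2 * (z r $ 1 + z r $ 4) * F2 r + 2 * (- (z r $ 2 - z r $ 3)) * F1 r
    + 2 * z r $ 3 * F1 r + 2 * z r $ 4 * F2 r \<le> (1 / s + 2 * s * c) * gyro_norm2 (z r) + 2 * s * d"
    by (simp add: algebra_simps)
qed (use assms in auto)

lemma sq_add_le: "(a + b)\<^sup>2 \<le> 2 * a\<^sup>2 + 2 * b\<^sup>2" for a b :: real
  using sum_squares_bound[of a b] by (simp add: power2_sum)

lemma gyro_norm2_position: "(z $ 1)\<^sup>2 + (z $ 2)\<^sup>2 \<le> 2 * gyro_norm2 z"
  using sq_add_le[of "z $ 1 + z $ 4" "- z $ 4"] sq_add_le[of "z $ 2 - z $ 3" "z $ 3"]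
  by (simp add: gyro_norm2_def)

lemma gyro_norm2_component: "\<bar>z $ i\<bar> \<le> sqrt (2 * gyro_norm2 z)"
proof -
  have "(z $ 3)\<^sup>2 + (z $ 4)\<^sup>2 \<le> gyro_norm2 z" by (simp add: gyro_norm2_def)
  moreover have "0 \<le> (z $ 1)\<^sup>2" "0 \<le> (z $ 2)\<^sup>2" "0 \<le> (z $ 3)\<^sup>2" "0 \<le> (z $ 4)\<^sup>2" by simp_all
  ultimately have "(z $ i)\<^sup>2 \<le> 2 * gyro_norm2 z"
    using gyro_norm2_position[of z] exhaust_4[of i] gyro_norm2_nonneg[of z] by (elim disjE; hypsubst; linarith)
  then show ?thesis by (simp add: real_le_rsqrt)
qed

lemma gyro_norm2_le:
  assumes "\<And>i. \<bar>z $ i\<bar> \<le> r"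
  shows "gyro_norm2 z \<le> 10 * r\<^sup>2"
proof -
  have sq: "(z $ i)\<^sup>2 \<le> r\<^sup>2" for i
    using assms[of i] by (metis abs_ge_zero power2_abs power_mono)
  \<comment> \<open>\<open>10 = 4 + 4 + 1 + 1\<close>, one summand for each square.\<close>
  show ?thesis
    using sq_add_le[of "z $ 1" "z $ 4"] sq_add_le[of "z $ 2" "- z $ 3"] sq[of 1] sq[of 2] sq[of 3] sq[of 4]
    by (simp add: gyro_norm2_def)
qed

section \<open>Taylor expansion of the field\<close>

lemma Ck_mono: "Ck k f \<Longrightarrow> m \<le> k \<Longrightarrow> Ck m f"
proof (induction k arbitrary: m f)
  case (Suc k)
  then show ?case by (cases m) auto
qed simp

lemma Ck_funpow_pd: "Ck (n + k) f \<Longrightarrow> Ck k ((pd i ^^ n) f)"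
proof (induction n arbitrary: f)
  case (Suc n)
  then have "Ck (n + k) (pd i f)" by simp
  from Suc.IH[OF this] show ?case by (simp add: funpow_swap1)
qed simp

text \<open>\<open>Ck\<close> speaks of derivatives at parameter \<open>0\<close> only, but for
  every base point; moving the base point along the axis gives them on the whole line.\<close>

lemma Ck_has_derivative_axis:
  assumes "Ck (Suc k) f"
  shows "((\<lambda>t. f (y + t *\<^sub>R axis i 1)) has_real_derivative pd i f (y + s *\<^sub>R axis i 1)) (at s)"
proof -
  let ?y = "y + s *\<^sub>R axis i 1"
  have "(\<lambda>t. f (?y + t *\<^sub>R axis i 1)) differentiable (at 0)" using assms by auto
  then have "((\<lambda>t. f (?y + t *\<^sub>R axis i 1)) has_real_derivative pd i f ?y) (at 0)"
    unfolding pd_def using DERIV_deriv_iff_real_differentiable by blast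
  then have "((\<lambda>t. f (?y + (t - s) *\<^sub>R axis i 1)) has_real_derivative pd i f ?y) (at (0 + s))"
    unfolding DERIV_shift by simp
  moreover have "?y + (t - s) *\<^sub>R axis i 1 = y + t *\<^sub>R axis i 1" for t
    by (simp add: algebra_simps)
  ultimately show ?thesis by simp
qed

text \<open>In the Lagrange remainder the derivative of order \<open>k\<close> sits at an
  intermediate point. Moving it to \<open>y\<close> completes the Taylor polynomial and costs
  \<open>L * \<bar>t\<bar>\<close> by the Lipschitz condition, which stands in for a derivative of
  order \<open>k + 1\<close>.\<close>

lemma taylor_axis:
  assumes f: "Ck k f" and L: "L-lipschitz_on UNIV ((pd i ^^ k) f)"
  shows "\<bar>f (y + t *\<^sub>R axis i 1) - (\<Sum>m\<le>k. (pd i ^^ m) f y * t ^ m / fact m)\<bar> \<le> L * \<bar>t\<bar> ^ (k + 1)"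
proof -
  define D where "D m s = (pd i ^^ m) f (y + s *\<^sub>R axis i 1)" for m s
  have "\<forall>m s. m < k \<and> \<bar>s\<bar> \<le> \<bar>t\<bar> \<longrightarrow> DERIV (D m) s :> D (Suc m) s"
  proof (intro allI impI)
    fix m s assume "m < k \<and> \<bar>s\<bar> \<le> \<bar>t\<bar>"
    then have "Ck (m + Suc (k - Suc m)) f" using f by simp
    from Ck_has_derivative_axis[OF Ck_funpow_pd[OF this]]
    show "DERIV (D m) s :> D (Suc m) s" unfolding D_def by (simp add: fun_eq_iff)
  qed
  with Maclaurin_bi_le[of D "D 0" k t] obtain r where r: "\<bar>r\<bar> \<le> \<bar>t\<bar>"
    and eq: "D 0 t = (\<Sum>m<k. D m 0 / fact m * t ^ m) + D k r / fact k * t ^ k"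
    by blast
  have "D 0 t - (\<Sum>m\<le>k. D m 0 * t ^ m / fact m) = (D k r - D k 0) * t ^ k / fact k"
    unfolding eq by (simp add: lessThan_Suc_atMost [symmetric] algebra_simps diff_divide_distrib)
  also have "\<bar>\<dots>\<bar> = \<bar>D k r - D k 0\<bar> * (\<bar>t\<bar> ^ k / fact k)"
    by (simp add: abs_mult power_abs)
  also have "\<dots> \<le> (L * \<bar>r\<bar>) * \<bar>t\<bar> ^ k"
  proof (intro mult_mono)
    show "\<bar>D k r - D k 0\<bar> \<le> L * \<bar>r\<bar>"
      using lipschitz_onD[OF L, of "y + r *\<^sub>R axis i 1" y] by (simp add: D_def dist_norm)
    show "\<bar>t\<bar> ^ k / fact k \<le> \<bar>t\<bar> ^ k"
      using fact_ge_1[of k] by (simp add: divide_le_eq mult_le_cancel_left1)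
  qed (use lipschitz_on_nonneg[OF L] in auto)
  also have "\<dots> \<le> (L * \<bar>t\<bar>) * \<bar>t\<bar> ^ k"
    using r lipschitz_on_nonneg[OF L] by (intro mult_right_mono mult_left_mono) auto
  finally show ?thesis by (simp add: D_def mult.assoc)
qed

text \<open>
  Expanding along the second axis first produces exactly the derivatives \<open>pderiv_mi b1 b2\<close>, so
  symmetry of the mixed partial derivatives is not needed.
\<close>

lemma taylor_plane:
  assumes f: "Ck k f" and L: "\<And>b1 b2. b1 + b2 \<le> k \<Longrightarrow> L-lipschitz_on UNIV (pderiv_mi b1 b2 f)"
    and r: "\<bar>s\<bar> \<le> r" "\<bar>t\<bar> \<le> r"
  shows "\<bar>f (y + s *\<^sub>R axis 1 1 + t *\<^sub>R axis 2 1)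
    - (\<Sum>b2\<le>k. \<Sum>b1\<le>k - b2. pderiv_mi b1 b2 f y / (fact b1 * fact b2) * s ^ b1 * t ^ b2)\<bar>
    \<le> real (k + 2) * L * r ^ (k + 1)"
proof -
  have L0: "0 \<le> L" using lipschitz_on_nonneg[OF L[of 0 0]] by simp
  have r0: "0 \<le> r" using r by linarith
  let ?z = "y + s *\<^sub>R axis 1 1"
  define P where "P b2 = (\<Sum>b1\<le>k - b2. pderiv_mi b1 b2 f y * s ^ b1 / fact b1)" for b2
  have "L-lipschitz_on UNIV ((pd 2 ^^ k) f)" using L[of 0 k] by (simp add: pderiv_mi_def)
  from taylor_axis[OF f this]
  have 1: "\<bar>f (?z + t *\<^sub>R axis 2 1) - (\<Sum>m\<le>k. (pd 2 ^^ m) f ?z * t ^ m / fact m)\<bar> \<le> L * r ^ (k + 1)"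
    by (rule order_trans) (intro mult_left_mono power_mono r L0, auto)
  \<comment> \<open>The coefficient of \<open>t ^ m\<close> is expanded to order
    \<open>k - m\<close> only; its error \<open>r ^ (k - m + 1)\<close> times \<open>r ^ m\<close>
    has the right order.\<close>
  have 2: "\<bar>(pd 2 ^^ m) f ?z * t ^ m / fact m - P m * t ^ m / fact m\<bar> \<le> L * r ^ (k + 1)" if m: "m \<le> k" for m
  proof -
    have "Ck (m + (k - m)) f" using f m by simp
    note c = Ck_funpow_pd[OF this, of 2]
    have "L-lipschitz_on UNIV ((pd 1 ^^ (k - m)) ((pd 2 ^^ m) f))"
      using L[of "k - m" m] m by (simp add: pderiv_mi_def)
    from taylor_axis[OF c this, of y s]
    have a: "\<bar>(pd 2 ^^ m) f ?z - P m\<bar> \<le> L * \<bar>s\<bar> ^ (k - m + 1)"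
      by (simp add: P_def pderiv_mi_def)
    have "\<bar>(pd 2 ^^ m) f ?z * t ^ m / fact m - P m * t ^ m / fact m\<bar>
        = \<bar>(pd 2 ^^ m) f ?z - P m\<bar> * (\<bar>t\<bar> ^ m / fact m)"
      by (simp add: abs_mult power_abs flip: left_diff_distrib diff_divide_distrib)
    also have "\<dots> \<le> (L * \<bar>s\<bar> ^ (k - m + 1)) * \<bar>t\<bar> ^ m"
      using a L0 fact_ge_1[of m]
      by (intro mult_mono) (auto simp: divide_le_eq mult_le_cancel_left1)
    also have "\<dots> \<le> (L * r ^ (k - m + 1)) * r ^ m"
      using r r0 L0 by (intro mult_mono mult_left_mono power_mono) auto
    also have "\<dots> = L * r ^ (k + 1)" using m by (simp add: mult.assoc flip: power_add)
    finally show ?thesis .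
  qed
  have eq: "(\<Sum>b2\<le>k. \<Sum>b1\<le>k - b2. pderiv_mi b1 b2 f y / (fact b1 * fact b2) * s ^ b1 * t ^ b2)
    = (\<Sum>m\<le>k. P m * t ^ m / fact m)"
    unfolding P_def sum_distrib_right sum_divide_distrib
    by (intro sum.cong refl) (simp add: field_simps)
  have "\<bar>(\<Sum>m\<le>k. (pd 2 ^^ m) f ?z * t ^ m / fact m) - (\<Sum>m\<le>k. P m * t ^ m / fact m)\<bar>
     \<le> (\<Sum>m\<le>k. L * r ^ (k + 1))"
    unfolding sum_subtractf [symmetric] by (rule order_trans[OF sum_abs sum_mono]) (use 2 in auto)
  \<comment> \<open>One error from the second axis and one from each of the \<open>k + 1\<close>
    coefficients give the factor \<open>k + 2\<close>.\<close>
  then show ?thesis using 1 unfolding eq by (simp add: algebra_simps)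
qed

text \<open>\<open>Ck\<close> supplies partial derivatives only, whereas differentiating the field
  along a trajectory requires a total derivative. A remainder quadratic in the increment yields
  one.\<close>

lemma has_derivative_of_quadratic_remainder:
  fixes f :: "real ^ 2 \<Rightarrow> real"
  assumes rem: "\<And>s t r. \<bar>s\<bar> \<le> r \<Longrightarrow> \<bar>t\<bar> \<le> r \<Longrightarrow>
     \<bar>f (y + s *\<^sub>R axis 1 1 + t *\<^sub>R axis 2 1) - (f y + p * s + q * t)\<bar> \<le> C * r\<^sup>2"
  shows "(f has_derivative (\<lambda>h. p * h $ 1 + q * h $ 2)) (at y)"
proof (rule has_derivativeI)
  show "bounded_linear (\<lambda>h::real ^ 2. p * h $ 1 + q * h $ 2)"
    by (intro bounded_linear_intros bounded_linear_vec_nth)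
  have b: "\<bar>f z - f y - (p * (z - y) $ 1 + q * (z - y) $ 2)\<bar> \<le> C * (norm (z - y))\<^sup>2" for z
  proof -
    have "y + (z - y) $ 1 *\<^sub>R axis 1 1 + (z - y) $ 2 *\<^sub>R axis 2 1 = z"
      by (auto simp: vec_eq_iff axis_def forall_2)
    with rem[OF component_le_norm_cart[of "z - y" 1] component_le_norm_cart[of "z - y" 2]]
    show ?thesis by (simp only: diff_diff_eq add.assoc)
  qed
  show "(\<lambda>z. (f z - f y - (p * (z - y) $ 1 + q * (z - y) $ 2)) /\<^sub>R norm (z - y)) \<midarrow>y\<rightarrow> 0"
  proof (rule Lim_null_comparison)
    show "\<forall>\<^sub>F z in at y. norm ((f z - f y - (p * (z - y) $ 1 + q * (z - y) $ 2)) /\<^sub>R norm (z - y))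
       \<le> C * norm (z - y)"
      unfolding eventually_at
    proof (intro exI[of _ 1] conjI ballI impI)
      fix z assume "z \<noteq> y \<and> dist z y < 1"
      then have "0 < norm (z - y)" by simp
      with b[of z] show "norm ((f z - f y - (p * (z - y) $ 1 + q * (z - y) $ 2)) /\<^sub>R norm (z - y))
       \<le> C * norm (z - y)"
        by (simp add: field_simps power2_eq_square)
    qed simp
    have "((\<lambda>z. C * norm (z - y)) \<longlongrightarrow> C * norm (y - y)) (at y)" by (intro tendsto_intros)
    then show "((\<lambda>z. C * norm (z - y)) \<longlongrightarrow> 0) (at y)" by simp
  qed
qed

text \<open>One constant for both components and all orders up to \<open>k\<close>. The values at
  the origin turn the Lipschitz conditions into bounds of linear growth.\<close>

definition smooth_bounds :: "(real ^ 2 \<Rightarrow> real ^ 2) \<Rightarrow> nat \<Rightarrow> real \<Rightarrow> bool" where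
  "smooth_bounds E k L \<longleftrightarrow> 0 \<le> L \<and> (\<forall>j. Ck k (\<lambda>y. E y $ j) \<and>
     (\<forall>b1 b2. b1 + b2 \<le> k \<longrightarrow> L-lipschitz_on UNIV (pderiv_mi b1 b2 (\<lambda>y. E y $ j))
        \<and> \<bar>pderiv_mi b1 b2 (\<lambda>y. E y $ j) 0\<bar> \<le> L))"

lemma smooth_bounds_exists:
  assumes "Ck_Lipschitz k E"
  obtains L where "smooth_bounds E k L"
proof -
  let ?g = "\<lambda>p::2 \<times> nat \<times> nat. pderiv_mi (fst (snd p)) (snd (snd p)) (\<lambda>y. E y $ fst p)"
  let ?S = "(UNIV :: 2 set) \<times> {..k} \<times> {..k}"
  have "\<forall>p. \<exists>L. fst (snd p) + snd (snd p) \<le> k \<longrightarrow> L-lipschitz_on UNIV (?g p)"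
    using assms unfolding Ck_Lipschitz_def by blast
  then obtain Lf where Lf: "\<And>p. fst (snd p) + snd (snd p) \<le> k \<Longrightarrow> (Lf p)-lipschitz_on UNIV (?g p)"
    by metis
  define L where "L = (\<Sum>p\<in>?S. \<bar>Lf p\<bar> + \<bar>?g p 0\<bar>)"
  have L0: "0 \<le> L" unfolding L_def by (intro sum_nonneg) auto
  have le: "\<bar>Lf p\<bar> + \<bar>?g p 0\<bar> \<le> L" if "p \<in> ?S" for p
    unfolding L_def using that by (intro member_le_sum[where f = "\<lambda>p. \<bar>Lf p\<bar> + \<bar>?g p 0\<bar>"]) auto
  have "smooth_bounds E k L" unfolding smooth_bounds_def
  proof (intro conjI allI impI L0)
    fix j b1 b2 assume b: "b1 + b2 \<le> k"
    from le[of "(j, b1, b2)"] b have l: "\<bar>Lf (j, b1, b2)\<bar> + \<bar>?g (j, b1, b2) 0\<bar> \<le> L" by auto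
    show "L-lipschitz_on UNIV (pderiv_mi b1 b2 (\<lambda>y. E y $ j))"
      using Lf[of "(j, b1, b2)"] b l by (auto intro: lipschitz_on_mono)
    show "\<bar>pderiv_mi b1 b2 (\<lambda>y. E y $ j) 0\<bar> \<le> L" using l by simp
  qed (use assms in \<open>simp add: Ck_Lipschitz_def\<close>)
  with that show ?thesis by blast
qed

lemma smooth_bounds_mono: "smooth_bounds E k L \<Longrightarrow> m \<le> k \<Longrightarrow> smooth_bounds E m L"
  unfolding smooth_bounds_def using Ck_mono by (meson le_trans)

lemma smooth_bounds_pderiv:
  assumes "smooth_bounds E k L" "b1 + b2 \<le> k"
  shows "\<bar>pderiv_mi b1 b2 (\<lambda>y. E y $ j) y\<bar> \<le> L * (1 + norm y)"
proof -
  have "\<bar>pderiv_mi b1 b2 (\<lambda>y. E y $ j) y - pderiv_mi b1 b2 (\<lambda>y. E y $ j) 0\<bar> \<le> L * norm y"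
    "\<bar>pderiv_mi b1 b2 (\<lambda>y. E y $ j) 0\<bar> \<le> L"
    using assms lipschitz_onD[of L UNIV "pderiv_mi b1 b2 (\<lambda>y. E y $ j)" y 0]
    by (auto simp: smooth_bounds_def dist_norm)
  then show ?thesis by (simp add: algebra_simps)
qed

lemma smooth_bounds_lipschitz:
  assumes "smooth_bounds E k L"
  shows "\<bar>E y $ j - E z $ j\<bar> \<le> L * norm (y - z)"
proof -
  have "L-lipschitz_on UNIV (pderiv_mi 0 0 (\<lambda>y. E y $ j))" using assms by (simp add: smooth_bounds_def)
  from lipschitz_onD[OF this, of y z] show ?thesis by (simp add: pderiv_mi_def dist_norm)
qed

lemma smooth_bounds_growth:
  assumes "smooth_bounds E k L"
  shows "\<bar>E y $ j\<bar> \<le> L * (1 + norm y)"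
  using smooth_bounds_pderiv[OF assms, of 0 0 j y] by (simp add: pderiv_mi_def)

lemma smooth_bounds_taylor:
  assumes "smooth_bounds E k L" and "\<bar>s\<bar> \<le> r" "\<bar>t\<bar> \<le> r"
  shows "\<bar>E (y + s *\<^sub>R axis 1 1 + t *\<^sub>R axis 2 1) $ j
    - (\<Sum>b2\<le>k. \<Sum>b1\<le>k - b2. pderiv_mi b1 b2 (\<lambda>y. E y $ j) y / (fact b1 * fact b2) * s ^ b1 * t ^ b2)\<bar>
    \<le> real (k + 2) * L * r ^ (k + 1)"
  using assms by (intro taylor_plane) (auto simp: smooth_bounds_def)

lemma smooth_bounds_has_derivative:
  assumes sb: "smooth_bounds E k L" and k: "1 \<le> k"
  shows "((\<lambda>y. E y $ j) has_derivative
     (\<lambda>h. pd 1 (\<lambda>y. E y $ j) y * h $ 1 + pd 2 (\<lambda>y. E y $ j) y * h $ 2)) (at y)"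
proof (rule has_derivative_of_quadratic_remainder)
  fix s t r :: real assume "\<bar>s\<bar> \<le> r" "\<bar>t\<bar> \<le> r"
  from smooth_bounds_taylor[OF smooth_bounds_mono[OF sb k] this, of y j]
  show "\<bar>E (y + s *\<^sub>R axis 1 1 + t *\<^sub>R axis 2 1) $ j - (E y $ j + pd 1 (\<lambda>y. E y $ j) y * s
     + pd 2 (\<lambda>y. E y $ j) y * t)\<bar> \<le> (3 * L) * r\<^sup>2"
    by (simp add: pderiv_mi_def numeral_2_eq_2 algebra_simps)
qed

section \<open>The linear extension as a differential equation\<close>

lemma mat_pow_scale: "mat_pow I (\<lambda>i j. B i j * s) n i j = s ^ n * mat_pow I B n i j"
  by (induction n arbitrary: i) (simp_all add: sum_distrib_left mult_ac)

text \<open>Each entry is an everywhere convergent power series in \<open>s\<close>. Since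
  \<open>mat_pow\<close> attaches the new factor on the left, the coefficients of the differentiated
  series are those of \<open>B\<close> times the exponential.\<close>

lemma mat_exp_has_derivative:
  assumes "finite I" "\<alpha> \<in> I"
  shows "((\<lambda>s. mat_vec I (mat_exp I (\<lambda>i j. B i j * s)) u \<alpha>) has_real_derivative
     mat_vec I B (mat_vec I (mat_exp I (\<lambda>i j. B i j * s)) u) \<alpha>) (at s)"
proof -
  define c where "c i j n = mat_pow I B n i j / fact n" for i j n
  have ex: "mat_exp I (\<lambda>i j. B i j * s) i j = (\<Sum>n. c i j n * s ^ n)" for i j s
    unfolding mat_exp_def mat_pow_scale c_def by (simp add: mult.commute)
  have sm: "summable (\<lambda>n. c i j n * x ^ n)" if "i \<in> I" "j \<in> I" for i j x
    using summable_norm_cancel[OF mat_exp_summable[OF assms(1) that, of "\<lambda>i j. B i j * x"]]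
    unfolding mat_pow_scale c_def by (simp add: mult.commute)
  have diffs: "diffs (c i j) n = (\<Sum>l\<in>I. B i l * c l j n)" for i j n
  proof -
    have "diffs (c i j) n = mat_pow I B (Suc n) i j / fact n"
      unfolding diffs_def c_def by (simp del: mat_pow.simps)
    then show ?thesis by (simp add: c_def sum_divide_distrib)
  qed
  have der: "((\<lambda>s. \<Sum>n. c i j n * s ^ n) has_real_derivative (\<Sum>l\<in>I. B i l * (\<Sum>n. c l j n * s ^ n))) (at s)"
    if "i \<in> I" "j \<in> I" for i j
  proof -
    have "((\<lambda>s. \<Sum>n. c i j n * s ^ n) has_real_derivative (\<Sum>n. diffs (c i j) n * s ^ n)) (at s)"
      by (rule termdiffs_strong_converges_everywhere) (rule sm[OF that])
    also have "(\<Sum>n. diffs (c i j) n * s ^ n) = (\<Sum>n. \<Sum>l\<in>I. B i l * (c l j n * s ^ n))"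
      unfolding diffs by (intro suminf_cong) (simp add: sum_distrib_right mult.assoc)
    also have "\<dots> = (\<Sum>l\<in>I. \<Sum>n. B i l * (c l j n * s ^ n))"
      by (rule suminf_sum) (intro summable_mult sm that)
    also have "\<dots> = (\<Sum>l\<in>I. B i l * (\<Sum>n. c l j n * s ^ n))"
      by (intro sum.cong refl suminf_mult[symmetric, THEN sym] sm that)
    finally show ?thesis .
  qed
  have "((\<lambda>s. \<Sum>j\<in>I. mat_exp I (\<lambda>i j. B i j * s) \<alpha> j * u j) has_real_derivative
     (\<Sum>j\<in>I. (\<Sum>l\<in>I. B \<alpha> l * mat_exp I (\<lambda>i j. B i j * s) l j) * u j)) (at s)"
    unfolding ex by (intro DERIV_sum DERIV_cmult_right der assms)
  also have "(\<Sum>j\<in>I. (\<Sum>l\<in>I. B \<alpha> l * mat_exp I (\<lambda>i j. B i j * s) l j) * u j)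
     = (\<Sum>l\<in>I. B \<alpha> l * (\<Sum>j\<in>I. mat_exp I (\<lambda>i j. B i j * s) l j * u j))"
    unfolding sum_distrib_left sum_distrib_right by (subst sum.swap) (simp add: mult.assoc)
  finally show ?thesis by (simp add: mat_vec_def)
qed

lemma mat_exp_zero: "mat_exp I (\<lambda>i j. B i j * 0) i j = (if i = j then 1 else 0)"
proof -
  have "(\<lambda>n. mat_pow I (\<lambda>i j. B i j * 0) n i j / fact n) = (\<lambda>n. if n = 0 then if i = j then 1 else 0 else 0)"
    unfolding mat_pow_scale by (auto simp: fun_eq_iff power_0_left)
  then show ?thesis unfolding mat_exp_def using sums_unique[OF sums_single[of 0 "\<lambda>_. if i = j then 1 else 0 :: real"]] by simp
qed

text \<open>For \<open>\<nu> = 1\<close> the scheme has the coefficients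
  \<open>\<epsilon> powi (- 2)\<close>, here \<open>\<omega>\<close>, and \<open>1\<close>. Turning
  the step size into a time \<open>s\<close> with frozen base point \<open>x\<close> makes one step
  the endpoint of a curve.\<close>

definition lle_flow :: "(real ^ 2 \<Rightarrow> real ^ 2) \<Rightarrow> nat \<Rightarrow> real \<Rightarrow> real ^ 4 \<Rightarrow> real \<Rightarrow> mindex \<Rightarrow> real" where
  "lle_flow E k \<omega> x s =
     mat_vec (mindices k) (mat_exp (mindices k) (\<lambda>\<alpha> \<beta>. (\<omega> * A1 x \<alpha> \<beta> + A0 E k x \<alpha> \<beta>) * s)) e1D"

lemma mlen_zero [simp]: "mlen 0 = 0"
  by (simp add: mlen_def)

lemma mlen_eq_0_iff [simp]: "mlen \<alpha> = 0 \<longleftrightarrow> \<alpha> = 0"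
  by (auto simp: mlen_def vec_eq_iff)

lemma lle_flow_0: "mlen \<alpha> \<le> k \<Longrightarrow> lle_flow E k \<omega> x 0 \<alpha> = e1D \<alpha>"
proof -
  assume "mlen \<alpha> \<le> k"
  then have \<alpha>: "\<alpha> \<in> mindices k" by (simp add: mindices_def)
  have "lle_flow E k \<omega> x 0 \<alpha> = (\<Sum>\<beta>\<in>mindices k. if \<beta> = \<alpha> then e1D \<alpha> else 0)"
    unfolding lle_flow_def mat_vec_def mat_exp_zero by (intro sum.cong) auto
  then show ?thesis using \<alpha> by simp
qed

lemma lle_flow_has_derivative:
  assumes "mlen \<alpha> \<le> k"
  shows "((\<lambda>s. lle_flow E k \<omega> x s \<alpha>) has_real_derivative
    \<omega> * A1_act x (lle_flow E k \<omega> x s) \<alpha> + A0_act E k x (lle_flow E k \<omega> x s) \<alpha>) (at s within S)"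
proof -
  have \<alpha>: "\<alpha> \<in> mindices k" using assms by (simp add: mindices_def)
  have "mat_vec (mindices k) (\<lambda>\<alpha> \<beta>. \<omega> * A1 x \<alpha> \<beta> + A0 E k x \<alpha> \<beta>) v \<alpha>
      = \<omega> * A1_act x v \<alpha> + A0_act E k x v \<alpha>" for v
    unfolding mat_vec_A1[OF \<alpha>, symmetric] mat_vec_A0[OF \<alpha>, symmetric]
    by (simp add: mat_vec_def distrib_right sum.distrib sum_distrib_left mult.assoc)
  with mat_exp_has_derivative[OF finite_mindices \<alpha>, of "\<lambda>\<alpha> \<beta>. \<omega> * A1 x \<alpha> \<beta> + A0 E k x \<alpha> \<beta>" e1D s]
  show ?thesis unfolding lle_flow_def by (simp add: has_field_derivative_at_within)
qed

section \<open>Uniform stability of the linear extension\<close>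

text \<open>
  A vector \<open>v\<close> is read as the linear functional \<open>z\<^sup>\<alpha> \<mapsto> v \<alpha>\<close> on polynomials in the increment \<open>z\<close>.
  Then \<open>coord x \<theta> j v\<close> is the functional \<open>f \<mapsto> v (\<ell> f)\<close> where \<open>\<ell>\<close> is, for \<open>j = 1, 2\<close>, a component of
  \<open>y + J p\<close> (up to a constant) and, for \<open>j = 3, 4\<close>, a component of \<open>p\<close> rotated back by the angle \<open>\<theta>\<close>.
\<close>

definition coord :: "real ^ 4 \<Rightarrow> real \<Rightarrow> 4 \<Rightarrow> (mindex \<Rightarrow> real) \<Rightarrow> mindex \<Rightarrow> real" where
  "coord x \<theta> j v \<alpha> =
     (if j = 1 then v (\<alpha> + munit 1) + v (\<alpha> + munit 4)
      else if j = 2 then v (\<alpha> + munit 2) - v (\<alpha> + munit 3)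
      else if j = 3 then cos \<theta> * (v (\<alpha> + munit 3) + x $ 3 * v \<alpha>) - sin \<theta> * (v (\<alpha> + munit 4) + x $ 4 * v \<alpha>)
      else sin \<theta> * (v (\<alpha> + munit 3) + x $ 3 * v \<alpha>) + cos \<theta> * (v (\<alpha> + munit 4) + x $ 4 * v \<alpha>))"

lemma coord_simps:
  "coord x \<theta> 1 v \<alpha> = v (\<alpha> + munit 1) + v (\<alpha> + munit 4)"
  "coord x \<theta> 2 v \<alpha> = v (\<alpha> + munit 2) - v (\<alpha> + munit 3)"
  "coord x \<theta> 3 v \<alpha> =
     cos \<theta> * (v (\<alpha> + munit 3) + x $ 3 * v \<alpha>) - sin \<theta> * (v (\<alpha> + munit 4) + x $ 4 * v \<alpha>)"
  "coord x \<theta> 4 v \<alpha> =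
     sin \<theta> * (v (\<alpha> + munit 3) + x $ 3 * v \<alpha>) + cos \<theta> * (v (\<alpha> + munit 4) + x $ 4 * v \<alpha>)"
  by (simp_all add: coord_def)

section \<open>Product rule for the fast part\<close>

lemma munit_add_diff: "0 < \<alpha> $ i \<Longrightarrow> \<alpha> + munit j - munit i = \<alpha> - munit i + munit j"
  by (auto simp: vec_eq_iff axis_def)

lemma munit_add_diff_same: "\<alpha> + munit i - munit i = \<alpha>"
  by (auto simp: vec_eq_iff)

lemma munit_nth: "(munit i :: mindex) $ j = (if i = j then 1 else 0)"
  by (auto simp: axis_def)

text \<open>Every term of \<open>A1_act\<close> has this form with \<open>\<delta>\<close> a unit
  index or \<open>0\<close>. The second summand is what the product rule adds when the new factor is
  itself differentiated.\<close>

lemma A1_coeff: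
  "real ((\<alpha> + munit j) $ i) * v (\<alpha> + munit j - munit i + \<delta>) =
     real (\<alpha> $ i) * v (\<alpha> - munit i + \<delta> + munit j) + (if i = j then v (\<alpha> + \<delta>) else 0)"
proof (cases "\<alpha> $ i = 0")
  case True
  then show ?thesis using munit_add_diff_same[of \<alpha> i]
    by (auto simp add: munit_nth simp del: One_nat_def)
next
  case False
  then have "\<alpha> + munit j - munit i = \<alpha> - munit i + munit j" by (intro munit_add_diff) simp
  moreover have "\<alpha> - munit i + munit i = \<alpha>"
    using False by (auto simp: vec_eq_iff axis_def)
  ultimately show ?thesis
    by (auto simp: munit_nth distrib_right add.commute add.left_commute simp del: One_nat_def)
qed

text \<open>With \<open>v\<close> read as a functional, \<open>A1_act x v\<close> is
  \<open>f \<mapsto> v (D f)\<close> for the derivation \<open>D\<close> sending the four variables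
  to \<open>z3 + x3\<close>, \<open>z4 + x4\<close>, \<open>z4 + x4\<close>,
  \<open>- (z3 + x3)\<close>. Shifting by \<open>munit j\<close> multiplies by \<open>z_j\<close>,
  so this is the Leibniz rule for \<open>D (z_j f)\<close>.\<close>

lemma A1_act_shift:
  "A1_act x v (\<alpha> + munit j) = A1_act x (\<lambda>\<gamma>. v (\<gamma> + munit j)) \<alpha> +
    (if j = 1 then v (\<alpha> + munit 3) + x $ 3 * v \<alpha>
     else if j = 2 then v (\<alpha> + munit 4) + x $ 4 * v \<alpha>
     else if j = 3 then v (\<alpha> + munit 4) + x $ 4 * v \<alpha>
     else - (v (\<alpha> + munit 3) + x $ 3 * v \<alpha>))"
proof -
  have a: "A1_act x v \<alpha> = real (\<alpha> $ 1) * v (\<alpha> - munit 1 + munit 3)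
   + real (\<alpha> $ 2) * v (\<alpha> - munit 2 + munit 4)
   + x $ 3 * (real (\<alpha> $ 1) * v (\<alpha> - munit 1 + 0))
   + x $ 4 * (real (\<alpha> $ 2) * v (\<alpha> - munit 2 + 0))
   + real (\<alpha> $ 3) * v (\<alpha> - munit 3 + munit 4)
   - real (\<alpha> $ 4) * v (\<alpha> - munit 4 + munit 3)
   + x $ 4 * (real (\<alpha> $ 3) * v (\<alpha> - munit 3 + 0))
   - x $ 3 * (real (\<alpha> $ 4) * v (\<alpha> - munit 4 + 0))" for v \<alpha>
    by (simp add: A1_act_def mult_ac)
  show ?thesis
    unfolding a[of v] a[of "\<lambda>\<gamma>. v (\<gamma> + munit j)"] A1_coeff
    using exhaust_4[of j] by (elim disjE) (simp_all add: algebra_simps del: One_nat_def)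
qed

text \<open>
  With \<open>\<theta> = \<omega> s\<close> the factor \<open>\<ell>\<close> is constant along the fast flow, so multiplication by it commutes with
  the evolution generated by \<open>\<omega> A1\<close>.
\<close>

lemma coord_has_derivative:
  assumes u: "\<And>\<alpha>. mlen \<alpha> \<le> m + 1 \<Longrightarrow>
      ((\<lambda>s. u s \<alpha>) has_real_derivative \<omega> * A1_act x (u s) \<alpha> + g \<alpha>) (at s within S)"
    and \<alpha>: "mlen \<alpha> \<le> m"
  shows "((\<lambda>s. coord x (\<omega> * s) j (u s) \<alpha>) has_real_derivative
     \<omega> * A1_act x (coord x (\<omega> * s) j (u s)) \<alpha> + coord x (\<omega> * s) j g \<alpha>) (at s within S)"
proof -
  have d0: "((\<lambda>s. u s \<alpha>) has_real_derivative \<omega> * A1_act x (u s) \<alpha> + g \<alpha>) (at s within S)"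
    using u \<alpha> by simp
  have d1: "((\<lambda>s. u s (\<alpha> + munit i)) has_real_derivative
     \<omega> * A1_act x (u s) (\<alpha> + munit i) + g (\<alpha> + munit i)) (at s within S)" for i
    using \<alpha> by (intro u) (simp add: mlen_add)
  have c: "((\<lambda>s. cos (\<omega> * s)) has_real_derivative - \<omega> * sin (\<omega> * s)) (at s within S)"
    by (auto intro!: derivative_eq_intros)
  have s: "((\<lambda>s. sin (\<omega> * s)) has_real_derivative \<omega> * cos (\<omega> * s)) (at s within S)"
    by (auto intro!: derivative_eq_intros)
  have lin: "A1_act x (\<lambda>\<gamma>. p * v \<gamma> + q * w \<gamma> + r * y \<gamma>) \<alpha> =
    p * A1_act x v \<alpha> + q * A1_act x w \<alpha> + r * A1_act x y \<alpha>" for p q r v w y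
    by (simp add: A1_act_def algebra_simps)
  let ?S = "\<lambda>i \<gamma>. u s (\<gamma> + munit i)"
  consider "j = 1" | "j = 2" | "j = 3" | "j = 4" using exhaust_4[of j] by blast
  then show ?thesis
  proof cases
    \<comment> \<open>The extra terms of \<open>A1_act_shift\<close> at indices 1 and 4 are
      opposite, those at 2 and 3 equal, so they cancel in the first two coordinates. In the other
      two they cancel against the derivatives of sine and cosine.\<close>
    case 1
    have eq: "A1_act x (coord x (\<omega> * s) 1 (u s)) \<alpha> = A1_act x (?S 1) \<alpha> + A1_act x (?S 4) \<alpha>"
      using lin[of 1 "?S 1" 1 "?S 4" 0 "?S 4"] by (simp add: coord_simps[abs_def] del: One_nat_def)
    show ?thesis unfolding 1 eq unfolding coord_simps
      by (rule derivative_eq_intros d1 refl)+ (simp add: A1_act_shift algebra_simps del: One_nat_def)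
  next
    case 2
    have eq: "A1_act x (coord x (\<omega> * s) 2 (u s)) \<alpha> = A1_act x (?S 2) \<alpha> - A1_act x (?S 3) \<alpha>"
      using lin[of 1 "?S 2" "-1" "?S 3" 0 "?S 4"] by (simp add: coord_simps[abs_def] del: One_nat_def)
    show ?thesis unfolding 2 eq unfolding coord_simps
      by (rule derivative_eq_intros d1 refl)+ (simp add: A1_act_shift algebra_simps del: One_nat_def)
  next
    case 3
    have eq: "A1_act x (coord x (\<omega> * s) 3 (u s)) \<alpha> = cos (\<omega> * s) * A1_act x (?S 3) \<alpha>
      - sin (\<omega> * s) * A1_act x (?S 4) \<alpha> + (cos (\<omega> * s) * x $ 3 - sin (\<omega> * s) * x $ 4) * A1_act x (u s) \<alpha>"
      using lin[of "cos (\<omega> * s)" "?S 3" "- sin (\<omega> * s)" "?S 4" "cos (\<omega> * s) * x $ 3 - sin (\<omega> * s) * x $ 4" "u s"]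
      by (simp add: coord_simps[abs_def] algebra_simps del: One_nat_def)
    show ?thesis unfolding 3 eq unfolding coord_simps
      by (rule derivative_eq_intros c s d0 d1 refl)+ (simp add: A1_act_shift algebra_simps del: One_nat_def)
  next
    case 4
    have eq: "A1_act x (coord x (\<omega> * s) 4 (u s)) \<alpha> = sin (\<omega> * s) * A1_act x (?S 3) \<alpha>
      + cos (\<omega> * s) * A1_act x (?S 4) \<alpha> + (sin (\<omega> * s) * x $ 3 + cos (\<omega> * s) * x $ 4) * A1_act x (u s) \<alpha>"
      using lin[of "sin (\<omega> * s)" "?S 3" "cos (\<omega> * s)" "?S 4" "sin (\<omega> * s) * x $ 3 + cos (\<omega> * s) * x $ 4" "u s"]
      by (simp add: coord_simps[abs_def] algebra_simps del: One_nat_def)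
    show ?thesis unfolding 4 eq unfolding coord_simps
      by (rule derivative_eq_intros c s d0 d1 refl)+ (simp add: A1_act_shift algebra_simps del: One_nat_def)
  qed
qed

lemma A1_act_0 [simp]: "A1_act x v 0 = 0"
  by (simp add: A1_act_def)

lemma mlen_munit_1 [simp]: "mlen (munit i) = 1"
  by simp

text \<open>\<open>foldr (coord x \<theta>) l v\<close> is the functional
  \<open>f \<mapsto> v (\<ell>1 * ... * \<ell>n * f)\<close>. Each factor uses up one unit of
  degree, hence the budget \<open>mlen \<alpha> + length l \<le> k\<close>.\<close>

lemma foldr_coord_has_derivative:
  assumes u: "\<And>\<alpha>. mlen \<alpha> \<le> k \<Longrightarrow>
      ((\<lambda>s. u s \<alpha>) has_real_derivative \<omega> * A1_act x (u s) \<alpha> + g \<alpha>) (at s within S)"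
    and "mlen \<alpha> + length l \<le> k"
  shows "((\<lambda>s. foldr (coord x (\<omega> * s)) l (u s) \<alpha>) has_real_derivative
     \<omega> * A1_act x (foldr (coord x (\<omega> * s)) l (u s)) \<alpha> + foldr (coord x (\<omega> * s)) l g \<alpha>) (at s within S)"
  using assms(2)
proof (induction l arbitrary: \<alpha>)
  case Nil
  then show ?case using u by simp
next
  case (Cons j l)
  then show ?case
    using coord_has_derivative[where u = "\<lambda>s. foldr (coord x (\<omega> * s)) l (u s)" and m = "k - Suc (length l)"
       and g = "foldr (coord x (\<omega> * s)) l g" and \<alpha> = \<alpha> and j = j and \<omega> = \<omega> and x = x and s = s and S = S]
    by simp
qed

section \<open>Passing to the coordinates and back\<close>

lemma abs_cos_mult_le: "\<bar>cos \<theta> * a\<bar> \<le> \<bar>a\<bar>" and abs_sin_mult_le: "\<bar>sin \<theta> * a\<bar> \<le> \<bar>a\<bar>" for a \<theta> :: real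
  by (simp_all add: abs_mult mult_left_le_one_le)

lemma coord_bound:
  assumes x: "\<bar>x $ 3\<bar> \<le> M" "\<bar>x $ 4\<bar> \<le> M"
    and v: "\<bar>v \<alpha>\<bar> \<le> V" "\<And>i. \<bar>v (\<alpha> + munit i)\<bar> \<le> V"
  shows "\<bar>coord x \<theta> j v \<alpha>\<bar> \<le> 2 * (1 + M) * V"
proof -
  have V: "0 \<le> V" and M: "0 \<le> M" using v(1) x(1) by linarith+
  have p: "\<bar>v (\<alpha> + munit i) + x $ i' * v \<alpha>\<bar> \<le> (1 + M) * V" if "i' = 3 \<or> i' = 4" for i i'
  proof -
    have "\<bar>x $ i' * v \<alpha>\<bar> \<le> M * V"
      unfolding abs_mult using that x v(1) M by (intro mult_mono) auto
    then show ?thesis using v(2)[of i] by (simp add: algebra_simps)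
  qed
  have p3: "\<bar>v (\<alpha> + munit 3) + x $ 3 * v \<alpha>\<bar> \<le> (1 + M) * V"
    and p4: "\<bar>v (\<alpha> + munit 4) + x $ 4 * v \<alpha>\<bar> \<le> (1 + M) * V" using p by blast+
  have MV: "0 \<le> M * V" using M V by simp
  consider "j = 1" | "j = 2" | "j = 3" | "j = 4" using exhaust_4[of j] by blast
  then show ?thesis
  proof cases
    case 1
    show ?thesis unfolding 1 coord_simps using v(2)[of 1] v(2)[of 4] MV unfolding distrib_left distrib_right by linarith
  next
    case 2
    show ?thesis unfolding 2 coord_simps using v(2)[of 2] v(2)[of 3] MV unfolding distrib_left distrib_right by linarith
  next
    case 3
    show ?thesis unfolding 3 coord_simps
      using order_trans[OF abs_cos_mult_le p3, of \<theta>] order_trans[OF abs_sin_mult_le p4, of \<theta>] by linarith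
  next
    case 4
    show ?thesis unfolding 4 coord_simps
      using order_trans[OF abs_sin_mult_le p3, of \<theta>] order_trans[OF abs_cos_mult_le p4, of \<theta>] by linarith
  qed
qed

text \<open>Undoing the rotation bounds the shifted momentum entries by \<open>2 * V\<close>;
  removing the shift \<open>x * v \<alpha>\<close> costs \<open>M * V\<close>; the conserved
  coordinates then give the position entries for one more \<open>V\<close>.\<close>

lemma coord_inverse_bound:
  assumes x: "\<bar>x $ 3\<bar> \<le> M" "\<bar>x $ 4\<bar> \<le> M"
    and v: "\<bar>v \<alpha>\<bar> \<le> V" "\<And>i. \<bar>coord x \<theta> i v \<alpha>\<bar> \<le> V"
  shows "\<bar>v (\<alpha> + munit j)\<bar> \<le> (4 + M) * V"
proof -
  have V: "0 \<le> V" and M: "0 \<le> M" using v(1) x(1) by linarith+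
  have xv: "\<bar>x $ i * v \<alpha>\<bar> \<le> M * V" if "i = 3 \<or> i = 4" for i
    unfolding abs_mult using that x v(1) M by (intro mult_mono) auto
  have sc: "a * (cos \<theta> * cos \<theta>) + a * (sin \<theta> * sin \<theta>) = a" for a
    by (simp flip: distrib_left power2_eq_square)
  define a where "a = v (\<alpha> + munit 3) + x $ 3 * v \<alpha>"
  define b where "b = v (\<alpha> + munit 4) + x $ 4 * v \<alpha>"
  have a: "a = cos \<theta> * coord x \<theta> 3 v \<alpha> + sin \<theta> * coord x \<theta> 4 v \<alpha>"
    unfolding coord_simps a_def[symmetric] b_def[symmetric] by (simp add: algebra_simps sc)
  have b: "b = - sin \<theta> * coord x \<theta> 3 v \<alpha> + cos \<theta> * coord x \<theta> 4 v \<alpha>"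
    unfolding coord_simps a_def[symmetric] b_def[symmetric] by (simp add: algebra_simps sc)
  have "\<bar>a\<bar> \<le> 2 * V" "\<bar>b\<bar> \<le> 2 * V"
    unfolding a b mult_minus_left
    using order_trans[OF abs_cos_mult_le v(2)[of 3], of \<theta>] order_trans[OF abs_sin_mult_le v(2)[of 4], of \<theta>]
      order_trans[OF abs_sin_mult_le v(2)[of 3], of \<theta>] order_trans[OF abs_cos_mult_le v(2)[of 4], of \<theta>]
    by - linarith+
  then have 3: "\<bar>v (\<alpha> + munit 3)\<bar> \<le> (2 + M) * V" and 4: "\<bar>v (\<alpha> + munit 4)\<bar> \<le> (2 + M) * V"
    using xv[of 3, simplified] xv[of 4, simplified] unfolding a_def b_def distrib_right by - linarith+
  have 1: "\<bar>v (\<alpha> + munit 1)\<bar> \<le> (3 + M) * V" and 2: "\<bar>v (\<alpha> + munit 2)\<bar> \<le> (3 + M) * V"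
    using 3 4 v(2)[of 1] v(2)[of 2] unfolding coord_simps distrib_right by - linarith+
  show ?thesis
    using exhaust_4[of j] 1 2 3 4 V unfolding distrib_right by (elim disjE; hypsubst; linarith)
qed

lemma foldr_coord_bound:
  assumes x: "\<bar>x $ 3\<bar> \<le> M" "\<bar>x $ 4\<bar> \<le> M"
    and v: "\<And>\<gamma>. mlen \<gamma> \<le> k \<Longrightarrow> \<bar>v \<gamma>\<bar> \<le> V" and "mlen \<alpha> + length l \<le> k"
  shows "\<bar>foldr (coord x \<theta>) l v \<alpha>\<bar> \<le> (2 * (1 + M)) ^ length l * V"
  using assms(4)
proof (induction l arbitrary: \<alpha>)
  case Nil
  then show ?case using v by simp
next
  case (Cons j l)
  have "\<bar>coord x \<theta> j (foldr (coord x \<theta>) l v) \<alpha>\<bar> \<le> 2 * (1 + M) * ((2 * (1 + M)) ^ length l * V)"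
    using Cons by (intro coord_bound[OF x] Cons.IH) (simp_all add: mlen_add)
  then show ?case by (simp add: mult.assoc)
qed

text \<open>Length of the index is traded for length of the list: an entry at
  \<open>\<gamma> + munit j\<close> is recovered from the entry at \<open>\<gamma>\<close> with the
  same list and the four with one more factor. In the end only index \<open>0\<close> is left, where
  \<open>A1\<close> vanishes.\<close>

lemma foldr_coord_recover:
  assumes x: "\<bar>x $ 3\<bar> \<le> M" "\<bar>x $ 4\<bar> \<le> M"
    and v: "\<And>l. length l \<le> k \<Longrightarrow> \<bar>foldr (coord x \<theta>) l v 0\<bar> \<le> V" and "mlen \<alpha> + length l \<le> k"
  shows "\<bar>foldr (coord x \<theta>) l v \<alpha>\<bar> \<le> (4 + M) ^ mlen \<alpha> * V"
  using assms(4)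
proof (induction "mlen \<alpha>" arbitrary: \<alpha> l)
  case 0
  then show ?case using v by simp
next
  case (Suc n)
  have "\<alpha> \<noteq> 0" using Suc.hyps(2) by auto
  then obtain j where j: "0 < \<alpha> $ j" by (auto simp: vec_eq_iff)
  define \<gamma> where "\<gamma> = \<alpha> - munit j"
  have \<alpha>: "\<alpha> = \<gamma> + munit j" using j by (auto simp: \<gamma>_def vec_eq_iff axis_def)
  then have n: "n = mlen \<gamma>" using Suc.hyps(2) by (simp add: mlen_add)
  have M: "0 \<le> M" using x by linarith
  have V: "0 \<le> V" using v[of "[]"] by simp
  have n': "mlen \<gamma> + length l < k" using Suc.prems by (simp add: \<alpha> mlen_add)
  have "\<bar>coord x \<theta> i (foldr (coord x \<theta>) l v) \<gamma>\<bar> \<le> (4 + M) ^ n * V" for i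
    using Suc.hyps(1)[OF n, of "i # l"] n' unfolding n by simp
  moreover have "\<bar>foldr (coord x \<theta>) l v \<gamma>\<bar> \<le> (4 + M) ^ n * V"
    using Suc.hyps(1)[OF n, of l] n' unfolding n by simp
  ultimately have "\<bar>foldr (coord x \<theta>) l v (\<gamma> + munit j)\<bar> \<le> (4 + M) * ((4 + M) ^ n * V)"
    by (intro coord_inverse_bound[OF x])
  then show ?case unfolding \<alpha> [symmetric] Suc.hyps(2) [symmetric] by (simp add: mult.assoc)
qed

text \<open>\<open>n\<close> counts the products of coordinates, \<open>K\<close> bounds the passage
  to them and \<open>Q\<close> the way back; the exponential is the Gronwall factor of the Lyapunov
  function. The frequency does not occur. The final \<open>1\<close> secures positivity.\<close>

definition stab_const :: "nat \<Rightarrow> real \<Rightarrow> real \<Rightarrow> real \<Rightarrow> real" where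
  "stab_const k M a T =
    (let n = real (card {l :: 4 list. length l \<le> k}); K = (2 * (1 + M)) ^ k; Q = (4 + M) ^ k
     in Q * sqrt ((n * K\<^sup>2 + 2 * n * K\<^sup>2 * T) * exp ((1 + 2 * n * K\<^sup>2 * a\<^sup>2 * Q\<^sup>2) * T)) + 1)"

lemma stab_const_pos: "0 \<le> M \<Longrightarrow> 0 \<le> T \<Longrightarrow> 0 < stab_const k M a T"
  unfolding stab_const_def Let_def by (intro add_nonneg_pos mult_nonneg_nonneg) auto

text \<open>
  Since \<open>A1\<close> annihilates the entry at index \<open>0\<close>, the entries at \<open>0\<close> of all products of at most \<open>k\<close>
  coordinates change only through \<open>g\<close>; the sum of their squares is the Lyapunov function.
\<close>

lemma linear_stability:
  assumes M: "0 \<le> M" and a: "0 \<le> a" and T: "0 \<le> T"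
    and x: "\<bar>x $ 3\<bar> \<le> M" "\<bar>x $ 4\<bar> \<le> M" and \<tau>: "\<tau> \<le> T" and U: "0 \<le> U" and b: "0 \<le> b"
    and der: "\<And>s \<alpha>. s \<in> {0..\<tau>} \<Longrightarrow> mlen \<alpha> \<le> k \<Longrightarrow>
       ((\<lambda>s. u s \<alpha>) has_real_derivative \<omega> * A1_act x (u s) \<alpha> + g s \<alpha>) (at s within {0..\<tau>})"
    and u0: "\<And>\<alpha>. mlen \<alpha> \<le> k \<Longrightarrow> \<bar>u 0 \<alpha>\<bar> \<le> U"
    and g: "\<And>s V \<alpha>. \<lbrakk>s \<in> {0..\<tau>}; 0 \<le> V; \<And>\<gamma>. mlen \<gamma> \<le> k \<Longrightarrow> \<bar>u s \<gamma>\<bar> \<le> V; mlen \<alpha> \<le> k\<rbrakk>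
       \<Longrightarrow> \<bar>g s \<alpha>\<bar> \<le> a * V + b"
    and s: "s \<in> {0..\<tau>}" and \<alpha>: "mlen \<alpha> \<le> k"
  shows "\<bar>u s \<alpha>\<bar> \<le> stab_const k M a T * (U + b)"
proof -
  define Ls where "Ls = {l :: 4 list. length l \<le> k}"
  have fin: "finite Ls" unfolding Ls_def using finite_lists_length_le[of "UNIV :: 4 set" k] by simp
  define K where "K = (2 * (1 + M)) ^ k"
  define Q where "Q = (4 + M) ^ k"
  define n where "n = real (card Ls)"
  define c where "c = 1 + 2 * n * K\<^sup>2 * a\<^sup>2 * Q\<^sup>2"
  define d where "d = 2 * n * K\<^sup>2"
  define C1 where "C1 = (n * K\<^sup>2 + d * T) * exp (c * T)"
  have C: "stab_const k M a T = Q * sqrt C1 + 1"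
    by (simp add: stab_const_def Let_def C1_def c_def d_def n_def Q_def K_def Ls_def)
  have nonneg: "0 \<le> K" "0 < Q" "0 \<le> n" "0 \<le> c" "0 \<le> d" "0 \<le> C1"
    using M T by (auto simp: K_def Q_def n_def c_def d_def C1_def)
  define W where "W l s = foldr (coord x (\<omega> * s)) l (u s) 0" for l s
  define G where "G l s = foldr (coord x (\<omega> * s)) l (g s) 0" for l s
  define H where "H s = (\<Sum>l\<in>Ls. (W l s)\<^sup>2)" for s
  have H0: "0 \<le> H s" for s unfolding H_def by (intro sum_nonneg) auto
  have W: "(W l has_real_derivative G l s) (at s within {0..\<tau>})" if "s \<in> {0..\<tau>}" "l \<in> Ls" for l s
    using foldr_coord_has_derivative[where u = u and \<omega> = \<omega> and x = x and g = "g s" and k = k and \<alpha> = 0 and l = l,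
        OF der[OF that(1)]] that(2)
    by (simp add: W_def[abs_def] G_def Ls_def)
  have pow_le: "(2 * (1 + M)) ^ length l \<le> K" if "l \<in> Ls" for l
    unfolding K_def using that M by (intro power_increasing) (auto simp: Ls_def)
  \<comment> \<open>Recovery with the empty list returns the entries of \<open>u\<close> themselves,
    so \<open>H\<close> controls the whole vector.\<close>
  have u_le: "\<bar>u s \<gamma>\<bar> \<le> Q * sqrt (H s)" if "s \<in> {0..\<tau>}" "mlen \<gamma> \<le> k" for s \<gamma>
  proof -
    have "\<bar>W l s\<bar> \<le> sqrt (H s)" if "l \<in> Ls" for l
    proof (rule real_le_rsqrt)
      show "\<bar>W l s\<bar>\<^sup>2 \<le> H s" unfolding H_def using member_le_sum[OF that, of "\<lambda>l. (W l s)\<^sup>2"] fin by simp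
    qed
    then have "\<bar>foldr (coord x (\<omega> * s)) [] (u s) \<gamma>\<bar> \<le> (4 + M) ^ mlen \<gamma> * sqrt (H s)"
      using that(2) by (intro foldr_coord_recover[OF x]) (auto simp: W_def Ls_def)
    also have "\<dots> \<le> Q * sqrt (H s)"
      unfolding Q_def using that(2) M H0[of s] by (intro mult_right_mono power_increasing) auto
    finally show ?thesis by simp
  qed
  \<comment> \<open>The source is bounded through a common bound for all entries of
    \<open>u s\<close>; inserting \<open>u_le\<close> expresses it by \<open>H\<close>, which closes
    the differential inequality.\<close>
  have G_le: "(G l s)\<^sup>2 \<le> K\<^sup>2 * (2 * a\<^sup>2 * Q\<^sup>2 * H s + 2 * b\<^sup>2)" if "s \<in> {0..\<tau>}" "l \<in> Ls" for l s
  proof -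
    let ?B = "a * (Q * sqrt (H s)) + b"
    have B: "0 \<le> ?B" using a b nonneg H0[of s] by simp
    have "\<bar>G l s\<bar> \<le> (2 * (1 + M)) ^ length l * ?B"
      unfolding G_def using that nonneg H0[of s]
      by (intro foldr_coord_bound[OF x] g u_le) (auto simp: Ls_def)
    also have "\<dots> \<le> K * ?B" using pow_le[OF that(2)] B by (intro mult_right_mono)
    finally have "(G l s)\<^sup>2 \<le> (K * ?B)\<^sup>2" by (rule abs_le_square_iff[THEN iffD1, OF order_trans]) simp
    also have "\<dots> = K\<^sup>2 * ?B\<^sup>2" by (simp add: power_mult_distrib)
    also have "\<dots> \<le> K\<^sup>2 * (2 * (a * (Q * sqrt (H s)))\<^sup>2 + 2 * b\<^sup>2)"
      by (intro mult_left_mono sq_add_le) auto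
    finally show ?thesis using H0[of s] by (simp add: power_mult_distrib mult.assoc)
  qed
  have "H s \<le> (H 0 + d * b\<^sup>2 * (s - 0)) * exp (c * (s - 0))"
  proof (rule gronwall_linear[where b = \<tau>])
    fix r assume r: "r \<in> {0..\<tau>}"
    show "(H has_real_derivative (\<Sum>l\<in>Ls. 2 * W l r * G l r)) (at r within {0..\<tau>})"
      unfolding H_def using W[OF r] by (intro DERIV_sum) (auto intro!: derivative_eq_intros)
    have "(\<Sum>l\<in>Ls. 2 * W l r * G l r) \<le> (\<Sum>l\<in>Ls. (W l r)\<^sup>2 + K\<^sup>2 * (2 * a\<^sup>2 * Q\<^sup>2 * H r + 2 * b\<^sup>2))"
    proof (rule sum_mono)
      fix l assume "l \<in> Ls"
      from G_le[OF r this] sum_squares_bound[of "W l r" "G l r"]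
      show "2 * W l r * G l r \<le> (W l r)\<^sup>2 + K\<^sup>2 * (2 * a\<^sup>2 * Q\<^sup>2 * H r + 2 * b\<^sup>2)" by linarith
    qed
    also have "\<dots> = c * H r + d * b\<^sup>2"
      by (simp add: sum.distrib H_def[symmetric] n_def[symmetric] c_def d_def algebra_simps)
    finally show "(\<Sum>l\<in>Ls. 2 * W l r * G l r) \<le> c * H r + d * b\<^sup>2" .
  qed (use nonneg s in auto)
  also have "\<dots> \<le> (n * K\<^sup>2 * U\<^sup>2 + d * b\<^sup>2 * T) * exp (c * T)"
  proof (intro mult_mono add_mono)
    have "H 0 \<le> (\<Sum>l\<in>Ls. K\<^sup>2 * U\<^sup>2)" unfolding H_def
    proof (rule sum_mono)
      fix l assume l: "l \<in> Ls"
      have "\<bar>W l 0\<bar> \<le> (2 * (1 + M)) ^ length l * U"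
        unfolding W_def using l by (intro foldr_coord_bound[OF x, where k = k]) (auto simp: Ls_def u0)
      also have "\<dots> \<le> K * U" using pow_le[OF l] U by (intro mult_right_mono)
      finally have "(W l 0)\<^sup>2 \<le> (K * U)\<^sup>2" by (rule abs_le_square_iff[THEN iffD1, OF order_trans]) simp
      then show "(W l 0)\<^sup>2 \<le> K\<^sup>2 * U\<^sup>2" by (simp add: power_mult_distrib)
    qed
    then show "H 0 \<le> n * K\<^sup>2 * U\<^sup>2" by (simp add: n_def)
    show "exp (c * (s - 0)) \<le> exp (c * T)" using s \<tau> nonneg by (auto intro: mult_left_mono)
  qed (use s \<tau> nonneg T in \<open>auto intro!: mult_left_mono mult_nonneg_nonneg add_nonneg_nonneg\<close>)
  also have "\<dots> \<le> C1 * (U + b)\<^sup>2"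
  proof -
    have "U\<^sup>2 \<le> (U + b)\<^sup>2" "b\<^sup>2 \<le> (U + b)\<^sup>2" using U b by (auto intro!: power_mono)
    then have "n * K\<^sup>2 * U\<^sup>2 + (d * T) * b\<^sup>2 \<le> n * K\<^sup>2 * (U + b)\<^sup>2 + (d * T) * (U + b)\<^sup>2"
      using nonneg T by (intro add_mono mult_left_mono) auto
    then have "(n * K\<^sup>2 * U\<^sup>2 + (d * T) * b\<^sup>2) * exp (c * T)
        \<le> (n * K\<^sup>2 * (U + b)\<^sup>2 + (d * T) * (U + b)\<^sup>2) * exp (c * T)"
      by (rule mult_right_mono) simp
    then show ?thesis by (simp add: C1_def algebra_simps)
  qed
  finally have "sqrt (H s) \<le> sqrt (C1 * (U + b)\<^sup>2)" by simp
  also have "\<dots> = sqrt C1 * (U + b)" using U b by (simp add: real_sqrt_mult)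
  finally have "Q * sqrt (H s) \<le> Q * (sqrt C1 * (U + b))" using nonneg by simp
  then show ?thesis
    using u_le[OF s \<alpha>] U b by (simp add: C distrib_right mult.assoc)
qed

section \<open>Consistency of one step\<close>

definition mpow :: "real ^ 4 \<Rightarrow> mindex \<Rightarrow> real" where
  "mpow \<xi> \<alpha> = (\<Prod>i\<in>UNIV. \<xi> $ i ^ (\<alpha> $ i))"

lemma mpow_add: "mpow \<xi> (\<alpha> + \<beta>) = mpow \<xi> \<alpha> * mpow \<xi> \<beta>"
  by (simp add: mpow_def power_add prod.distrib)

lemma mpow_0 [simp]: "mpow \<xi> 0 = 1"
  by (simp add: mpow_def)

lemma mpow_munit: "mpow \<xi> (munit i) = \<xi> $ i"
proof -
  have "mpow \<xi> (munit i) = (\<Prod>j\<in>UNIV. if i = j then \<xi> $ j else 1)"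
    unfolding mpow_def by (intro prod.cong refl) (simp add: axis_def)
  then show ?thesis by simp
qed

text \<open>By \<open>0 ^ 0 = 1\<close> the monomials of the zero increment form the initial vector
  of the scheme, so the comparison of \<open>v\<close> with the monomials starts without
  error.\<close>

lemma mpow_zero: "mpow 0 \<alpha> = e1D \<alpha>"
proof (cases "\<alpha> = 0")
  case False
  then obtain i where "0 < \<alpha> $ i" by (auto simp: vec_eq_iff)
  then have "mpow 0 \<alpha> = 0" unfolding mpow_def by (intro prod_zero bexI[of _ i]) simp_all
  then show ?thesis using False by (simp add: e1D_def)
qed (simp add: e1D_def)

lemma mpow_bound:
  assumes "\<And>i. \<bar>\<xi> $ i\<bar> \<le> \<rho>"
  shows "\<bar>mpow \<xi> \<alpha>\<bar> \<le> \<rho> ^ mlen \<alpha>"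
proof -
  have "\<bar>mpow \<xi> \<alpha>\<bar> = (\<Prod>i\<in>UNIV. \<bar>\<xi> $ i\<bar> ^ (\<alpha> $ i))"
    by (simp add: mpow_def abs_prod power_abs)
  also have "\<dots> \<le> (\<Prod>i\<in>UNIV. \<rho> ^ (\<alpha> $ i))"
    by (intro prod_mono) (auto intro!: power_mono assms)
  also have "\<dots> = \<rho> ^ mlen \<alpha>" by (simp add: mlen_def power_sum)
  finally show ?thesis .
qed

lemma mpow_eq: "mpow z \<beta> = z $ 1 ^ (\<beta> $ 1) * z $ 2 ^ (\<beta> $ 2) * z $ 3 ^ (\<beta> $ 3) * z $ 4 ^ (\<beta> $ 4)"
  unfolding mpow_def UNIV_4 by (simp add: mult.assoc)

lemma mpow_has_derivative:
  assumes "\<And>i. ((\<lambda>s. \<xi> s $ i) has_real_derivative d i) (at s within S)"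
  shows "((\<lambda>s. mpow (\<xi> s) \<alpha>) has_real_derivative
    (\<Sum>i\<in>UNIV. real (\<alpha> $ i) * mpow (\<xi> s) (\<alpha> - munit i) * d i)) (at s within S)"
proof -
  have m: "(\<alpha> - munit i) $ j = (if i = j then \<alpha> $ j - 1 else \<alpha> $ j)" for i j
    by (simp add: munit_nth del: One_nat_def)
  have p: "((\<lambda>s. \<xi> s $ i ^ (\<alpha> $ i)) has_real_derivative real (\<alpha> $ i) * (d i * \<xi> s $ i ^ (\<alpha> $ i - 1))) (at s within S)" for i
    using DERIV_power[OF assms[of i], of "\<alpha> $ i"] by simp
  have ne: "(1::4) \<noteq> 2" "(1::4) \<noteq> 3" "(1::4) \<noteq> 4" "(2::4) \<noteq> 3" "(2::4) \<noteq> 4" "(3::4) \<noteq> 4"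
    by simp_all
  show ?thesis
    unfolding mpow_eq
    by (rule DERIV_cong[OF DERIV_mult[OF DERIV_mult[OF DERIV_mult[OF p p] p] p]])
      (simp only: sum_4 m ne ne[symmetric] if_True if_False refl, simp only: algebra_simps)
qed

section \<open>The force part and its truncation defect\<close>

definition pos_indices :: "nat \<Rightarrow> mindex set" where
  "pos_indices n = {\<beta>. \<beta> $ 3 = 0 \<and> \<beta> $ 4 = 0 \<and> mlen \<beta> \<le> n}"

definition taylor_coeff :: "(real ^ 2 \<Rightarrow> real ^ 2) \<Rightarrow> real ^ 4 \<Rightarrow> 2 \<Rightarrow> mindex \<Rightarrow> real" where
  "taylor_coeff E x j \<beta> = pderiv_mi (\<beta> $ 1) (\<beta> $ 2) (\<lambda>y. E y $ j) (vector [x $ 1, x $ 2])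
     / (fact (\<beta> $ 1) * fact (\<beta> $ 2))"

lemma finite_pos_indices [simp]: "finite (pos_indices n)"
  by (rule finite_subset[OF _ finite_mindices[of n]]) (auto simp: pos_indices_def mindices_def)

lemma A0_act_eq:
  "A0_act E k x v \<alpha> =
     real (\<alpha> $ 3) * (\<Sum>\<beta> | \<beta> $ 3 = 0 \<and> \<beta> $ 4 = 0 \<and> mlen \<beta> + mlen \<alpha> \<le> k + 1. taylor_coeff E x 1 \<beta> * v (\<alpha> + \<beta> - munit 3))
   + real (\<alpha> $ 4) * (\<Sum>\<beta> | \<beta> $ 3 = 0 \<and> \<beta> $ 4 = 0 \<and> mlen \<beta> + mlen \<alpha> \<le> k + 1. taylor_coeff E x 2 \<beta> * v (\<alpha> + \<beta> - munit 4))"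
  unfolding A0_act_def taylor_coeff_def sum_distrib_left sum.distrib [symmetric]
  by (intro sum.cong refl) (simp add: field_simps)

lemma A0_act_0 [simp]: "A0_act E k x v 0 = 0"
  by (simp add: A0_act_eq)

text \<open>These two rows are the force driving the numerical curve: the Taylor polynomial of the
  field with its monomials replaced by entries of \<open>v\<close>.\<close>

lemma A0_act_munit:
  "A0_act E k x v (munit 3) = (\<Sum>\<beta>\<in>pos_indices k. taylor_coeff E x 1 \<beta> * v \<beta>)"
  "A0_act E k x v (munit 4) = (\<Sum>\<beta>\<in>pos_indices k. taylor_coeff E x 2 \<beta> * v \<beta>)"
  using munit_add_diff_same unfolding A0_act_eq pos_indices_def
  by (simp_all add: munit_nth add.commute del: One_nat_def)

lemma mlen_add_diff_munit: "0 < \<alpha> $ i \<Longrightarrow> mlen (\<alpha> + \<beta> - munit i) + 1 = mlen \<alpha> + mlen \<beta>"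
  using mlen_diff_munit[of "\<alpha> + \<beta>" i] by (simp add: mlen_add)

lemma sum_pos_indices_restrict:
  assumes "0 < mlen \<alpha>"
  shows "(\<Sum>\<beta> | \<beta> $ 3 = 0 \<and> \<beta> $ 4 = 0 \<and> mlen \<beta> + mlen \<alpha> \<le> k + 1. f \<beta>)
    = (\<Sum>\<beta>\<in>pos_indices k. if mlen \<beta> + mlen \<alpha> \<le> k + 1 then f \<beta> else 0 :: real)"
proof -
  have "{\<beta>. \<beta> $ 3 = 0 \<and> \<beta> $ 4 = 0 \<and> mlen \<beta> + mlen \<alpha> \<le> k + 1} = {\<beta> \<in> pos_indices k. mlen \<beta> + mlen \<alpha> \<le> k + 1}"
    using assms by (auto simp: pos_indices_def)
  then show ?thesis by (simp add: sum.inter_filter)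
qed

lemma A0_component_bound:
  assumes c: "\<And>\<beta>. \<beta> \<in> pos_indices k \<Longrightarrow> \<bar>c \<beta>\<bar> \<le> D" and v: "\<And>\<gamma>. mlen \<gamma> \<le> k \<Longrightarrow> \<bar>v \<gamma>\<bar> \<le> V"
    and \<alpha>: "mlen \<alpha> \<le> k" and i: "0 < \<alpha> $ i" and V: "0 \<le> V" and D: "0 \<le> D"
  shows "\<bar>\<Sum>\<beta> | \<beta> $ 3 = 0 \<and> \<beta> $ 4 = 0 \<and> mlen \<beta> + mlen \<alpha> \<le> k + 1. c \<beta> * v (\<alpha> + \<beta> - munit i)\<bar>
     \<le> real (card (pos_indices k)) * (D * V)"
proof -
  have l: "0 < mlen \<alpha>" using mlen_diff_munit[OF i] by simp
  have "\<bar>\<Sum>\<beta>\<in>pos_indices k. if mlen \<beta> + mlen \<alpha> \<le> k + 1 then c \<beta> * v (\<alpha> + \<beta> - munit i) else 0\<bar> \<le> (\<Sum>\<beta>\<in>pos_indices k. D * V)"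
  proof (rule order_trans[OF sum_abs sum_mono])
    fix \<beta> assume \<beta>: "\<beta> \<in> pos_indices k"
    have "\<bar>c \<beta> * v (\<alpha> + \<beta> - munit i)\<bar> \<le> D * V" if "mlen \<beta> + mlen \<alpha> \<le> k + 1"
      unfolding abs_mult using that mlen_add_diff_munit[OF i, of \<beta>] D
      by (intro mult_mono c[OF \<beta>] v) auto
    then show "\<bar>if mlen \<beta> + mlen \<alpha> \<le> k + 1 then c \<beta> * v (\<alpha> + \<beta> - munit i) else 0\<bar> \<le> D * V"
      using V D by auto
  qed
  then show ?thesis unfolding sum_pos_indices_restrict[OF l] by simp
qed

text \<open>The bounds on \<open>p\<close> and \<open>q\<close> are conditional because a truncated
  difference is the intended index only where its coefficient is positive.\<close>

lemma A0_combination_bound: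
  fixes p q B :: real
  assumes "0 < \<alpha> $ 3 \<Longrightarrow> \<bar>p\<bar> \<le> B" "0 < \<alpha> $ 4 \<Longrightarrow> \<bar>q\<bar> \<le> B" "0 \<le> B" "mlen \<alpha> \<le> k"
  shows "\<bar>real (\<alpha> $ 3) * p + real (\<alpha> $ 4) * q\<bar> \<le> 2 * real k * B"
proof -
  have le: "\<alpha> $ i \<le> k" for i
    using member_le_sum[of i UNIV "\<lambda>i. \<alpha> $ i"] assms(4) by (simp add: mlen_def)
  have "\<bar>real (\<alpha> $ i) * c\<bar> \<le> real k * B" if "0 < \<alpha> $ i \<Longrightarrow> \<bar>c\<bar> \<le> B" for i c
  proof (cases "\<alpha> $ i = 0")
    case False
    then show ?thesis unfolding abs_mult using that le[of i] by (intro mult_mono) auto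
  qed (use assms(3) in simp)
  from this[of 3 p, OF assms(1)] this[of 4 q, OF assms(2)] show ?thesis by simp
qed

lemma A0_act_bound:
  assumes c: "\<And>j \<beta>. \<beta> \<in> pos_indices k \<Longrightarrow> \<bar>taylor_coeff E x j \<beta>\<bar> \<le> D" and v: "\<And>\<gamma>. mlen \<gamma> \<le> k \<Longrightarrow> \<bar>v \<gamma>\<bar> \<le> V"
    and \<alpha>: "mlen \<alpha> \<le> k" and V: "0 \<le> V" and D: "0 \<le> D"
  shows "\<bar>A0_act E k x v \<alpha>\<bar> \<le> 2 * real k * (real (card (pos_indices k)) * (D * V))"
  unfolding A0_act_eq
  by (rule A0_combination_bound[OF _ _ _ \<alpha>]; (rule A0_component_bound[OF _ _ \<alpha> _ V D])?)
    (use c v V D in simp_all)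

text \<open>For exact monomials both sums agree except for the terms cut off in the second one,
  which have degree at least \<open>k + 1\<close>: this gives \<open>\<rho> ^ (k + 1)\<close>.
  Exchanging monomials for entries of \<open>v\<close> costs \<open>V\<close> in each sum, up to the
  common factor.\<close>

lemma A0_component_defect:
  assumes c: "\<And>\<beta>. \<beta> \<in> pos_indices k \<Longrightarrow> \<bar>c \<beta>\<bar> \<le> D" and u: "\<And>\<gamma>. mlen \<gamma> \<le> k \<Longrightarrow> \<bar>mpow \<xi> \<gamma> - v \<gamma>\<bar> \<le> V"
    and \<xi>: "\<And>i. \<bar>\<xi> $ i\<bar> \<le> \<rho>" and \<rho>: "0 \<le> \<rho>" "\<rho> \<le> r"
    and \<alpha>: "mlen \<alpha> \<le> k" and i: "0 < \<alpha> $ i" and V: "0 \<le> V" and D: "0 \<le> D"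
  shows "\<bar>mpow \<xi> (\<alpha> - munit i) * (\<Sum>\<beta>\<in>pos_indices k. c \<beta> * v \<beta>)
      - (\<Sum>\<beta> | \<beta> $ 3 = 0 \<and> \<beta> $ 4 = 0 \<and> mlen \<beta> + mlen \<alpha> \<le> k + 1. c \<beta> * v (\<alpha> + \<beta> - munit i))\<bar>
     \<le> real (card (pos_indices k)) * (D * ((1 + r) ^ (2 * k) * (\<rho> ^ (k + 1) + 2 * V)))"
proof -
  have l: "0 < mlen \<alpha>" and l1: "mlen (\<alpha> - munit i) + 1 = mlen \<alpha>" using mlen_diff_munit[OF i] by simp_all
  \<comment> \<open>Dominates every power of \<open>\<rho>\<close> with exponent up to
    \<open>2 * k\<close>, whether \<open>\<rho>\<close> is below or above one.\<close>
  let ?P = "(1 + r) ^ (2 * k)"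
  let ?m = "mpow \<xi> (\<alpha> - munit i)"
  have P1: "1 \<le> ?P" using \<rho> by (intro one_le_power) simp
  have pow: "\<rho> ^ n \<le> ?P" if "n \<le> 2 * k" for n
  proof -
    have "\<rho> ^ n \<le> (1 + r) ^ n" using \<rho> by (intro power_mono) auto
    also have "\<dots> \<le> ?P" using \<rho> that by (intro power_increasing) auto
    finally show ?thesis .
  qed
  have m: "\<bar>?m\<bar> \<le> ?P"
    using order_trans[OF mpow_bound[OF \<xi>] pow[of "mlen (\<alpha> - munit i)"]] l1 \<alpha> by simp
  have term_le: "\<bar>?m * (c \<beta> * v \<beta>) - (if mlen \<beta> + mlen \<alpha> \<le> k + 1 then c \<beta> * v (\<alpha> + \<beta> - munit i) else 0)\<bar>
     \<le> D * (?P * (\<rho> ^ (k + 1) + 2 * V))" if \<beta>: "\<beta> \<in> pos_indices k" for \<beta>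
  proof -
    have \<beta>k: "mlen \<beta> \<le> k" using \<beta> by (simp add: pos_indices_def)
    have mu: "\<bar>?m * (mpow \<xi> \<beta> - v \<beta>)\<bar> \<le> ?P * V"
      unfolding abs_mult using m u[OF \<beta>k] P1 by (intro mult_mono) auto
    have r0: "0 \<le> \<rho> ^ (k + 1)" using \<rho> by simp
    have "\<alpha> + \<beta> - munit i = (\<alpha> - munit i) + \<beta>"
      using i by (auto simp: vec_eq_iff axis_def)
    then have mm: "mpow \<xi> (\<alpha> + \<beta> - munit i) = ?m * mpow \<xi> \<beta>" by (simp add: mpow_add)
    show ?thesis
    proof (cases "mlen \<beta> + mlen \<alpha> \<le> k + 1")
      case True
      let ?w = "mpow \<xi> (\<alpha> + \<beta> - munit i) - v (\<alpha> + \<beta> - munit i)"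
      have w: "\<bar>?w\<bar> \<le> V" using True mlen_add_diff_munit[OF i, of \<beta>] by (intro u) simp
      have "V \<le> ?P * V" using P1 V by (simp add: mult_le_cancel_right1)
      then have "\<bar>?w - ?m * (mpow \<xi> \<beta> - v \<beta>)\<bar> \<le> 2 * (?P * V)" using w mu by linarith
      also have "\<dots> \<le> ?P * (\<rho> ^ (k + 1) + 2 * V)" using r0 P1 by (simp add: distrib_left)
      finally have "\<bar>c \<beta> * (?w - ?m * (mpow \<xi> \<beta> - v \<beta>))\<bar> \<le> D * (?P * (\<rho> ^ (k + 1) + 2 * V))"
        unfolding abs_mult using c[OF \<beta>] D by (intro mult_mono) auto
      moreover have "?m * (c \<beta> * v \<beta>) - c \<beta> * v (\<alpha> + \<beta> - munit i) = c \<beta> * (?w - ?m * (mpow \<xi> \<beta> - v \<beta>))"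
        unfolding mm by (simp add: algebra_simps)
      ultimately show ?thesis using True by simp
    next
      case False
      \<comment> \<open>The degree in excess of \<open>k + 1\<close>; its power of
        \<open>\<rho>\<close> is absorbed by \<open>?P\<close>.\<close>
      define n where "n = mlen (\<alpha> + \<beta> - munit i) - (k + 1)"
      have n: "mlen (\<alpha> + \<beta> - munit i) = (k + 1) + n" "n \<le> 2 * k"
        using False \<alpha> \<beta>k mlen_add_diff_munit[OF i, of \<beta>] by (auto simp: n_def)
      have "\<bar>mpow \<xi> (\<alpha> + \<beta> - munit i)\<bar> \<le> \<rho> ^ (k + 1) * \<rho> ^ n"
        using mpow_bound[OF \<xi>, of "\<alpha> + \<beta> - munit i"] unfolding n(1) power_add .
      also have "\<dots> \<le> \<rho> ^ (k + 1) * ?P" using r0 pow[OF n(2)] by (rule mult_left_mono[rotated])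
      finally have "\<bar>?m * mpow \<xi> \<beta> - ?m * (mpow \<xi> \<beta> - v \<beta>)\<bar> \<le> \<rho> ^ (k + 1) * ?P + ?P * V"
        using mu unfolding mm by linarith
      also have "\<dots> \<le> ?P * (\<rho> ^ (k + 1) + 2 * V)" using P1 V by (simp add: algebra_simps)
      finally have "\<bar>c \<beta> * (?m * mpow \<xi> \<beta> - ?m * (mpow \<xi> \<beta> - v \<beta>))\<bar> \<le> D * (?P * (\<rho> ^ (k + 1) + 2 * V))"
        unfolding abs_mult using c[OF \<beta>] D by (intro mult_mono) auto
      then show ?thesis using False by (simp add: algebra_simps)
    qed
  qed
  have "mpow \<xi> (\<alpha> - munit i) * (\<Sum>\<beta>\<in>pos_indices k. c \<beta> * v \<beta>)
      - (\<Sum>\<beta> | \<beta> $ 3 = 0 \<and> \<beta> $ 4 = 0 \<and> mlen \<beta> + mlen \<alpha> \<le> k + 1. c \<beta> * v (\<alpha> + \<beta> - munit i))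
    = (\<Sum>\<beta>\<in>pos_indices k. ?m * (c \<beta> * v \<beta>) - (if mlen \<beta> + mlen \<alpha> \<le> k + 1 then c \<beta> * v (\<alpha> + \<beta> - munit i) else 0))"
    unfolding sum_pos_indices_restrict[OF l] by (simp add: sum_subtractf sum_distrib_left)
  also have "\<bar>\<dots>\<bar> \<le> (\<Sum>\<beta>\<in>pos_indices k. D * (?P * (\<rho> ^ (k + 1) + 2 * V)))"
    by (rule order_trans[OF sum_abs sum_mono]) (rule term_le)
  finally show ?thesis by simp
qed

lemma norm_vector_2_le: "norm (vector [a, b] :: real ^ 2) \<le> \<bar>a\<bar> + \<bar>b\<bar>"
  using norm_le_l1_cart[of "vector [a, b] :: real ^ 2"] by (simp add: sum_2)

lemma taylor_coeff_bound:
  assumes "smooth_bounds E k L" "\<bar>x $ 1\<bar> \<le> R" "\<bar>x $ 2\<bar> \<le> R" "\<beta> \<in> pos_indices k"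
  shows "\<bar>taylor_coeff E x j \<beta>\<bar> \<le> L * (1 + 2 * R)"
proof -
  let ?y = "vector [x $ 1, x $ 2] :: real ^ 2"
  let ?f = "fact (\<beta> $ 1) * fact (\<beta> $ 2) :: real"
  have b: "\<beta> $ 1 + \<beta> $ 2 \<le> k" using assms(4) by (simp add: pos_indices_def mlen_def sum_4)
  have "1 \<le> ?f" using mult_mono[of 1 "fact (\<beta> $ 1)" 1 "fact (\<beta> $ 2) :: real"] by simp
  then have "\<bar>taylor_coeff E x j \<beta>\<bar> \<le> \<bar>pderiv_mi (\<beta> $ 1) (\<beta> $ 2) (\<lambda>y. E y $ j) ?y\<bar>"
    by (simp add: taylor_coeff_def abs_mult divide_le_eq mult_le_cancel_left1)
  also have "\<dots> \<le> L * (1 + norm ?y)" by (rule smooth_bounds_pderiv[OF assms(1) b])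
  also have "\<dots> \<le> L * (1 + 2 * R)"
    using assms(1-3) norm_vector_2_le[of "x $ 1" "x $ 2"]
    by (intro mult_left_mono) (auto simp: smooth_bounds_def)
  finally show ?thesis .
qed

lemma sum_pos_indices_taylor:
  "(\<Sum>\<beta>\<in>pos_indices k. taylor_coeff E x j \<beta> * mpow \<xi> \<beta>) =
   (\<Sum>b2\<le>k. \<Sum>b1\<le>k - b2. pderiv_mi b1 b2 (\<lambda>y. E y $ j) (vector [x $ 1, x $ 2])
      / (fact b1 * fact b2) * \<xi> $ 1 ^ b1 * \<xi> $ 2 ^ b2)"
proof -
  let ?f = "\<lambda>b2 b1. pderiv_mi b1 b2 (\<lambda>y. E y $ j) (vector [x $ 1, x $ 2])
      / (fact b1 * fact b2) * \<xi> $ 1 ^ b1 * \<xi> $ 2 ^ b2"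
  define w :: "nat \<Rightarrow> nat \<Rightarrow> mindex" where "w b1 b2 = (\<chi> i. if i = 1 then b1 else if i = 2 then b2 else 0)" for b1 b2
  have w: "w b1 b2 $ 1 = b1" "w b1 b2 $ 2 = b2" "w b1 b2 $ 3 = 0" "w b1 b2 $ 4 = 0" for b1 b2
    by (simp_all add: w_def)
  have inv: "w (\<beta> $ 1) (\<beta> $ 2) = \<beta>" if "\<beta> \<in> pos_indices k" for \<beta>
    using that by (simp add: vec_eq_iff forall_4 w pos_indices_def)
  have "(\<Sum>b2\<le>k. \<Sum>b1\<le>k - b2. ?f b2 b1) = (\<Sum>(b2, b1)\<in>(SIGMA b2:{..k}. {..k - b2}). ?f b2 b1)"
    by (rule sum.Sigma) auto
  also have "\<dots> = (\<Sum>\<beta>\<in>pos_indices k. taylor_coeff E x j \<beta> * mpow \<xi> \<beta>)"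
  proof (rule sum.reindex_bij_witness[where i = "\<lambda>\<beta>. (\<beta> $ 2, \<beta> $ 1)" and j = "\<lambda>(b2, b1). w b1 b2"])
    fix p assume "p \<in> (SIGMA b2:{..k}. {..k - b2})"
    then obtain b2 b1 where p: "p = (b2, b1)" "b2 \<le> k" "b1 \<le> k - b2" by auto
    show "(case p of (b2, b1) \<Rightarrow> w b1 b2) \<in> pos_indices k"
      using p by (simp add: pos_indices_def mlen_def sum_4 w)
    show "((case p of (b2, b1) \<Rightarrow> w b1 b2) $ 2, (case p of (b2, b1) \<Rightarrow> w b1 b2) $ 1) = p"
      using p by (simp add: w)
    show "taylor_coeff E x j (case p of (b2, b1) \<Rightarrow> w b1 b2) * mpow \<xi> (case p of (b2, b1) \<Rightarrow> w b1 b2)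
       = (case p of (b2, b1) \<Rightarrow> ?f b2 b1)"
      by (simp add: p taylor_coeff_def w mpow_eq)
  next
    fix \<beta> assume "\<beta> \<in> pos_indices k"
    then show "(case (\<beta> $ 2, \<beta> $ 1) of (b2, b1) \<Rightarrow> w b1 b2) = \<beta>"
      "(\<beta> $ 2, \<beta> $ 1) \<in> (SIGMA b2:{..k}. {..k - b2})"
      using inv by (auto simp: pos_indices_def mlen_def sum_4)
  qed
  finally show ?thesis by simp
qed

section \<open>The curve traced by one step\<close>

lemma lle_flow_index_0: "lle_flow E k \<omega> x s 0 = 1"
proof -
  have "((\<lambda>s. lle_flow E k \<omega> x s 0) has_real_derivative 0) (at s)" for s
    using lle_flow_has_derivative[of 0 k E \<omega> x s UNIV] by simp
  then have "lle_flow E k \<omega> x s 0 = lle_flow E k \<omega> x 0 0" by (intro DERIV_isconst_all) simp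
  then show ?thesis by (simp add: lle_flow_0 e1D_def)
qed

lemma A1_act_munit:
  "A1_act x v (munit 1) = v (munit 3) + x $ 3 * v 0"
  "A1_act x v (munit 2) = v (munit 4) + x $ 4 * v 0"
  "A1_act x v (munit 3) = v (munit 4) + x $ 4 * v 0"
  "A1_act x v (munit 4) = - (v (munit 3) + x $ 3 * v 0)"
  using A1_act_shift[of x v 0] A1_act_0[of x] by (simp_all del: One_nat_def)

lemma Pi_x_nth: "Pi_x v $ i = v (munit i)"
  by (simp add: Pi_x_def)

lemma Pi_x_lle_flow_0: "1 \<le> k \<Longrightarrow> Pi_x (lle_flow E k \<omega> x 0) = 0"
  by (subst vec_eq_iff) (simp add: Pi_x_nth lle_flow_0 e1D_def)

text \<open>As the entry at \<open>0\<close> stays \<open>1\<close>, the entries at unit indices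
  obey a closed gyration. Its right-hand side does not see the position, which leaves the first two
  components of \<open>c\<close> free.\<close>

lemma lle_flow_gyro:
  assumes k: "1 \<le> k" and c: "c $ 3 = x $ 3" "c $ 4 = x $ 4"
  shows "gyro \<omega> a b (\<lambda>s. c + Pi_x (lle_flow E k \<omega> x s))
     (\<lambda>s. A0_act E k x (lle_flow E k \<omega> x s) (munit 3)) (\<lambda>s. A0_act E k x (lle_flow E k \<omega> x s) (munit 4))"
proof -
  have d: "((\<lambda>s. (c + Pi_x (lle_flow E k \<omega> x s)) $ i) has_real_derivative
     \<omega> * A1_act x (lle_flow E k \<omega> x s) (munit i) + A0_act E k x (lle_flow E k \<omega> x s) (munit i)) (at s within S)" for i s S
    unfolding vector_add_component Pi_x_nth
    using k by (intro DERIV_cong[OF DERIV_add[OF DERIV_const lle_flow_has_derivative]]) simp_all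
  have z: "A0_act E k x v (munit 1) = 0" "A0_act E k x v (munit 2) = 0" for v
    by (simp_all add: A0_act_eq munit_nth del: One_nat_def)
  show ?thesis unfolding gyro_def
    using d[of 1] d[of 2] d[of 3] d[of 4]
    unfolding A1_act_munit z lle_flow_index_0
    by (simp add: c Pi_x_nth algebra_simps del: One_nat_def)
qed

text \<open>The monomials of the curve satisfy the product rule to which \<open>A1\<close> is dual,
  so the mismatch obeys the same stiff equation as \<open>v\<close>. Everything that carries
  \<open>\<omega>\<close> is in the \<open>A1\<close> term; the rest is the defect of the force
  part.\<close>

lemma mpow_flow_derivative:
  assumes k: "1 \<le> k" and "mlen \<alpha> \<le> k"
    and v_def: "v = lle_flow E k \<omega> x"
  shows "((\<lambda>s. mpow (Pi_x (v s)) \<alpha> - v s \<alpha>) has_real_derivative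
     \<omega> * A1_act x (\<lambda>\<gamma>. mpow (Pi_x (v s)) \<gamma> - v s \<gamma>) \<alpha>
     + (real (\<alpha> $ 3) * (mpow (Pi_x (v s)) (\<alpha> - munit 3) * A0_act E k x (v s) (munit 3))
      + real (\<alpha> $ 4) * (mpow (Pi_x (v s)) (\<alpha> - munit 4) * A0_act E k x (v s) (munit 4))
      - A0_act E k x (v s) \<alpha>)) (at s within S)"
proof -
  have "((\<lambda>s. Pi_x (v s) $ i) has_real_derivative
     \<omega> * A1_act x (v s) (munit i) + A0_act E k x (v s) (munit i)) (at s within S)" for i
    unfolding Pi_x_nth v_def using k by (intro lle_flow_has_derivative) simp
  from DERIV_diff[OF mpow_has_derivative[OF this, of \<alpha>] lle_flow_has_derivative[OF assms(2), of E \<omega> x s S, folded v_def]]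
  have d: "((\<lambda>s. mpow (Pi_x (v s)) \<alpha> - v s \<alpha>) has_real_derivative
    (\<Sum>i\<in>UNIV. real (\<alpha> $ i) * mpow (Pi_x (v s)) (\<alpha> - munit i)
        * (\<omega> * A1_act x (v s) (munit i) + A0_act E k x (v s) (munit i)))
     - (\<omega> * A1_act x (v s) \<alpha> + A0_act E k x (v s) \<alpha>)) (at s within S)" .
  have z: "A0_act E k x v (munit 1) = 0" "A0_act E k x v (munit 2) = 0" for v
    by (simp_all add: A0_act_eq munit_nth del: One_nat_def)
  have v0: "v s 0 = 1" by (simp add: v_def lle_flow_index_0)
  have eq: "(\<Sum>i\<in>UNIV. real (\<alpha> $ i) * mpow (Pi_x (v s)) (\<alpha> - munit i)
        * (\<omega> * A1_act x (v s) (munit i) + A0_act E k x (v s) (munit i)))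
     - (\<omega> * A1_act x (v s) \<alpha> + A0_act E k x (v s) \<alpha>) =
     \<omega> * A1_act x (\<lambda>\<gamma>. mpow (Pi_x (v s)) \<gamma> - v s \<gamma>) \<alpha>
     + (real (\<alpha> $ 3) * (mpow (Pi_x (v s)) (\<alpha> - munit 3) * A0_act E k x (v s) (munit 3))
      + real (\<alpha> $ 4) * (mpow (Pi_x (v s)) (\<alpha> - munit 4) * A0_act E k x (v s) (munit 4))
      - A0_act E k x (v s) \<alpha>)"
    unfolding sum_4 A1_act_munit z v0 unfolding A1_act_def mpow_add mpow_munit Pi_x_nth
    by (simp add: algebra_simps del: One_nat_def)
  show ?thesis by (rule DERIV_cong[OF d eq])
qed

lemma abs_coeff_sum_le:
  assumes "\<And>\<beta>. \<beta> \<in> pos_indices k \<Longrightarrow> \<bar>c \<beta>\<bar> \<le> D" "\<And>\<gamma>. mlen \<gamma> \<le> k \<Longrightarrow> \<bar>v \<gamma>\<bar> \<le> V" "0 \<le> D"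
  shows "\<bar>\<Sum>\<beta>\<in>pos_indices k. c \<beta> * v \<beta>\<bar> \<le> real (card (pos_indices k)) * (D * V)"
proof -
  have "\<bar>\<Sum>\<beta>\<in>pos_indices k. c \<beta> * v \<beta>\<bar> \<le> (\<Sum>\<beta>\<in>pos_indices k. D * V)"
    by (rule order_trans[OF sum_abs sum_mono])
      (auto simp: abs_mult pos_indices_def intro!: mult_mono assms)
  then show ?thesis by simp
qed

text \<open>Integrating \<open>\<omega> * p\<close> would bring in the frequency, the energy does
  not. With its free parameter equal to \<open>\<tau>\<close> the exponential stays below
  \<open>exp 1\<close> and the force contributes
  \<open>4 * F\<^sup>2 * \<tau>\<^sup>2\<close>.\<close>

lemma lle_step_increment_bound:
  assumes F: "\<And>s. s \<in> {0..\<tau>} \<Longrightarrow> \<bar>A0_act E k x (lle_flow E k \<omega> x s) (munit 3)\<bar> \<le> F"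
    "\<And>s. s \<in> {0..\<tau>} \<Longrightarrow> \<bar>A0_act E k x (lle_flow E k \<omega> x s) (munit 4)\<bar> \<le> F"
    and k: "1 \<le> k" and \<tau>: "0 < \<tau>" and M: "0 \<le> M" "\<bar>x $ 3\<bar> \<le> M * \<tau>" "\<bar>x $ 4\<bar> \<le> M * \<tau>"
    and s: "s \<in> {0..\<tau>}"
  shows "\<bar>Pi_x (lle_flow E k \<omega> x s) $ i\<bar> \<le> (sqrt (2 * ((2 * M\<^sup>2 + 4 * F\<^sup>2) * exp 1)) + M) * \<tau>"
proof -
  \<comment> \<open>This base point makes \<open>y + J p\<close> vanish at time \<open>0\<close>, so that the initial energy is \<open>O(\<tau>\<^sup>2)\<close>.\<close>
  define c :: "real ^ 4" where "c = (\<chi> i. if i = 1 then - x $ 4 else if i = 2 then x $ 3 else x $ i)"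
  have c: "c $ 1 = - x $ 4" "c $ 2 = x $ 3" "c $ 3 = x $ 3" "c $ 4 = x $ 4"
    by (simp_all add: c_def)
  let ?z = "\<lambda>s. c + Pi_x (lle_flow E k \<omega> x s)"
  have sq: "(x $ 3)\<^sup>2 \<le> M\<^sup>2 * \<tau>\<^sup>2" "(x $ 4)\<^sup>2 \<le> M\<^sup>2 * \<tau>\<^sup>2"
    using M \<tau> abs_le_square_iff[of "x $ 3" "M * \<tau>"] abs_le_square_iff[of "x $ 4" "M * \<tau>"]
    by (simp_all add: power_mult_distrib)
  have F0: "0 \<le> F" using F(1)[OF s] by linarith
  have "gyro_norm2 (?z s) \<le> (gyro_norm2 (?z 0) + 2 * \<tau> * (2 * F\<^sup>2) * (s - 0)) * exp ((1 / \<tau> + 2 * \<tau> * 0) * (s - 0))"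
  proof (rule gyro_energy[OF lle_flow_gyro[OF k c(3,4)] \<tau> _ _ _ s])
    fix t assume t: "t \<in> {0..\<tau>}"
    have "\<And>y. \<bar>y\<bar> \<le> F \<Longrightarrow> y\<^sup>2 \<le> F\<^sup>2" using F0 abs_le_square_iff[of _ F] by simp
    from this[OF F(1)[OF t]] this[OF F(2)[OF t]]
    show "(A0_act E k x (lle_flow E k \<omega> x t) (munit 3))\<^sup>2 + (A0_act E k x (lle_flow E k \<omega> x t) (munit 4))\<^sup>2
       \<le> 0 * gyro_norm2 (?z t) + 2 * F\<^sup>2" by simp
  qed auto
  also have "\<dots> \<le> (2 * M\<^sup>2 * \<tau>\<^sup>2 + 2 * \<tau> * (2 * F\<^sup>2) * \<tau>) * exp 1"
  proof (intro mult_mono add_mono mult_left_mono)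
    have "gyro_norm2 (?z 0) = (x $ 3)\<^sup>2 + (x $ 4)\<^sup>2" by (simp add: gyro_norm2_def c Pi_x_lle_flow_0[OF k])
    then show "gyro_norm2 (?z 0) \<le> 2 * M\<^sup>2 * \<tau>\<^sup>2" using sq by simp
    show "exp ((1 / \<tau> + 2 * \<tau> * 0) * (s - 0)) \<le> exp 1" using s \<tau> by simp
  qed (use s \<tau> in auto)
  also have "\<dots> = ((2 * M\<^sup>2 + 4 * F\<^sup>2) * exp 1) * \<tau>\<^sup>2" by (simp add: algebra_simps power2_eq_square)
  finally have "sqrt (2 * gyro_norm2 (?z s)) \<le> sqrt (2 * ((2 * M\<^sup>2 + 4 * F\<^sup>2) * exp 1) * \<tau>\<^sup>2)" by simp
  also have "\<dots> = sqrt (2 * ((2 * M\<^sup>2 + 4 * F\<^sup>2) * exp 1)) * \<tau>"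
    using \<tau> by (simp add: real_sqrt_mult)
  finally have "\<bar>?z s $ i\<bar> \<le> sqrt (2 * ((2 * M\<^sup>2 + 4 * F\<^sup>2) * exp 1)) * \<tau>"
    using gyro_norm2_component[of "?z s" i] by linarith
  \<comment> \<open>The artificial base point is itself of order \<open>\<tau>\<close>, so it can be
    subtracted again.\<close>
  moreover have "\<bar>c $ i\<bar> \<le> M * \<tau>" using exhaust_4[of i] M by (elim disjE) (simp_all add: c)
  ultimately show ?thesis by (simp add: distrib_right)
qed

text \<open>Stability is used twice. Applied to \<open>v\<close>, it bounds the force and thereby
  the increments, by \<open>r * \<tau>\<close>. Applied to the mismatch between monomials and
  \<open>v\<close>, whose source is then \<open>O(\<tau> ^ (k + 1))\<close>, it shows that the force
  is the Taylor polynomial of the field up to that order. All constants are fixed before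
  \<open>\<omega>\<close>, \<open>\<tau>\<close> and \<open>x\<close>.\<close>

lemma lle_step:
  assumes sb: "smooth_bounds E k L" and k: "1 \<le> k" and M: "0 \<le> M" and R: "0 \<le> R" and T: "0 \<le> T"
  obtains C where "0 < C" and
    "\<And>\<omega> \<tau> x. \<lbrakk>0 < \<tau>; \<tau> \<le> T; \<bar>x $ 3\<bar> \<le> M * \<tau>; \<bar>x $ 4\<bar> \<le> M * \<tau>; \<bar>x $ 1\<bar> \<le> R; \<bar>x $ 2\<bar> \<le> R\<rbrakk> \<Longrightarrow>
      \<exists>z F1 F2. gyro \<omega> 0 \<tau> z F1 F2 \<and> z 0 = x \<and> z \<tau> = x + Pi_x (lle_flow E k \<omega> x \<tau>) \<and>
        (\<forall>s\<in>{0..\<tau>}. \<bar>F1 s - E (vector [z s $ 1, z s $ 2]) $ 1\<bar> \<le> C * \<tau> ^ (k + 1) \<and>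
           \<bar>F2 s - E (vector [z s $ 1, z s $ 2]) $ 2\<bar> \<le> C * \<tau> ^ (k + 1))"
proof -
  have L: "0 \<le> L" using sb by (simp add: smooth_bounds_def)
  define D where "D = L * (1 + 2 * R)"
  have D: "0 \<le> D" using L R by (simp add: D_def)
  define N where "N = real (card (pos_indices k))"
  have N: "0 \<le> N" by (simp add: N_def)
  define a1 where "a1 = 2 * real k * (N * D)"
  have a1: "0 \<le> a1" using N D by (simp add: a1_def)
  have MT: "0 \<le> M * T" using M T by simp
  define C1 where "C1 = stab_const k (M * T) a1 T"
  have C1: "0 < C1" unfolding C1_def using MT T by (rule stab_const_pos)
  define F where "F = a1 * C1"
  define r where "r = sqrt (2 * ((2 * M\<^sup>2 + 4 * F\<^sup>2) * exp 1)) + M"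
  have r: "0 \<le> r" using M by (simp add: r_def)
  define P where "P = (1 + r * T) ^ (2 * k)"
  have P: "0 \<le> P" using r T by (simp add: P_def)
  \<comment> \<open>Collects the factors of \<open>A0_component_defect\<close> for both momentum
    indices; it yields the growth rate \<open>2 * B\<close> and the source
    \<open>B * \<rho> ^ (k + 1)\<close> of the mismatch.\<close>
  define B where "B = 2 * real k * (N * (D * P))"
  have B: "0 \<le> B" using N D P by (simp add: B_def)
  then have B2: "0 \<le> 2 * B" by simp
  define C2 where "C2 = stab_const k (M * T) (2 * B) T"
  have C2: "0 < C2" unfolding C2_def using MT T by (rule stab_const_pos)
  \<comment> \<open>First the replacement of monomials by entries of \<open>v\<close>, then the
    Taylor remainder of the field; both carry \<open>\<rho> ^ (k + 1)\<close> with
    \<open>\<rho> = r * \<tau>\<close>.\<close>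
  define C where "C = (N * (D * (C2 * B)) + real (k + 2) * L) * r ^ (k + 1) + 1"
  have C: "0 < C" unfolding C_def using N D C2 B L r by (intro add_nonneg_pos mult_nonneg_nonneg add_nonneg_nonneg) auto
  show ?thesis
  proof (rule that[OF C])
    fix \<omega> \<tau> :: real and x :: "real ^ 4"
    assume \<tau>: "0 < \<tau>" "\<tau> \<le> T" and x34: "\<bar>x $ 3\<bar> \<le> M * \<tau>" "\<bar>x $ 4\<bar> \<le> M * \<tau>"
      and x12: "\<bar>x $ 1\<bar> \<le> R" "\<bar>x $ 2\<bar> \<le> R"
    have xT: "\<bar>x $ 3\<bar> \<le> M * T" "\<bar>x $ 4\<bar> \<le> M * T"
      using x34 mult_left_mono[OF \<tau>(2) M] by linarith+
    define v where "v = lle_flow E k \<omega> x"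
    define \<xi> where "\<xi> s = Pi_x (v s)" for s
    define G1 where "G1 s = A0_act E k x (v s) (munit 3)" for s
    define G2 where "G2 s = A0_act E k x (v s) (munit 4)" for s
    have tcb: "\<bar>taylor_coeff E x j \<beta>\<bar> \<le> D" if "\<beta> \<in> pos_indices k" for j \<beta>
      unfolding D_def by (rule taylor_coeff_bound[OF sb x12 that])
    have A0b: "\<bar>A0_act E k x w \<alpha>\<bar> \<le> a1 * V" if "\<And>\<gamma>. mlen \<gamma> \<le> k \<Longrightarrow> \<bar>w \<gamma>\<bar> \<le> V" "mlen \<alpha> \<le> k" "0 \<le> V" for w V \<alpha>
      using A0_act_bound[OF tcb that(1,2,3) D] by (simp add: a1_def N_def mult.assoc)
    have vb: "\<bar>v s \<alpha>\<bar> \<le> C1 * (1 + 0)" if "s \<in> {0..\<tau>}" "mlen \<alpha> \<le> k" for s \<alpha>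
      unfolding C1_def
    proof (rule linear_stability[where u = v and s = s and \<alpha> = \<alpha> and g = "\<lambda>s. A0_act E k x (v s)" and \<omega> = \<omega> and x = x and \<tau> = \<tau>])
      show "((\<lambda>s. v s \<alpha>) has_real_derivative \<omega> * A1_act x (v s) \<alpha> + A0_act E k x (v s) \<alpha>) (at s within {0..\<tau>})"
        if "mlen \<alpha> \<le> k" for s \<alpha> unfolding v_def by (rule lle_flow_has_derivative[OF that])
      show "\<bar>v 0 \<alpha>\<bar> \<le> 1" if "mlen \<alpha> \<le> k" for \<alpha> using that by (simp add: v_def lle_flow_0 e1D_def)
      show "\<bar>A0_act E k x (v s) \<alpha>\<bar> \<le> a1 * V + 0"
        if "0 \<le> V" "\<And>\<gamma>. mlen \<gamma> \<le> k \<Longrightarrow> \<bar>v s \<gamma>\<bar> \<le> V" "mlen \<alpha> \<le> k" for s V \<alpha>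
        using A0b[of "v s" V \<alpha>] that by simp
    qed (use xT \<tau> that MT a1 T in auto)
    have G: "\<bar>G1 s\<bar> \<le> F" "\<bar>G2 s\<bar> \<le> F" if "s \<in> {0..\<tau>}" for s
      using A0b[of "v s" C1] vb[OF that] k C1 by (auto simp: G1_def G2_def F_def)
    define \<rho> where "\<rho> = r * \<tau>"
    have \<rho>: "0 \<le> \<rho>" "\<rho> \<le> r * T" using r \<tau> by (auto simp: \<rho>_def intro: mult_left_mono)
    have \<xi>b: "\<bar>\<xi> s $ i\<bar> \<le> \<rho>" if "s \<in> {0..\<tau>}" for s i
      unfolding \<xi>_def v_def \<rho>_def r_def
      using G[unfolded G1_def G2_def v_def] k \<tau>(1) M x34 that by (rule lle_step_increment_bound)
    define b where "b = B * \<rho> ^ (k + 1)"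
    have b: "0 \<le> b" using B \<rho> by (simp add: b_def)
    define u where "u s \<alpha> = mpow (\<xi> s) \<alpha> - v s \<alpha>" for s \<alpha>
    define g where "g s \<alpha> = real (\<alpha> $ 3) * (mpow (\<xi> s) (\<alpha> - munit 3) * G1 s)
      + real (\<alpha> $ 4) * (mpow (\<xi> s) (\<alpha> - munit 4) * G2 s) - A0_act E k x (v s) \<alpha>" for s \<alpha>
    have ub: "\<bar>u s \<alpha>\<bar> \<le> C2 * (0 + b)" if "s \<in> {0..\<tau>}" "mlen \<alpha> \<le> k" for s \<alpha>
      unfolding C2_def
    proof (rule linear_stability[where u = u and s = s and \<alpha> = \<alpha> and g = g and \<omega> = \<omega> and x = x and \<tau> = \<tau>])
      show "((\<lambda>s. u s \<alpha>) has_real_derivative \<omega> * A1_act x (u s) \<alpha> + g s \<alpha>) (at s within {0..\<tau>})"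
        if "mlen \<alpha> \<le> k" for s \<alpha>
        using mpow_flow_derivative[OF k that refl, of E \<omega> x s "{0..\<tau>}"]
        unfolding u_def[abs_def] g_def \<xi>_def v_def G1_def G2_def by simp
      show "\<bar>u 0 \<alpha>\<bar> \<le> 0" if "mlen \<alpha> \<le> k" for \<alpha>
      proof -
        have "\<xi> 0 = 0" by (simp add: \<xi>_def v_def Pi_x_lle_flow_0[OF k])
        then show ?thesis using that by (simp add: u_def mpow_zero v_def lle_flow_0)
      qed
      show "\<bar>g s \<alpha>\<bar> \<le> 2 * B * V + b"
        if s: "s \<in> {0..\<tau>}" and V: "0 \<le> V" "\<And>\<gamma>. mlen \<gamma> \<le> k \<Longrightarrow> \<bar>u s \<gamma>\<bar> \<le> V" and \<alpha>: "mlen \<alpha> \<le> k" for s V \<alpha>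
      proof -
        note pd = A0_component_defect[OF tcb V(2)[unfolded u_def] \<xi>b[OF s] \<rho> \<alpha> _ V(1) D]
        have "\<bar>real (\<alpha> $ 3) * (mpow (\<xi> s) (\<alpha> - munit 3) * G1 s - (\<Sum>\<beta> | \<beta> $ 3 = 0 \<and> \<beta> $ 4 = 0 \<and> mlen \<beta> + mlen \<alpha> \<le> k + 1. taylor_coeff E x 1 \<beta> * v s (\<alpha> + \<beta> - munit 3)))
          + real (\<alpha> $ 4) * (mpow (\<xi> s) (\<alpha> - munit 4) * G2 s - (\<Sum>\<beta> | \<beta> $ 3 = 0 \<and> \<beta> $ 4 = 0 \<and> mlen \<beta> + mlen \<alpha> \<le> k + 1. taylor_coeff E x 2 \<beta> * v s (\<alpha> + \<beta> - munit 4)))\<bar>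
          \<le> 2 * real k * (N * (D * (P * (\<rho> ^ (k + 1) + 2 * V))))"
          unfolding N_def P_def G1_def G2_def A0_act_munit
          by (rule A0_combination_bound[OF _ _ _ \<alpha>]; (rule pd)?)
            (use r T V(1) \<rho> D in \<open>auto intro!: mult_nonneg_nonneg add_nonneg_nonneg\<close>)
        also have "\<dots> = 2 * B * V + b" by (simp add: B_def b_def algebra_simps)
        finally show ?thesis by (simp add: g_def A0_act_eq[of E k x "v s" \<alpha>] algebra_simps)
      qed
    qed (use xT \<tau> b that MT B2 T in auto)
    have def_le: "\<bar>(\<Sum>\<beta>\<in>pos_indices k. taylor_coeff E x j \<beta> * v s \<beta>) - E (vector [(x + \<xi> s) $ 1, (x + \<xi> s) $ 2]) $ j\<bar> \<le> C * \<tau> ^ (k + 1)"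
      if s: "s \<in> {0..\<tau>}" for s j
    proof -
      let ?y = "vector [x $ 1, x $ 2] :: real ^ 2"
      have y: "?y + \<xi> s $ 1 *\<^sub>R axis 1 1 + \<xi> s $ 2 *\<^sub>R axis 2 1 = vector [(x + \<xi> s) $ 1, (x + \<xi> s) $ 2]"
        by (auto simp: vec_eq_iff forall_2 axis_def)
      have 1: "\<bar>E (vector [(x + \<xi> s) $ 1, (x + \<xi> s) $ 2]) $ j - (\<Sum>\<beta>\<in>pos_indices k. taylor_coeff E x j \<beta> * mpow (\<xi> s) \<beta>)\<bar>
          \<le> real (k + 2) * L * \<rho> ^ (k + 1)"
        using smooth_bounds_taylor[OF sb \<xi>b[OF s, of 1] \<xi>b[OF s, of 2], of ?y j] unfolding y sum_pos_indices_taylor .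
      have 2: "\<bar>\<Sum>\<beta>\<in>pos_indices k. taylor_coeff E x j \<beta> * u s \<beta>\<bar> \<le> N * (D * (C2 * (0 + b)))"
        unfolding N_def by (rule abs_coeff_sum_le[OF tcb ub[OF s] D])
      have 3: "(\<Sum>\<beta>\<in>pos_indices k. taylor_coeff E x j \<beta> * mpow (\<xi> s) \<beta>) - (\<Sum>\<beta>\<in>pos_indices k. taylor_coeff E x j \<beta> * v s \<beta>)
        = (\<Sum>\<beta>\<in>pos_indices k. taylor_coeff E x j \<beta> * u s \<beta>)"
        by (simp add: u_def sum_subtractf right_diff_distrib)
      have "\<bar>(\<Sum>\<beta>\<in>pos_indices k. taylor_coeff E x j \<beta> * v s \<beta>) - E (vector [(x + \<xi> s) $ 1, (x + \<xi> s) $ 2]) $ j\<bar>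
         \<le> N * (D * (C2 * (0 + b))) + real (k + 2) * L * \<rho> ^ (k + 1)"
        using 1 2 unfolding 3[symmetric] by linarith
      also have "\<dots> = (N * (D * (C2 * B)) + real (k + 2) * L) * r ^ (k + 1) * \<tau> ^ (k + 1)"
        by (simp add: b_def \<rho>_def power_mult_distrib algebra_simps)
      also have "\<dots> \<le> C * \<tau> ^ (k + 1)" using \<tau> by (intro mult_right_mono) (auto simp: C_def)
      finally show ?thesis .
    qed
    have "gyro \<omega> 0 \<tau> (\<lambda>s. x + \<xi> s) G1 G2"
      using lle_flow_gyro[OF k refl refl, of \<omega> 0 \<tau> x E] by (simp add: \<xi>_def[abs_def] v_def G1_def[abs_def] G2_def[abs_def])
    moreover have "x + \<xi> 0 = x"
      by (simp add: \<xi>_def v_def Pi_x_lle_flow_0[OF k])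
    moreover have "x + \<xi> \<tau> = x + Pi_x (lle_flow E k \<omega> x \<tau>)" by (simp add: \<xi>_def v_def)
    moreover have "\<forall>s\<in>{0..\<tau>}. \<bar>G1 s - E (vector [(x + \<xi> s) $ 1, (x + \<xi> s) $ 2]) $ 1\<bar> \<le> C * \<tau> ^ (k + 1) \<and>
           \<bar>G2 s - E (vector [(x + \<xi> s) $ 1, (x + \<xi> s) $ 2]) $ 2\<bar> \<le> C * \<tau> ^ (k + 1)"
      using def_le unfolding G1_def G2_def A0_act_munit by blast
    ultimately show "\<exists>z F1 F2. gyro \<omega> 0 \<tau> z F1 F2 \<and> z 0 = x \<and> z \<tau> = x + Pi_x (lle_flow E k \<omega> x \<tau>) \<and>
        (\<forall>s\<in>{0..\<tau>}. \<bar>F1 s - E (vector [z s $ 1, z s $ 2]) $ 1\<bar> \<le> C * \<tau> ^ (k + 1) \<and>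
           \<bar>F2 s - E (vector [z s $ 1, z s $ 2]) $ 2\<bar> \<le> C * \<tau> ^ (k + 1))"
      by (intro exI[of _ "\<lambda>s. x + \<xi> s"] exI[of _ G1] exI[of _ G2]) blast
  qed
qed

section \<open>Bounds for the exact trajectory\<close>

definition planar :: "real ^ 4 \<Rightarrow> real ^ 2" where
  "planar x = vector [x $ 1, x $ 2]"

lemma norm_planar: "(norm (planar x))\<^sup>2 = (x $ 1)\<^sup>2 + (x $ 2)\<^sup>2"
  by (simp add: planar_def norm_vec_def L2_set_def sum_2 add_nonneg_nonneg)

lemma planar_diff: "planar (x - z) = planar x - planar z"
  by (simp add: planar_def vec_eq_iff forall_2)

lemma norm_planar_le: "(norm (planar x))\<^sup>2 \<le> 2 * gyro_norm2 x"
  unfolding norm_planar by (rule gyro_norm2_position)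

text \<open>Linear growth of the field makes the squared force affine in the energy, so Gronwall
  applies with a rate independent of \<open>\<omega>\<close>.\<close>

lemma gyro_solution_bounded:
  assumes sb: "smooth_bounds E k L"
    and g: "gyro \<omega> 0 T x (\<lambda>t. E (planar (x t)) $ 1) (\<lambda>t. E (planar (x t)) $ 2)"
    and x0: "\<And>i. \<bar>x 0 $ i\<bar> \<le> r" and t: "t \<in> {0..T}"
  shows "gyro_norm2 (x t) \<le> (10 * r\<^sup>2 + 8 * L\<^sup>2 * T) * exp ((1 + 16 * L\<^sup>2) * T)"
proof -
  have L: "0 \<le> L" using sb by (simp add: smooth_bounds_def)
  have "gyro_norm2 (x t) \<le> (gyro_norm2 (x 0) + 2 * 1 * (4 * L\<^sup>2) * (t - 0)) * exp ((1 / 1 + 2 * 1 * (8 * L\<^sup>2)) * (t - 0))"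
  proof (rule gyro_energy[OF g])
    fix s assume "s \<in> {0..T}"
    have E: "(E (planar (x s)) $ j)\<^sup>2 \<le> 2 * L\<^sup>2 + 4 * L\<^sup>2 * gyro_norm2 (x s)" for j
    proof -
      have "(E (planar (x s)) $ j)\<^sup>2 \<le> (L * (1 + norm (planar (x s))))\<^sup>2"
        by (rule abs_le_square_iff[THEN iffD1, OF order_trans[OF smooth_bounds_growth[OF sb]]]) simp
      also have "\<dots> = L\<^sup>2 * (1 + norm (planar (x s)))\<^sup>2" by (simp add: power_mult_distrib)
      also have "\<dots> \<le> L\<^sup>2 * (2 * 1\<^sup>2 + 2 * (norm (planar (x s)))\<^sup>2)"
        by (intro mult_left_mono sq_add_le) auto
      also have "\<dots> \<le> L\<^sup>2 * (2 + 2 * (2 * gyro_norm2 (x s)))"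
        using norm_planar_le[of "x s"] by (intro mult_left_mono) auto
      finally show ?thesis by (simp add: algebra_simps)
    qed
    show "(E (planar (x s)) $ 1)\<^sup>2 + (E (planar (x s)) $ 2)\<^sup>2 \<le> 8 * L\<^sup>2 * gyro_norm2 (x s) + 4 * L\<^sup>2"
      using E[of 1] E[of 2] by simp
  qed (use t in auto)
  also have "\<dots> \<le> (10 * r\<^sup>2 + 8 * L\<^sup>2 * T) * exp ((1 + 16 * L\<^sup>2) * T)"
  proof (rule mult_mono)
    show "gyro_norm2 (x 0) + 2 * 1 * (4 * L\<^sup>2) * (t - 0) \<le> 10 * r\<^sup>2 + 8 * L\<^sup>2 * T"
      using t gyro_norm2_le[of "x 0" r, OF x0] mult_left_mono[of t T "8 * L\<^sup>2"] by simp
    show "exp ((1 / 1 + 2 * 1 * (8 * L\<^sup>2)) * (t - 0)) \<le> exp ((1 + 16 * L\<^sup>2) * T)"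
      using t mult_left_mono[of t T "1 + 16 * L\<^sup>2"] by simp
  qed (use t in auto)
  finally show ?thesis .
qed

text \<open>The factor \<open>\<omega>\<close> in this derivative is compensated by the weight
  \<open>\<epsilon>\<^sup>2\<close> in the corrected momentum below.\<close>

lemma force_has_derivative:
  assumes sb: "smooth_bounds E k L" "1 \<le> k"
    and g: "gyro \<omega> a b x F1 F2" and t: "t \<in> {a..b}"
  shows "((\<lambda>t. E (planar (x t)) $ j) has_real_derivative
     pd 1 (\<lambda>y. E y $ j) (planar (x t)) * (\<omega> * x t $ 3) + pd 2 (\<lambda>y. E y $ j) (planar (x t)) * (\<omega> * x t $ 4))
     (at t within {a..b})"
proof -
  note * = g[unfolded gyro_def, rule_format, OF t]
  have p: "planar z = z $ 1 *\<^sub>R axis 1 1 + z $ 2 *\<^sub>R axis 2 1" for z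
    by (simp add: planar_def vec_eq_iff forall_2 axis_def)
  have "((\<lambda>t. x t $ 1 *\<^sub>R axis 1 1 + x t $ 2 *\<^sub>R (axis 2 1 :: real ^ 2)) has_vector_derivative
     ((\<omega> * x t $ 3) *\<^sub>R axis 1 1 + (\<omega> * x t $ 4) *\<^sub>R (axis 2 1 :: real ^ 2))) (at t within {a..b})"
    using * by (intro has_vector_derivative_add has_vector_derivative_scaleR[where g = "\<lambda>_. axis i 1" and g' = 0 for i, simplified]) blast+
  then have d: "((\<lambda>t. planar (x t)) has_vector_derivative
     ((\<omega> * x t $ 3) *\<^sub>R axis 1 1 + (\<omega> * x t $ 4) *\<^sub>R (axis 2 1 :: real ^ 2))) (at t within {a..b})"
    unfolding p .
  have "((\<lambda>y. E y $ j) \<circ> (\<lambda>t. planar (x t)) has_vector_derivative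
     (\<lambda>h :: real ^ 2. pd 1 (\<lambda>y. E y $ j) (planar (x t)) * h $ 1 + pd 2 (\<lambda>y. E y $ j) (planar (x t)) * h $ 2)
       ((\<omega> * x t $ 3) *\<^sub>R axis 1 1 + (\<omega> * x t $ 4) *\<^sub>R (axis 2 1 :: real ^ 2))) (at t within {a..b})"
    by (rule vector_derivative_diff_chain_within[OF d has_derivative_at_withinI[OF smooth_bounds_has_derivative[OF sb]]])
  then show ?thesis
    by (simp add: has_real_derivative_iff_has_vector_derivative o_def axis_def)
qed

text \<open>
  \<open>p - \<epsilon>\<^sup>2 J E y\<close> removes the oscillating forcing: its derivative contains \<open>E\<close> only through
  \<open>\<epsilon>\<^sup>2 (E y)' = O(p)\<close>, so \<open>p\<close> stays of order \<open>\<epsilon>\<close> although \<open>E\<close> is of order one.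
\<close>

lemma exact_momentum_bound:
  assumes sb: "smooth_bounds E k L" and k: "1 \<le> k" and \<epsilon>: "0 < \<epsilon>" "\<epsilon> \<le> 1" and T: "0 \<le> T"
    and g: "gyro (1 / \<epsilon>\<^sup>2) 0 T x (\<lambda>t. E (planar (x t)) $ 1) (\<lambda>t. E (planar (x t)) $ 2)"
    and Q: "\<And>t j. t \<in> {0..T} \<Longrightarrow> (E (planar (x t)) $ j)\<^sup>2 \<le> Q"
    and G: "\<And>t i j. t \<in> {0..T} \<Longrightarrow> \<bar>pd i (\<lambda>y. E y $ j) (planar (x t))\<bar> \<le> G"
    and r: "\<bar>x 0 $ 3\<bar> \<le> r * \<epsilon>" "\<bar>x 0 $ 4\<bar> \<le> r * \<epsilon>" and t: "t \<in> {0..T}"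
  shows "(x t $ 3)\<^sup>2 + (x t $ 4)\<^sup>2
    \<le> (2 * ((4 * r\<^sup>2 + 4 * Q + 16 * G\<^sup>2 * Q * T) * exp ((1 + 8 * G\<^sup>2) * T)) + 4 * Q) * \<epsilon>\<^sup>2"
proof -
  let ?E = "\<lambda>j t. E (planar (x t)) $ j"
  define u1 where "u1 t = x t $ 3 - \<epsilon>\<^sup>2 * ?E 2 t" for t
  define u2 where "u2 t = x t $ 4 + \<epsilon>\<^sup>2 * ?E 1 t" for t
  \<comment> \<open>\<open>h j\<close> is \<open>\<epsilon>\<^sup>2\<close> times the time
    derivative of force component \<open>j\<close>, with the frequency cancelled.\<close>
  define h where "h j t = pd 1 (\<lambda>y. E y $ j) (planar (x t)) * x t $ 3 + pd 2 (\<lambda>y. E y $ j) (planar (x t)) * x t $ 4" for j t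
  have Q0: "0 \<le> Q" using Q[OF t, of 1] zero_le_power2[of "?E 1 t"] by linarith
  have G0: "0 \<le> G" using G[OF t, of 1 1] by linarith
  \<comment> \<open>The source must be of order \<open>\<epsilon>\<^sup>2\<close> in the squared
    momentum; the correction terms contribute even \<open>\<epsilon> ^ 4\<close>.\<close>
  have \<epsilon>4: "\<epsilon> ^ 4 \<le> \<epsilon>\<^sup>2" using \<epsilon> by (intro power_decreasing) auto
  have E4: "(\<epsilon>\<^sup>2 * ?E j s)\<^sup>2 \<le> Q * \<epsilon> ^ 4" if "s \<in> {0..T}" for j s
    using mult_right_mono[OF Q[OF that, of j], of "\<epsilon> ^ 4"] by (simp add: power_mult_distrib mult.commute flip: power_mult)
  have xu: "(x s $ 3)\<^sup>2 + (x s $ 4)\<^sup>2 \<le> 2 * ((u1 s)\<^sup>2 + (u2 s)\<^sup>2) + 4 * Q * \<epsilon> ^ 4" if s: "s \<in> {0..T}" for s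
    using sq_add_le[of "u1 s" "\<epsilon>\<^sup>2 * ?E 2 s"] sq_add_le[of "u2 s" "- (\<epsilon>\<^sup>2 * ?E 1 s)"] E4[OF s, of 1] E4[OF s, of 2]
    by (simp add: u1_def u2_def)
  have hb: "(h j s)\<^sup>2 \<le> 2 * G\<^sup>2 * ((x s $ 3)\<^sup>2 + (x s $ 4)\<^sup>2)" if s: "s \<in> {0..T}" for j s
  proof -
    have G2: "(pd i (\<lambda>y. E y $ j) (planar (x s)))\<^sup>2 \<le> G\<^sup>2" for i
      using G[OF s, of i j] G0 abs_le_square_iff[of _ G] by simp
    have "(h j s)\<^sup>2 \<le> 2 * ((pd 1 (\<lambda>y. E y $ j) (planar (x s)))\<^sup>2 * (x s $ 3)\<^sup>2)
        + 2 * ((pd 2 (\<lambda>y. E y $ j) (planar (x s)))\<^sup>2 * (x s $ 4)\<^sup>2)"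
      unfolding h_def power_mult_distrib[symmetric] by (rule sq_add_le)
    also have "\<dots> \<le> 2 * (G\<^sup>2 * (x s $ 3)\<^sup>2) + 2 * (G\<^sup>2 * (x s $ 4)\<^sup>2)"
      by (intro add_mono mult_left_mono mult_right_mono G2) auto
    finally show ?thesis by (simp add: algebra_simps)
  qed
  define U where "U s = (u1 s)\<^sup>2 + (u2 s)\<^sup>2" for s
  have "U t \<le> (U 0 + (16 * G\<^sup>2 * Q * \<epsilon>\<^sup>2) * (t - 0)) * exp ((1 + 8 * G\<^sup>2) * (t - 0))"
  proof (rule gronwall_linear[where b = T])
    fix s assume s: "s \<in> {0..T}"
    note * = g[unfolded gyro_def, rule_format, OF s]
    note ** = force_has_derivative[OF sb k g s]
    have \<omega>: "\<epsilon>\<^sup>2 * (p * (1 / \<epsilon>\<^sup>2 * c) + q * (1 / \<epsilon>\<^sup>2 * d)) = p * c + q * d" for p q c d :: real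
      using \<epsilon> by (simp add: field_simps)
    \<comment> \<open>The force is absorbed into the rotation:
      \<open>1 / \<epsilon>\<^sup>2 * u2\<close> is \<open>1 / \<epsilon>\<^sup>2 * x $ 4\<close>
      plus the first force component. The same happens in \<open>d2\<close>, and the rotation then
      drops out of \<open>U\<close>.\<close>
    have d1: "(u1 has_real_derivative 1 / \<epsilon>\<^sup>2 * u2 s - h 2 s) (at s within {0..T})"
      unfolding u1_def[abs_def]
      by (rule DERIV_cong[OF DERIV_diff[OF *[THEN conjunct2, THEN conjunct2, THEN conjunct1] DERIV_cmult[OF **]]])
        (use \<epsilon> in \<open>simp only: \<omega> h_def u2_def, simp add: field_simps\<close>)
    have d2: "(u2 has_real_derivative - (1 / \<epsilon>\<^sup>2 * u1 s) + h 1 s) (at s within {0..T})"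
      unfolding u2_def[abs_def]
      by (rule DERIV_cong[OF DERIV_add[OF *[THEN conjunct2, THEN conjunct2, THEN conjunct2] DERIV_cmult[OF **]]])
        (use \<epsilon> in \<open>simp only: \<omega> h_def u1_def, simp add: field_simps\<close>)
    show "(U has_real_derivative 2 * u2 s * h 1 s - 2 * u1 s * h 2 s) (at s within {0..T})"
      unfolding U_def[abs_def]
      by (rule derivative_eq_intros d1 d2 refl)+ (simp add: algebra_simps)
    have "2 * u2 s * h 1 s - 2 * u1 s * h 2 s \<le> U s + (h 1 s)\<^sup>2 + (h 2 s)\<^sup>2"
      using sum_squares_bound[of "u2 s" "h 1 s"] sum_squares_bound[of "- u1 s" "h 2 s"] by (simp add: U_def)
    also have "\<dots> \<le> U s + 4 * G\<^sup>2 * (2 * U s + 4 * Q * \<epsilon> ^ 4)"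
      using hb[OF s, of 1] hb[OF s, of 2] mult_left_mono[OF xu[OF s], of "4 * G\<^sup>2"] by (simp add: U_def)
    also have "\<dots> = (1 + 8 * G\<^sup>2) * U s + 16 * G\<^sup>2 * Q * \<epsilon> ^ 4" by (simp add: algebra_simps)
    also have "\<dots> \<le> (1 + 8 * G\<^sup>2) * U s + 16 * G\<^sup>2 * Q * \<epsilon>\<^sup>2"
      using \<epsilon>4 Q0 by (intro add_left_mono mult_left_mono) auto
    finally show "2 * u2 s * h 1 s - 2 * u1 s * h 2 s \<le> (1 + 8 * G\<^sup>2) * U s + 16 * G\<^sup>2 * Q * \<epsilon>\<^sup>2" .
  qed (use t Q0 in auto)
  also have "\<dots> \<le> ((4 * r\<^sup>2 * \<epsilon>\<^sup>2 + 4 * Q * \<epsilon>\<^sup>2) + (16 * G\<^sup>2 * Q * \<epsilon>\<^sup>2) * T) * exp ((1 + 8 * G\<^sup>2) * T)"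
  proof (intro mult_mono add_mono)
    have 0: "0 \<in> {0..T}" using T by simp
    have "\<And>y. \<bar>y\<bar> \<le> r * \<epsilon> \<Longrightarrow> y\<^sup>2 \<le> r\<^sup>2 * \<epsilon>\<^sup>2"
      using abs_le_square_iff[of _ "r * \<epsilon>"] by (simp add: power_mult_distrib)
    from this[OF r(1)] this[OF r(2)] E4[OF 0, of 1] E4[OF 0, of 2]
    have "U 0 \<le> 4 * (r\<^sup>2 * \<epsilon>\<^sup>2) + 4 * (Q * \<epsilon> ^ 4)"
      using sq_add_le[of "x 0 $ 3" "- (\<epsilon>\<^sup>2 * ?E 2 0)"] sq_add_le[of "x 0 $ 4" "\<epsilon>\<^sup>2 * ?E 1 0"]
      by (simp add: U_def u1_def u2_def)
    also have "\<dots> \<le> 4 * r\<^sup>2 * \<epsilon>\<^sup>2 + 4 * Q * \<epsilon>\<^sup>2"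
      using mult_left_mono[OF \<epsilon>4 Q0] by simp
    finally show "U 0 \<le> 4 * r\<^sup>2 * \<epsilon>\<^sup>2 + 4 * Q * \<epsilon>\<^sup>2" .
  qed (use t Q0 in \<open>auto intro!: mult_left_mono add_nonneg_nonneg\<close>)
  finally have U: "U t \<le> ((4 * r\<^sup>2 + 4 * Q + 16 * G\<^sup>2 * Q * T) * exp ((1 + 8 * G\<^sup>2) * T)) * \<epsilon>\<^sup>2"
    by (simp add: algebra_simps)
  have "(x t $ 3)\<^sup>2 + (x t $ 4)\<^sup>2 \<le> 2 * U t + 4 * Q * \<epsilon> ^ 4" using xu[OF t] by (simp add: U_def)
  also have "\<dots> \<le> 2 * (((4 * r\<^sup>2 + 4 * Q + 16 * G\<^sup>2 * Q * T) * exp ((1 + 8 * G\<^sup>2) * T)) * \<epsilon>\<^sup>2) + 4 * Q * \<epsilon>\<^sup>2"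
    using U \<epsilon>4 Q0 by (intro add_mono mult_left_mono) auto
  finally show ?thesis by (simp add: distrib_right mult.assoc)
qed

lemma exact_bounds:
  assumes sb: "smooth_bounds E k L" and k: "1 \<le> k" and T: "0 \<le> T" and r: "0 \<le> r"
  obtains K where "0 < K" and
    "\<And>\<epsilon> x t. \<lbrakk>0 < \<epsilon>; \<epsilon> \<le> 1;
       gyro (1 / \<epsilon>\<^sup>2) 0 T x (\<lambda>t. E (planar (x t)) $ 1) (\<lambda>t. E (planar (x t)) $ 2);
       \<bar>x 0 $ 1\<bar> \<le> r; \<bar>x 0 $ 2\<bar> \<le> r; \<bar>x 0 $ 3\<bar> \<le> r * \<epsilon>; \<bar>x 0 $ 4\<bar> \<le> r * \<epsilon>; t \<in> {0..T}\<rbrakk>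
     \<Longrightarrow> \<bar>x t $ 1\<bar> \<le> K \<and> \<bar>x t $ 2\<bar> \<le> K \<and> \<bar>x t $ 3\<bar> \<le> K * \<epsilon> \<and> \<bar>x t $ 4\<bar> \<le> K * \<epsilon>"
proof -
  have L: "0 \<le> L" using sb by (simp add: smooth_bounds_def)
  define K1 where "K1 = (10 * r\<^sup>2 + 8 * L\<^sup>2 * T) * exp ((1 + 16 * L\<^sup>2) * T)"
  \<comment> \<open>Bounds the field and, as \<open>k \<ge> 1\<close>, also its first derivatives
    along the trajectory.\<close>
  define G where "G = L * (1 + sqrt (2 * K1))"
  define K2 where "K2 = 2 * ((4 * r\<^sup>2 + 4 * G\<^sup>2 + 16 * G\<^sup>2 * G\<^sup>2 * T) * exp ((1 + 8 * G\<^sup>2) * T)) + 4 * G\<^sup>2"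
  have K1: "0 \<le> K1" using T by (simp add: K1_def)
  have K2: "0 \<le> K2" using T by (simp add: K2_def)
  define K where "K = sqrt (2 * K1) + sqrt K2 + 1"
  have "0 < K" using K1 K2 by (simp add: K_def add_nonneg_pos)
  then show ?thesis
  proof (rule that)
    fix \<epsilon> t :: real and x :: "real \<Rightarrow> real ^ 4"
    assume \<epsilon>: "0 < \<epsilon>" "\<epsilon> \<le> 1"
      and g: "gyro (1 / \<epsilon>\<^sup>2) 0 T x (\<lambda>t. E (planar (x t)) $ 1) (\<lambda>t. E (planar (x t)) $ 2)"
      and x0: "\<bar>x 0 $ 1\<bar> \<le> r" "\<bar>x 0 $ 2\<bar> \<le> r" "\<bar>x 0 $ 3\<bar> \<le> r * \<epsilon>" "\<bar>x 0 $ 4\<bar> \<le> r * \<epsilon>" and t: "t \<in> {0..T}"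
    have "r * \<epsilon> \<le> r" using \<epsilon> r by (simp add: mult_left_le)
    then have x0': "\<bar>x 0 $ i\<bar> \<le> r" for i using exhaust_4[of i] x0 by (elim disjE; hypsubst; linarith)
    have gyro_norm2: "gyro_norm2 (x s) \<le> K1" if "s \<in> {0..T}" for s
      unfolding K1_def by (rule gyro_solution_bounded[OF sb g x0' that])
    have np: "norm (planar (x s)) \<le> sqrt (2 * K1)" if "s \<in> {0..T}" for s
      using norm_planar_le[of "x s"] gyro_norm2[OF that] by (intro real_le_rsqrt) linarith
    have LG: "L * (1 + norm (planar (x s))) \<le> G" if "s \<in> {0..T}" for s
      unfolding G_def using np[OF that] L by (intro mult_left_mono) auto
    have EG: "(E (planar (x s)) $ j)\<^sup>2 \<le> G\<^sup>2" if "s \<in> {0..T}" for s j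
    proof -
      have "\<bar>E (planar (x s)) $ j\<bar> \<le> G" using smooth_bounds_growth[OF sb, of "planar (x s)" j] LG[OF that] by linarith
      then show ?thesis by (metis abs_ge_zero power2_abs power_mono)
    qed
    have PG: "\<bar>pd i (\<lambda>y. E y $ j) (planar (x s))\<bar> \<le> G" if "s \<in> {0..T}" for s i j
    proof -
      have "\<bar>pd i (\<lambda>y. E y $ j) (planar (x s))\<bar> \<le> L * (1 + norm (planar (x s)))"
        using exhaust_2[of i] smooth_bounds_pderiv[OF sb, of 1 0 j] smooth_bounds_pderiv[OF sb, of 0 1 j] k
        by (auto simp: pderiv_mi_def)
      then show ?thesis using LG[OF that] by linarith
    qed
    have p: "(x t $ 3)\<^sup>2 + (x t $ 4)\<^sup>2 \<le> K2 * \<epsilon>\<^sup>2"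
      unfolding K2_def by (rule exact_momentum_bound[OF sb k \<epsilon> T g EG PG x0(3,4) t])
    have p3: "\<bar>x t $ i\<bar> \<le> sqrt K2 * \<epsilon>" if "i = 3 \<or> i = 4" for i
    proof -
      have "\<bar>x t $ i\<bar> \<le> sqrt (K2 * \<epsilon>\<^sup>2)"
        using that p zero_le_power2[of "x t $ 3"] zero_le_power2[of "x t $ 4"]
        by (intro real_le_rsqrt) (elim disjE; hypsubst; unfold power2_abs; linarith)
      then show ?thesis using \<epsilon> by (simp add: real_sqrt_mult)
    qed
    have "sqrt K2 * \<epsilon> \<le> K * \<epsilon>" using \<epsilon> K1 by (intro mult_right_mono) (auto simp: K_def)
    moreover have "\<bar>x t $ i\<bar> \<le> K" for i
    proof -
      have "sqrt (2 * gyro_norm2 (x t)) \<le> sqrt (2 * K1)" using gyro_norm2[OF t] by simp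
      then show ?thesis using gyro_norm2_component[of "x t" i] K2 real_sqrt_ge_zero[OF K2] unfolding K_def by linarith
    qed
    ultimately show "\<bar>x t $ 1\<bar> \<le> K \<and> \<bar>x t $ 2\<bar> \<le> K \<and> \<bar>x t $ 3\<bar> \<le> K * \<epsilon> \<and> \<bar>x t $ 4\<bar> \<le> K * \<epsilon>"
      using p3[of 3] p3[of 4] by (meson order_trans)
  qed
qed

lemma vector_4 [simp]:
  "(vector [a, b, c, d] :: 'a::zero ^ 4) $ 1 = a" "(vector [a, b, c, d] :: 'a::zero ^ 4) $ 2 = b"
  "(vector [a, b, c, d] :: 'a::zero ^ 4) $ 3 = c" "(vector [a, b, c, d] :: 'a::zero ^ 4) $ 4 = d"
  unfolding vector_def by simp_all

section \<open>Global error\<close>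

lemma lle_X_step:
  assumes "0 < \<epsilon>"
  shows "lle_X E k 1 \<epsilon> \<tau> y0 v0 (Suc n) = lle_X E k 1 \<epsilon> \<tau> y0 v0 n
    + Pi_x (lle_flow E k (1 / \<epsilon>\<^sup>2) (lle_X E k 1 \<epsilon> \<tau> y0 v0 n) \<tau>)"
  using assms by (simp add: lle_flow_def Let_def power_int_minus divide_inverse)

lemma solves_cpd_gyro:
  assumes sol: "solves_cpd E \<epsilon> (T / \<epsilon>) y0 v0 y v" and \<epsilon>: "0 < \<epsilon>"
    and x: "x = (\<lambda>t. vector [y (t / \<epsilon>) $ 1, y (t / \<epsilon>) $ 2, \<epsilon> * v (t / \<epsilon>) $ 1, \<epsilon> * v (t / \<epsilon>) $ 2])"
  shows "gyro (1 / \<epsilon>\<^sup>2) 0 T x (\<lambda>t. E (planar (x t)) $ 1) (\<lambda>t. E (planar (x t)) $ 2)"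
  unfolding gyro_def
proof (intro ballI)
  fix t assume t: "t \<in> {0..T}"
  then have s: "t / \<epsilon> \<in> {0..T / \<epsilon>}" using \<epsilon> by (auto intro: divide_right_mono)
  have comp: "((\<lambda>t. f (t / \<epsilon>) $ i) has_real_derivative D $ i / \<epsilon>) (at t within {0..T})"
    if "(f has_vector_derivative D) (at (t / \<epsilon>) within {0..T / \<epsilon>})" for f :: "real \<Rightarrow> real ^ 2" and D i
  proof -
    have "((\<lambda>s. f s $ i) has_real_derivative D $ i) (at (t / \<epsilon>) within {0..T / \<epsilon>})"
      using bounded_linear.has_vector_derivative[OF bounded_linear_vec_nth that]
      by (simp add: has_real_derivative_iff_has_vector_derivative)
    then have "((\<lambda>s. f s $ i) has_real_derivative D $ i) (at (t / \<epsilon>) within (\<lambda>t. t / \<epsilon>) ` {0..T})"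
      using \<epsilon> by (elim has_field_derivative_subset) (auto intro: divide_right_mono)
    then have "((\<lambda>s. f s $ i) \<circ> (\<lambda>t. t / \<epsilon>) has_real_derivative D $ i * (1 / \<epsilon>)) (at t within {0..T})"
      by (rule DERIV_image_chain) (use \<epsilon> in \<open>auto intro!: derivative_eq_intros\<close>)
    then show ?thesis by (simp add: o_def)
  qed
  have pl: "planar (x t) = y (t / \<epsilon>)" by (simp add: x planar_def vec_eq_iff forall_2)
  have J: "(J *v w) $ 1 = w $ 2" "(J *v w) $ 2 = - w $ 1" for w
    by (simp_all add: J_def matrix_vector_mult_def sum_2)
  have y: "(y has_vector_derivative v (t / \<epsilon>)) (at (t / \<epsilon>) within {0..T / \<epsilon>})"
    and v: "(v has_vector_derivative (1 / \<epsilon>) *\<^sub>R (J *v v (t / \<epsilon>)) + E (y (t / \<epsilon>))) (at (t / \<epsilon>) within {0..T / \<epsilon>})"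
    using sol s by (auto simp: solves_cpd_def)
  show "((\<lambda>s. x s $ 1) has_real_derivative 1 / \<epsilon>\<^sup>2 * x t $ 3) (at t within {0..T}) \<and>
    ((\<lambda>s. x s $ 2) has_real_derivative 1 / \<epsilon>\<^sup>2 * x t $ 4) (at t within {0..T}) \<and>
    ((\<lambda>s. x s $ 3) has_real_derivative 1 / \<epsilon>\<^sup>2 * x t $ 4 + E (planar (x t)) $ 1) (at t within {0..T}) \<and>
    ((\<lambda>s. x s $ 4) has_real_derivative - (1 / \<epsilon>\<^sup>2) * x t $ 3 + E (planar (x t)) $ 2) (at t within {0..T})"
    unfolding pl unfolding x vector_4
    by (intro conjI DERIV_cong[OF comp[OF y]] DERIV_cong[OF DERIV_cmult[OF comp[OF v]]])
      (use \<epsilon> in \<open>simp_all add: J field_simps power2_eq_square\<close>)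
qed

lemma force_defect:
  assumes sb: "smooth_bounds E k L" and F: "\<bar>F - E (planar z) $ j\<bar> \<le> \<kappa>"
  shows "(E (planar x) $ j - F)\<^sup>2 \<le> 4 * L\<^sup>2 * gyro_norm2 (x - z) + 2 * \<kappa>\<^sup>2"
proof -
  have L: "0 \<le> L" using sb by (simp add: smooth_bounds_def)
  have \<kappa>: "0 \<le> \<kappa>" using F by linarith
  have "\<bar>E (planar x) $ j - F\<bar> \<le> L * norm (planar (x - z)) + \<kappa>"
    using smooth_bounds_lipschitz[OF sb, of "planar x" j "planar z"] F unfolding planar_diff by linarith
  then have "(E (planar x) $ j - F)\<^sup>2 \<le> (L * norm (planar (x - z)) + \<kappa>)\<^sup>2"
    by (rule abs_le_square_iff[THEN iffD1, OF order_trans]) simp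
  also have "\<dots> \<le> 2 * (L * norm (planar (x - z)))\<^sup>2 + 2 * \<kappa>\<^sup>2" by (rule sq_add_le)
  also have "\<dots> = 2 * L\<^sup>2 * (norm (planar (x - z)))\<^sup>2 + 2 * \<kappa>\<^sup>2" by (simp add: power_mult_distrib)
  also have "\<dots> \<le> 2 * L\<^sup>2 * (2 * gyro_norm2 (x - z)) + 2 * \<kappa>\<^sup>2"
    by (intro add_right_mono mult_left_mono norm_planar_le) auto
  finally show ?thesis by simp
qed

text \<open>On each step the exact trajectory is compared with a curve joining two consecutive
  numerical points. A step adds \<open>8 * \<kappa>\<^sup>2 * \<tau>\<close> to the squared error,
  altogether at most a multiple of \<open>\<kappa>\<^sup>2 * T\<close>. Bounds are requested at
  earlier grid points only, which leaves room for an induction.\<close>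

lemma lle_global_error:
  assumes sb: "smooth_bounds E k L" and k: "1 \<le> k" and M: "0 \<le> M" and R: "0 \<le> R" and T: "0 \<le> T"
  obtains C where "0 < C" and
    "\<And>\<epsilon> \<tau> n x y0 v0 i. \<lbrakk>0 < \<epsilon>; 0 < \<tau>; real n * \<tau> \<le> T;
       gyro (1 / \<epsilon>\<^sup>2) 0 T x (\<lambda>t. E (planar (x t)) $ 1) (\<lambda>t. E (planar (x t)) $ 2);
       x 0 = lle_X E k 1 \<epsilon> \<tau> y0 v0 0;
       \<forall>m<n. \<bar>lle_X E k 1 \<epsilon> \<tau> y0 v0 m $ 1\<bar> \<le> R \<and> \<bar>lle_X E k 1 \<epsilon> \<tau> y0 v0 m $ 2\<bar> \<le> R \<and>
         \<bar>lle_X E k 1 \<epsilon> \<tau> y0 v0 m $ 3\<bar> \<le> M * \<tau> \<and> \<bar>lle_X E k 1 \<epsilon> \<tau> y0 v0 m $ 4\<bar> \<le> M * \<tau>\<rbrakk>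
     \<Longrightarrow> \<bar>(x (real n * \<tau>) - lle_X E k 1 \<epsilon> \<tau> y0 v0 n) $ i\<bar> \<le> C * \<tau> ^ (k + 1)"
proof -
  obtain C0 where C0: "0 < C0" and step:
    "\<And>\<omega> \<tau> x. \<lbrakk>0 < \<tau>; \<tau> \<le> T; \<bar>x $ 3\<bar> \<le> M * \<tau>; \<bar>x $ 4\<bar> \<le> M * \<tau>; \<bar>x $ 1\<bar> \<le> R; \<bar>x $ 2\<bar> \<le> R\<rbrakk> \<Longrightarrow>
      \<exists>z F1 F2. gyro \<omega> 0 \<tau> z F1 F2 \<and> z 0 = x \<and> z \<tau> = x + Pi_x (lle_flow E k \<omega> x \<tau>) \<and>
        (\<forall>s\<in>{0..\<tau>}. \<bar>F1 s - E (vector [z s $ 1, z s $ 2]) $ 1\<bar> \<le> C0 * \<tau> ^ (k + 1) \<and>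
           \<bar>F2 s - E (vector [z s $ 1, z s $ 2]) $ 2\<bar> \<le> C0 * \<tau> ^ (k + 1))"
    by (rule lle_step[OF sb k M R T]) (rule that)
  define c where "c = 1 + 16 * L\<^sup>2"
  define C where "C = sqrt (2 * (8 * C0\<^sup>2 * T * exp (c * T))) + 1"
  have c: "0 \<le> c" by (simp add: c_def)
  have "0 < C" using T by (simp add: C_def add_nonneg_pos)
  then show ?thesis
  proof (rule that)
    fix \<epsilon> \<tau> :: real and n :: nat and x y0 v0 i
    assume \<epsilon>: "0 < \<epsilon>" and \<tau>: "0 < \<tau>" "real n * \<tau> \<le> T"
      and g: "gyro (1 / \<epsilon>\<^sup>2) 0 T x (\<lambda>t. E (planar (x t)) $ 1) (\<lambda>t. E (planar (x t)) $ 2)"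
      and x0: "x 0 = lle_X E k 1 \<epsilon> \<tau> y0 v0 0"
      and bd: "\<forall>m<n. \<bar>lle_X E k 1 \<epsilon> \<tau> y0 v0 m $ 1\<bar> \<le> R \<and> \<bar>lle_X E k 1 \<epsilon> \<tau> y0 v0 m $ 2\<bar> \<le> R \<and>
         \<bar>lle_X E k 1 \<epsilon> \<tau> y0 v0 m $ 3\<bar> \<le> M * \<tau> \<and> \<bar>lle_X E k 1 \<epsilon> \<tau> y0 v0 m $ 4\<bar> \<le> M * \<tau>"
    define X where "X = lle_X E k 1 \<epsilon> \<tau> y0 v0"
    define \<kappa> where "\<kappa> = C0 * \<tau> ^ (k + 1)"
    have "gyro_norm2 (x (real m * \<tau>) - X m) \<le> (real m * (8 * \<kappa>\<^sup>2 * \<tau>)) * exp (c * (real m * \<tau>))" if "m \<le> n" for m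
      using that
    proof (induction m)
      case 0
      then show ?case using x0 by (simp add: X_def gyro_norm2_def)
    next
      case (Suc m)
      have "real (Suc m) * \<tau> \<le> real n * \<tau>" using Suc.prems \<tau>(1) by (intro mult_right_mono) auto
      then have Sm: "real m * \<tau> + \<tau> \<le> T" using \<tau>(2) by (simp add: distrib_right)
      moreover have "0 \<le> real m * \<tau>" using \<tau>(1) by simp
      ultimately have \<tau>T: "\<tau> \<le> T" by linarith
      have b: "\<bar>X m $ 1\<bar> \<le> R \<and> \<bar>X m $ 2\<bar> \<le> R \<and> \<bar>X m $ 3\<bar> \<le> M * \<tau> \<and> \<bar>X m $ 4\<bar> \<le> M * \<tau>"
        using bd Suc.prems unfolding X_def by simp
      obtain z F1 F2 where z: "gyro (1 / \<epsilon>\<^sup>2) 0 \<tau> z F1 F2" "z 0 = X m"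
        "z \<tau> = X m + Pi_x (lle_flow E k (1 / \<epsilon>\<^sup>2) (X m) \<tau>)"
        and F: "\<And>s. s \<in> {0..\<tau>} \<Longrightarrow> \<bar>F1 s - E (planar (z s)) $ 1\<bar> \<le> \<kappa>"
          "\<And>s. s \<in> {0..\<tau>} \<Longrightarrow> \<bar>F2 s - E (planar (z s)) $ 2\<bar> \<le> \<kappa>"
        using step[OF \<tau>(1) \<tau>T, of "X m" "1 / \<epsilon>\<^sup>2"] b unfolding \<kappa>_def planar_def by blast
      let ?t = "real m * \<tau>"
      have gs: "gyro (1 / \<epsilon>\<^sup>2) 0 \<tau> (\<lambda>t. x (?t + t)) (\<lambda>t. E (planar (x (?t + t))) $ 1) (\<lambda>t. E (planar (x (?t + t))) $ 2)"
        using gyro_shift[OF g, of ?t 0 \<tau>] Sm \<tau> by (simp add: distrib_right)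
      have "gyro_norm2 (x (?t + \<tau>) - z \<tau>) \<le> (gyro_norm2 (x (?t + 0) - z 0) + 2 * 1 * (4 * \<kappa>\<^sup>2) * (\<tau> - 0)) * exp ((1 / 1 + 2 * 1 * (8 * L\<^sup>2)) * (\<tau> - 0))"
      proof (rule gyro_energy[OF gyro_diff[OF gs z(1)]])
        fix s assume s: "s \<in> {0..\<tau>}"
        show "(E (planar (x (?t + s))) $ 1 - F1 s)\<^sup>2 + (E (planar (x (?t + s))) $ 2 - F2 s)\<^sup>2
            \<le> 8 * L\<^sup>2 * gyro_norm2 (x (?t + s) - z s) + 4 * \<kappa>\<^sup>2"
          using force_defect[OF sb F(1)[OF s], of "x (?t + s)"] force_defect[OF sb F(2)[OF s], of "x (?t + s)"]
          by simp
      qed (use \<tau> in auto)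
      also have "\<dots> = (gyro_norm2 (x ?t - X m) + 8 * \<kappa>\<^sup>2 * \<tau>) * exp (c * \<tau>)" by (simp add: z(2) c_def)
      also have "\<dots> \<le> (real m * (8 * \<kappa>\<^sup>2 * \<tau>) * exp (c * ?t) + 8 * \<kappa>\<^sup>2 * \<tau> * exp (c * ?t)) * exp (c * \<tau>)"
      proof (intro mult_right_mono add_mono)
        show "gyro_norm2 (x ?t - X m) \<le> real m * (8 * \<kappa>\<^sup>2 * \<tau>) * exp (c * ?t)" using Suc by simp
        have "1 \<le> exp (c * ?t)" using c \<tau> by simp
        then show "8 * \<kappa>\<^sup>2 * \<tau> \<le> 8 * \<kappa>\<^sup>2 * \<tau> * exp (c * ?t)"
          using mult_left_mono[of 1 "exp (c * ?t)" "8 * \<kappa>\<^sup>2 * \<tau>"] \<tau> by simp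
      qed simp
      also have "\<dots> = real (Suc m) * (8 * \<kappa>\<^sup>2 * \<tau>) * exp (c * (real (Suc m) * \<tau>))"
        by (simp add: exp_add algebra_simps)
      finally show ?case unfolding X_def lle_X_step[OF \<epsilon>] using z(3) by (simp add: X_def algebra_simps)
    qed
    from this[of n] have "gyro_norm2 (x (real n * \<tau>) - X n) \<le> (real n * (8 * \<kappa>\<^sup>2 * \<tau>)) * exp (c * (real n * \<tau>))" by simp
    also have "\<dots> = (8 * \<kappa>\<^sup>2) * (real n * \<tau>) * exp (c * (real n * \<tau>))" by simp
    also have "\<dots> \<le> (8 * \<kappa>\<^sup>2) * T * exp (c * T)"
      using \<tau> c T by (intro mult_mono mult_left_mono) (auto intro!: mult_left_mono)
    also have "\<dots> = 8 * C0\<^sup>2 * T * exp (c * T) * (\<tau> ^ (k + 1))\<^sup>2"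
      by (simp add: \<kappa>_def power_mult_distrib algebra_simps)
    finally have "2 * gyro_norm2 (x (real n * \<tau>) - X n) \<le> 2 * (8 * C0\<^sup>2 * T * exp (c * T) * (\<tau> ^ (k + 1))\<^sup>2)"
      by (rule mult_left_mono) simp
    then have "sqrt (2 * gyro_norm2 (x (real n * \<tau>) - X n)) \<le> sqrt ((2 * (8 * C0\<^sup>2 * T * exp (c * T))) * (\<tau> ^ (k + 1))\<^sup>2)"
      by (intro real_sqrt_le_mono) (simp only: mult.assoc)
    also have "\<dots> = sqrt (2 * (8 * C0\<^sup>2 * T * exp (c * T))) * \<tau> ^ (k + 1)"
      using \<tau> by (subst real_sqrt_mult) simp
    also have "\<dots> \<le> C * \<tau> ^ (k + 1)" using \<tau> by (intro mult_right_mono) (auto simp: C_def)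
    finally show "\<bar>(x (real n * \<tau>) - lle_X E k 1 \<epsilon> \<tau> y0 v0 n) $ i\<bar> \<le> C * \<tau> ^ (k + 1)"
      using gyro_norm2_component[of "x (real n * \<tau>) - X n" i] unfolding X_def by linarith
  qed
qed

section \<open>Closing the circle between error bound and boundedness\<close>

theorem theorem3p7:
  fixes T c2 :: real and k :: nat and y0 v0 :: "real ^ 2" and E :: "real ^ 2 \<Rightarrow> real ^ 2"
  assumes "T > 0" and "k \<ge> 1" and "c2 > 0" and "Ck_Lipschitz k E"
  shows "\<exists>\<epsilon>0>0. \<exists>C>0. \<forall>\<epsilon> N. 0 < \<epsilon> \<longrightarrow> \<epsilon> \<le> \<epsilon>0 \<longrightarrow> N \<ge> (1::nat) \<longrightarrow> T / real N > c2 * \<epsilon> \<longrightarrow>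
    (\<forall>y v. solves_cpd E \<epsilon> (T / \<epsilon>) y0 v0 y v \<longrightarrow>
      (\<forall>n\<le>N. norm (y (real n * (T / real N) / \<epsilon>) - lle_pos E k 1 \<epsilon> (T / real N) y0 v0 n)
           + \<epsilon> * norm (v (real n * (T / real N) / \<epsilon>) - lle_vel E k 1 \<epsilon> (T / real N) y0 v0 n)
           \<le> C * (T / real N) ^ (k + 1)))"
proof -
  note k = \<open>k \<ge> 1\<close>
  have T: "0 \<le> T" using \<open>T > 0\<close> by simp
  obtain L where sb: "smooth_bounds E k L" using smooth_bounds_exists[OF assms(4)] .
  define r where "r = \<bar>y0 $ 1\<bar> + \<bar>y0 $ 2\<bar> + \<bar>v0 $ 1\<bar> + \<bar>v0 $ 2\<bar>"
  have r: "0 \<le> r" by (simp add: r_def)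
  define sol where "sol \<epsilon> x \<longleftrightarrow> gyro (1 / \<epsilon>\<^sup>2) 0 T x (\<lambda>t. E (planar (x t)) $ 1) (\<lambda>t. E (planar (x t)) $ 2)
     \<and> x 0 = vector [y0 $ 1, y0 $ 2, \<epsilon> * v0 $ 1, \<epsilon> * v0 $ 2]" for \<epsilon> and x :: "real \<Rightarrow> real ^ 4"
  define X where "X N \<epsilon> = lle_X E k 1 \<epsilon> (T / real N) y0 v0" for N \<epsilon>
  define adm where "adm N \<epsilon> \<longleftrightarrow> 0 < \<epsilon> \<and> \<epsilon> \<le> 1 \<and> 1 \<le> N \<and> c2 * \<epsilon> < T / real N" for N \<epsilon>
  define err where "err N \<epsilon> x n C \<longleftrightarrow>
    (\<forall>i. \<bar>(x (real n * (T / real N)) - X N \<epsilon> n) $ i\<bar> \<le> C * (T / real N) ^ (k + 1))" for N \<epsilon> x n C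
  define bdd where "bdd N \<epsilon> m M R \<longleftrightarrow> \<bar>X N \<epsilon> m $ 1\<bar> \<le> R \<and> \<bar>X N \<epsilon> m $ 2\<bar> \<le> R \<and>
     \<bar>X N \<epsilon> m $ 3\<bar> \<le> M * (T / real N) \<and> \<bar>X N \<epsilon> m $ 4\<bar> \<le> M * (T / real N)" for N \<epsilon> m M R
  obtain K where K: "0 < K" and exact:
    "\<And>\<epsilon> x t. \<lbrakk>0 < \<epsilon>; \<epsilon> \<le> 1;
       gyro (1 / \<epsilon>\<^sup>2) 0 T x (\<lambda>t. E (planar (x t)) $ 1) (\<lambda>t. E (planar (x t)) $ 2);
       \<bar>x 0 $ 1\<bar> \<le> r; \<bar>x 0 $ 2\<bar> \<le> r; \<bar>x 0 $ 3\<bar> \<le> r * \<epsilon>; \<bar>x 0 $ 4\<bar> \<le> r * \<epsilon>; t \<in> {0..T}\<rbrakk>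
     \<Longrightarrow> \<bar>x t $ 1\<bar> \<le> K \<and> \<bar>x t $ 2\<bar> \<le> K \<and> \<bar>x t $ 3\<bar> \<le> K * \<epsilon> \<and> \<bar>x t $ 4\<bar> \<le> K * \<epsilon>"
    by (rule exact_bounds[OF sb k T r]) (rule that)
  have grid: "real n * (T / real N) \<in> {0..T}" if "n \<le> N" "1 \<le> N" for n N
  proof -
    have "real n * (T / real N) \<le> real N * (T / real N)" using that T by (intro mult_right_mono) auto
    then show ?thesis using that T by simp
  qed
  have exact_grid: "\<bar>x (real n * (T / real N)) $ 1\<bar> \<le> K \<and> \<bar>x (real n * (T / real N)) $ 2\<bar> \<le> K
     \<and> \<bar>x (real n * (T / real N)) $ 3\<bar> \<le> (K / c2) * (T / real N) \<and> \<bar>x (real n * (T / real N)) $ 4\<bar> \<le> (K / c2) * (T / real N)"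
    if "adm N \<epsilon>" "sol \<epsilon> x" "n \<le> N" for N \<epsilon> x n
  proof -
    have \<epsilon>: "0 < \<epsilon>" "\<epsilon> \<le> 1" and N: "1 \<le> N" and \<epsilon>N: "c2 * \<epsilon> < T / real N" using that(1) by (auto simp: adm_def)
    have x0: "x 0 = vector [y0 $ 1, y0 $ 2, \<epsilon> * v0 $ 1, \<epsilon> * v0 $ 2]" using that(2) by (simp add: sol_def)
    have "\<bar>x 0 $ 1\<bar> \<le> r" "\<bar>x 0 $ 2\<bar> \<le> r" by (simp_all add: x0 r_def)
    moreover have "\<bar>x 0 $ 3\<bar> \<le> r * \<epsilon>" "\<bar>x 0 $ 4\<bar> \<le> r * \<epsilon>"
      using \<epsilon> by (simp_all add: x0 abs_mult mult.commute[of \<epsilon>] mult_right_mono r_def)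
    ultimately have "\<bar>x (real n * (T / real N)) $ 1\<bar> \<le> K \<and> \<bar>x (real n * (T / real N)) $ 2\<bar> \<le> K
     \<and> \<bar>x (real n * (T / real N)) $ 3\<bar> \<le> K * \<epsilon> \<and> \<bar>x (real n * (T / real N)) $ 4\<bar> \<le> K * \<epsilon>"
      using that(2) exact[OF \<epsilon>] grid[OF that(3) N] unfolding sol_def by blast
    \<comment> \<open>Here the restriction on the step size turns a momentum of order
      \<open>\<epsilon>\<close> into one of order \<open>\<Delta>t\<close>.\<close>
    moreover have "K * \<epsilon> \<le> (K / c2) * (T / real N)"
    proof -
      have "(K / c2) * (c2 * \<epsilon>) \<le> (K / c2) * (T / real N)" using \<epsilon>N K \<open>c2 > 0\<close> by (intro mult_left_mono) auto
      then show ?thesis using \<open>c2 > 0\<close> by simp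
    qed
    ultimately show ?thesis by (meson order_trans)
  qed
  \<comment> \<open>An error \<open>C * \<Delta>t ^ (k + 1)\<close> is
    \<open>C * \<Delta>t ^ k\<close> times the step, so the momentum bound proportional to the step
    survives with a larger factor.\<close>
  have numeric: "bdd N \<epsilon> n (K / c2 + C * (T / real N) ^ k) (K + C * (T / real N) ^ (k + 1))"
    if "adm N \<epsilon>" "sol \<epsilon> x" "n \<le> N" "err N \<epsilon> x n C" for N \<epsilon> x n C
  proof -
    have p: "(K / c2 + C * (T / real N) ^ k) * (T / real N) = (K / c2) * (T / real N) + C * (T / real N) ^ (k + 1)"
      by (simp add: algebra_simps)
    have e: "\<bar>x (real n * (T / real N)) $ i - X N \<epsilon> n $ i\<bar> \<le> C * (T / real N) ^ (k + 1)" for i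
      using that(4) by (simp add: err_def)
    have tri: "\<bar>b\<bar> \<le> B + \<delta>" if "\<bar>a\<bar> \<le> B" "\<bar>a - b\<bar> \<le> \<delta>" for a b B \<delta> :: real
      using that by linarith
    show ?thesis unfolding bdd_def p
      using exact_grid[OF that(1-3)] by (intro conjI tri[OF _ e]) simp_all
  qed
  \<comment> \<open>The constant depends on \<open>M\<close> and \<open>R\<close> but not on
    \<open>N\<close> or \<open>\<epsilon>\<close>; both arguments below rely on this order of
    quantifiers.\<close>
  have conditional: "\<exists>C>0. \<forall>N \<epsilon> x n. adm N \<epsilon> \<longrightarrow> sol \<epsilon> x \<longrightarrow> n \<le> N \<longrightarrow>
      (\<forall>m<n. bdd N \<epsilon> m M R) \<longrightarrow> err N \<epsilon> x n C"
    if MR: "0 \<le> M" "0 \<le> R" for M R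
  proof -
    obtain C where C: "0 < C" and *:
      "\<And>\<epsilon> \<tau> n x y0 v0 i. \<lbrakk>0 < \<epsilon>; 0 < \<tau>; real n * \<tau> \<le> T;
       gyro (1 / \<epsilon>\<^sup>2) 0 T x (\<lambda>t. E (planar (x t)) $ 1) (\<lambda>t. E (planar (x t)) $ 2);
       x 0 = lle_X E k 1 \<epsilon> \<tau> y0 v0 0;
       \<forall>m<n. \<bar>lle_X E k 1 \<epsilon> \<tau> y0 v0 m $ 1\<bar> \<le> R \<and> \<bar>lle_X E k 1 \<epsilon> \<tau> y0 v0 m $ 2\<bar> \<le> R \<and>
         \<bar>lle_X E k 1 \<epsilon> \<tau> y0 v0 m $ 3\<bar> \<le> M * \<tau> \<and> \<bar>lle_X E k 1 \<epsilon> \<tau> y0 v0 m $ 4\<bar> \<le> M * \<tau>\<rbrakk>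
      \<Longrightarrow> \<bar>(x (real n * \<tau>) - lle_X E k 1 \<epsilon> \<tau> y0 v0 n) $ i\<bar> \<le> C * \<tau> ^ (k + 1)"
      by (rule lle_global_error[OF sb k MR T]) (rule that)
    have "err N \<epsilon> x n C" if "adm N \<epsilon>" "sol \<epsilon> x" "n \<le> N"
       "\<forall>m<n. bdd N \<epsilon> m M R" for N \<epsilon> x n
      unfolding err_def X_def
    proof (intro allI *)
      show "real n * (T / real N) \<le> T" using grid[OF that(3)] that(1) by (auto simp: adm_def)
    qed (use that \<open>T > 0\<close> in \<open>auto simp: adm_def sol_def X_def bdd_def\<close>)
    with C show ?thesis by blast
  qed

  \<comment> \<open>The error bound presupposes a bounded numerical solution. For large \<open>N\<close> this is bootstrapped from
    the error bound itself; each of the remaining \<open>N\<close> has its own constant, by induction on the step.\<close>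
  have each_N: "\<exists>C>0. \<forall>\<epsilon> x. adm N \<epsilon> \<longrightarrow> sol \<epsilon> x \<longrightarrow> (\<forall>n\<le>N. err N \<epsilon> x n C)" for N
  proof -
    have "\<exists>C>0. \<forall>\<epsilon> x. adm N \<epsilon> \<longrightarrow> sol \<epsilon> x \<longrightarrow> (\<forall>m\<le>n. err N \<epsilon> x m C)" if "n \<le> N" for n
      using that
    proof (induction n)
      case 0
      have "err N \<epsilon> x 0 1" if "sol \<epsilon> x" for \<epsilon> x
        using that T by (simp add: err_def sol_def X_def)
      then show ?case by (intro exI[of _ 1]) auto
    next
      case (Suc n)
      then obtain C where C: "0 < C" "\<And>\<epsilon> x m. adm N \<epsilon> \<Longrightarrow> sol \<epsilon> x \<Longrightarrow> m \<le> n \<Longrightarrow> err N \<epsilon> x m C"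
        by (meson Suc_leD)
      \<comment> \<open>The errors up to \<open>n\<close> bound the numerical solution up to
        \<open>n\<close>, which is all that the error at \<open>Suc n\<close> requires. These bounds
        depend on \<open>N\<close>, harmless while \<open>N\<close> is fixed.\<close>
      let ?M = "K / c2 + C * (T / real N) ^ k" and ?R = "K + C * (T / real N) ^ (k + 1)"
      have "0 \<le> ?M" "0 \<le> ?R" using K C(1) T \<open>c2 > 0\<close> by (auto intro!: add_nonneg_nonneg mult_nonneg_nonneg)
      from conditional[OF this] obtain C' where C': "0 < C'"
        "\<And>\<epsilon> x m. adm N \<epsilon> \<Longrightarrow> sol \<epsilon> x \<Longrightarrow> m \<le> N \<Longrightarrow>
          (\<forall>j<m. bdd N \<epsilon> j ?M ?R) \<Longrightarrow> err N \<epsilon> x m C'"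
        by blast
      have "err N \<epsilon> x m C'" if a: "adm N \<epsilon>" "sol \<epsilon> x" and m: "m \<le> Suc n" for \<epsilon> x m
      proof (rule C'(2)[OF a])
        show "m \<le> N" using m Suc.prems by simp
        show "\<forall>j<m. bdd N \<epsilon> j ?M ?R"
          using m Suc.prems by (intro allI impI numeric[OF a _ C(2)[OF a]]) auto
      qed
      with C'(1) show ?case by blast
    qed
    from this[of N] show ?thesis by simp
  qed

  have large_N: "\<exists>C>0. \<exists>N0. \<forall>N\<ge>N0. \<forall>\<epsilon> x. adm N \<epsilon> \<longrightarrow> sol \<epsilon> x \<longrightarrow> (\<forall>n\<le>N. err N \<epsilon> x n C)"
  proof -
    \<comment> \<open>A margin of one over the bounds for the exact solution; it fixes
      \<open>C\<close> before \<open>N0\<close> is chosen.\<close>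
    have "0 \<le> K / c2 + 1" "0 \<le> K + 1" using K \<open>c2 > 0\<close> by (auto intro!: add_nonneg_nonneg)
    from conditional[OF this] obtain C where C: "0 < C" and cond:
      "\<And>N \<epsilon> x n. adm N \<epsilon> \<Longrightarrow> sol \<epsilon> x \<Longrightarrow> n \<le> N \<Longrightarrow>
        (\<And>m. m < n \<Longrightarrow> bdd N \<epsilon> m (K / c2 + 1) (K + 1)) \<Longrightarrow> err N \<epsilon> x n C"
      by blast
    \<comment> \<open>Beyond this threshold \<open>T / real N\<close> and
      \<open>C * (T / real N)\<close> are at most one, so with \<open>k \<ge> 1\<close> both
      contributions of the error fit into the margin.\<close>
    define N0 where "N0 = nat \<lceil>(C + 1) * T\<rceil>"
    have "err N \<epsilon> x n C" if "N0 \<le> N" and a: "adm N \<epsilon>" "sol \<epsilon> x" and "n \<le> N" for N \<epsilon> x n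
      using that(4)
    proof (induction n rule: less_induct)
      case (less n)
      let ?\<tau> = "T / real N"
      have N1: "1 \<le> N" using a by (simp add: adm_def)
      have "(C + 1) * T \<le> real N" using that(1) unfolding N0_def by linarith
      then have "C * ?\<tau> + ?\<tau> \<le> 1" using N1 by (simp add: field_simps)
      moreover have \<tau>0: "0 \<le> ?\<tau>" "0 \<le> C * ?\<tau>" using T C by auto
      ultimately have \<tau>1: "?\<tau> \<le> 1" "C * ?\<tau> \<le> 1" by linarith+
      have "?\<tau> ^ k \<le> ?\<tau> ^ 1" using \<tau>0 \<tau>1 k by (intro power_decreasing) auto
      then have ck: "C * ?\<tau> ^ k \<le> 1" using mult_left_mono[of "?\<tau> ^ k" ?\<tau> C] C \<tau>1 by simp
      moreover have "?\<tau> ^ (k + 1) \<le> ?\<tau> ^ k" using \<tau>0 \<tau>1 by (intro power_decreasing) auto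
      ultimately have ck1: "C * ?\<tau> ^ (k + 1) \<le> 1" using mult_left_mono[of "?\<tau> ^ (k + 1)" "?\<tau> ^ k" C] C by linarith
      show ?case
      proof (rule cond[OF a less.prems])
        fix m assume m: "m < n"
        then have "err N \<epsilon> x m C" using less by auto
        then have num: "bdd N \<epsilon> m (K / c2 + C * ?\<tau> ^ k) (K + C * ?\<tau> ^ (k + 1))"
          using m less.prems by (intro numeric[OF a]) auto
        have "(K / c2 + C * ?\<tau> ^ k) * ?\<tau> \<le> (K / c2 + 1) * ?\<tau>"
          using ck \<tau>0 by (intro mult_right_mono) auto
        moreover have "K + C * ?\<tau> ^ (k + 1) \<le> K + 1" using ck1 by simp
        ultimately show "bdd N \<epsilon> m (K / c2 + 1) (K + 1)"
          using num unfolding bdd_def by (meson order_trans)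
      qed
    qed
    with C show ?thesis by blast
  qed

  obtain C1 N0 where C1: "0 < C1" "\<And>N \<epsilon> x n. N0 \<le> N \<Longrightarrow> adm N \<epsilon> \<Longrightarrow> sol \<epsilon> x \<Longrightarrow> n \<le> N \<Longrightarrow> err N \<epsilon> x n C1"
    using large_N by blast
  obtain Cf where Cf: "\<And>N. 0 < Cf N" "\<And>N \<epsilon> x n. adm N \<epsilon> \<Longrightarrow> sol \<epsilon> x \<Longrightarrow> n \<le> N \<Longrightarrow> err N \<epsilon> x n (Cf N)"
    using each_N by metis
  \<comment> \<open>The sum over the finitely many small \<open>N\<close> serves as an upper bound
    for their constants.\<close>
  define C where "C = C1 + (\<Sum>N<N0. Cf N)"
  have sum0: "0 \<le> (\<Sum>N<N0. Cf N)" using Cf(1) by (intro sum_nonneg) (auto intro: less_imp_le)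
  have C: "0 < C" using C1(1) sum0 by (simp add: C_def)
  have err_mono: "err N \<epsilon> x n C" if "err N \<epsilon> x n D" "D \<le> C" for N \<epsilon> x n D
  proof -
    have "D * (T / real N) ^ (k + 1) \<le> C * (T / real N) ^ (k + 1)" using that(2) T by (intro mult_right_mono) auto
    then show ?thesis using that(1) unfolding err_def by (meson order_trans)
  qed
  have all: "err N \<epsilon> x n C" if a: "adm N \<epsilon>" "sol \<epsilon> x" "n \<le> N" for N \<epsilon> x n
  proof (cases "N0 \<le> N")
    case True
    then show ?thesis using C1(2)[OF True a] sum0 by (intro err_mono[of _ _ _ _ C1]) (auto simp: C_def)
  next
    case False
    have "Cf N \<le> (\<Sum>N<N0. Cf N)" using False Cf(1) by (intro member_le_sum) (auto intro: less_imp_le)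
    then show ?thesis using Cf(2)[OF a] C1(1) by (intro err_mono[of _ _ _ _ "Cf N"]) (auto simp: C_def)
  qed

  \<comment> \<open>The threshold for \<open>\<epsilon>\<close> is \<open>1\<close>, as in
    \<open>adm\<close>. Both Euclidean norms are bounded by sums of absolute values, four components
    in all, whence \<open>4 * C\<close>.\<close>
  show ?thesis
  proof (rule exI[of _ 1], intro conjI exI[of _ "4 * C"] allI impI)
    fix \<epsilon> N y v n
    assume \<epsilon>: "0 < \<epsilon>" "\<epsilon> \<le> 1" and N: "1 \<le> (N::nat)" "c2 * \<epsilon> < T / real N"
      and s: "solves_cpd E \<epsilon> (T / \<epsilon>) y0 v0 y v" and n: "n \<le> N"
    define x :: "real \<Rightarrow> real ^ 4" where
      "x = (\<lambda>t. vector [y (t / \<epsilon>) $ 1, y (t / \<epsilon>) $ 2, \<epsilon> * v (t / \<epsilon>) $ 1, \<epsilon> * v (t / \<epsilon>) $ 2])"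
    have "sol \<epsilon> x" using solves_cpd_gyro[OF s \<epsilon>(1) x_def] s by (simp add: sol_def x_def solves_cpd_def)
    moreover have "adm N \<epsilon>" using \<epsilon> N by (simp add: adm_def)
    ultimately have "err N \<epsilon> x n C" using all n by blast
    then have e: "\<bar>x (real n * (T / real N)) $ i - X N \<epsilon> n $ i\<bar> \<le> C * (T / real N) ^ (k + 1)" for i
      by (simp add: err_def)
    let ?s = "real n * (T / real N) / \<epsilon>"
    have "norm (y ?s - lle_pos E k 1 \<epsilon> (T / real N) y0 v0 n)
       \<le> \<bar>x (real n * (T / real N)) $ 1 - X N \<epsilon> n $ 1\<bar> + \<bar>x (real n * (T / real N)) $ 2 - X N \<epsilon> n $ 2\<bar>"
      using norm_le_l1_cart[of "y ?s - lle_pos E k 1 \<epsilon> (T / real N) y0 v0 n"]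
      by (simp add: sum_2 lle_pos_def Let_def x_def X_def)
    moreover have "\<epsilon> * norm (v ?s - lle_vel E k 1 \<epsilon> (T / real N) y0 v0 n)
       \<le> \<bar>x (real n * (T / real N)) $ 3 - X N \<epsilon> n $ 3\<bar> + \<bar>x (real n * (T / real N)) $ 4 - X N \<epsilon> n $ 4\<bar>"
    proof -
      have "\<epsilon> * norm (v ?s - lle_vel E k 1 \<epsilon> (T / real N) y0 v0 n)
         = norm (\<epsilon> *\<^sub>R (v ?s - lle_vel E k 1 \<epsilon> (T / real N) y0 v0 n))"
        using \<epsilon> by simp
      also have "\<epsilon> *\<^sub>R (v ?s - lle_vel E k 1 \<epsilon> (T / real N) y0 v0 n) = \<epsilon> *\<^sub>R v ?s - vector [X N \<epsilon> n $ 3, X N \<epsilon> n $ 4]"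
        using \<epsilon> by (simp add: lle_vel_def Let_def X_def scaleR_diff_right)
      also have "norm \<dots> \<le> \<bar>x (real n * (T / real N)) $ 3 - X N \<epsilon> n $ 3\<bar> + \<bar>x (real n * (T / real N)) $ 4 - X N \<epsilon> n $ 4\<bar>"
        using norm_le_l1_cart[of "\<epsilon> *\<^sub>R v ?s - vector [X N \<epsilon> n $ 3, X N \<epsilon> n $ 4]"]
        by (simp add: sum_2 x_def)
      finally show ?thesis .
    qed
    ultimately show "norm (y ?s - lle_pos E k 1 \<epsilon> (T / real N) y0 v0 n)
       + \<epsilon> * norm (v ?s - lle_vel E k 1 \<epsilon> (T / real N) y0 v0 n) \<le> 4 * C * (T / real N) ^ (k + 1)"
      using e[of 1] e[of 2] e[of 3] e[of 4] by linarith
  qed (use C in auto)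
qed

end
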